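(* Assume the Generalised Riemann Hypothesis for all Dirichlet $L$-functions. Then for each fixed integer $k\ge 1$ and each fixed $\varepsilon\in\{+1,-1\}$, $$|q_{\min}(k,m,\varepsilon)|=O_k\bigl(m(\log m)^2\bigr)\qquad (m\to\infty).$$
   Context: For integers $k,m\ge 1$ and $\varepsilon\in\{+1,-1\}$, $q_{\min}(k,m,\varepsilon)$ is the integer $q\in\mathbb{Z}$ of least absolute value such that $km(m+1)+\varepsilon+2kq$ is a prime number; if both $q$ and $-q$ achieve the minimum absolute value, the positive one is taken. (The paper calls $(k,\varepsilon)$ admissible if $\gcd(\varepsilon,2k)=1$; this holds for all $k\ge1$, $\varepsilon=\pm1$.) *)

theory Defs
  imports
    "HOL-Complex_Analysis.Complex_Analysis"
    "HOL-Computational_Algebra.Primes"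
    "HOL-Library.Landau_Symbols"
begin

definition dirichlet_character :: "nat \<Rightarrow> (nat \<Rightarrow> complex) \<Rightarrow> bool" where
  "dirichlet_character N \<psi> \<longleftrightarrow>
     N > 0 \<and>
     (\<forall>a b. \<psi> (a * b) = \<psi> a * \<psi> b) \<and>
     (\<forall>a. \<psi> (a + N) = \<psi> a) \<and>
     (\<forall>a. \<psi> a \<noteq> 0 \<longleftrightarrow> coprime a N)"

definition principal_character :: "(nat \<Rightarrow> complex) \<Rightarrow> bool" where
  "principal_character \<psi> \<longleftrightarrow> (\<forall>a. \<psi> a \<noteq> 0 \<longrightarrow> \<psi> a = 1)"

text \<open>
  The L-function is the analytic continuation of its Dirichlet series: to the whole plane if
  \<open>\<psi>\<close> is not principal, and to the plane without the simple pole at 1 if it is. By the identity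
  theorem the function is unique, except for its (irrelevant) value at that pole.
\<close>

definition dirichlet_L :: "(nat \<Rightarrow> complex) \<Rightarrow> complex \<Rightarrow> complex" where
  "dirichlet_L \<psi> =
     (SOME f. f holomorphic_on (if principal_character \<psi> then - {1} else UNIV) \<and>
              (\<forall>s. Re s > 1 \<longrightarrow> (\<lambda>n. \<psi> (Suc n) / of_nat (Suc n) powr s) sums f s))"

text \<open>
  Imprimitive characters are included. Their additional Euler factors vanish only on the line
  \<open>Re s = 0\<close>, so in the open critical strip they contribute no zeros beyond those of the
  primitive characters.
\<close>

definition GRH :: bool where
  "GRH \<longleftrightarrow>
     (\<forall>N \<psi> s. dirichlet_character N \<psi> \<and> 0 < Re s \<and> Re s < 1 \<and> dirichlet_L \<psi> s = 0
        \<longrightarrow> Re s = 1 / 2)"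

definition q_val :: "nat \<Rightarrow> nat \<Rightarrow> int \<Rightarrow> int \<Rightarrow> int" where
  "q_val k m \<epsilon> q = int k * int m * (int m + 1) + \<epsilon> + 2 * int k * q"

text \<open>
  The last conjunct is the tie-break between \<open>q\<close> and \<open>-q\<close>.
  Note that \<open>prime\<close> on \<open>int\<close> only holds for positive numbers.
\<close>

definition q_min :: "nat \<Rightarrow> nat \<Rightarrow> int \<Rightarrow> int" where
  "q_min k m \<epsilon> =
     (THE q. prime (q_val k m \<epsilon> q) \<and>
             (\<forall>q'. prime (q_val k m \<epsilon> q') \<longrightarrow> \<bar>q\<bar> \<le> \<bar>q'\<bar>) \<and>
             (prime (q_val k m \<epsilon> (- q)) \<longrightarrow> q \<ge> 0))"

end

theory Submission
  imports Defs "HOL-Number_Theory.Number_Theory" "HOL-Real_Asymp.Real_Asymp"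
begin

text \<open>
  The numbers \<open>k m (m + 1) + \<epsilon> + 2 k q\<close> form the residue class of \<open>X = k m (m + 1) + \<epsilon>\<close> modulo
  \<open>N = 2 k\<close>, and this class is coprime to \<open>N\<close> because \<open>m (m + 1)\<close> is even. So the theorem asks for
  a prime in this class at a distance of \<open>O(sqrt X ln\<^sup>2 X)\<close> from \<open>X\<close>, which is what the prime number
  theorem for arithmetic progressions with the error term of GRH provides.

  Weight the prime powers by a tent function on \<open>[X, X + 2 h]\<close> of height \<open>h\<close>, and let \<open>P = - L'/L\<close>,
  whose Dirichlet coefficients are \<open>\<psi> n * \<Lambda> n\<close>. The Mellin transform of the tent expresses
  \<open>\<Sum>n. \<psi> n * \<Lambda> n * tent n\<close> as an integral of \<open>P\<close> over the line \<open>Re s = 2\<close>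
  (\<open>contour_integral_dseries_tent_kernel\<close>). Under GRH the line can be moved to
  \<open>Re s = 1/2 + \<delta>\<close> with \<open>\<delta> = 1 / ln X\<close>; the only pole on the way is at 1, for the principal
  character, where the integrand has residue \<open>h\<^sup>2\<close> (\<open>GRH_contour_integral_rectpath\<close>). On the new line \<open>P s\<close> is
  \<open>O(ln (\<bar>Im s\<bar> + 3) / \<delta>)\<close> (\<open>GRH_log_deriv_bound\<close>), and the transform of the tent decays for
  \<open>\<bar>Im s\<bar> > X / h\<close> (\<open>norm_tent_kernel_le\<close>), so the integral is \<open>O(h sqrt X ln\<^sup>2 X)\<close>
  (\<open>GRH_tent_sum\<close>). By orthogonality of the characters, the weighted sum over one class has the main
  term \<open>h\<^sup>2\<close>, up to the number of characters. It wins over the error, and over the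
  proper prime powers, once \<open>h = C sqrt X ln\<^sup>2 X\<close> with a large \<open>C\<close>
  (\<open>GRH_primes_in_short_progression\<close>).

  The bound for \<open>P\<close> loses only one factor \<open>1/\<delta>\<close> because the zeros near \<open>s\<close> are divided out one by
  one: there are \<open>O(ln (\<bar>Im s\<bar> + 3))\<close> of them by the maximum principle, and each contributes
  at most \<open>O(1/\<delta>)\<close> (\<open>log_deriv_bound_away_from_zeros\<close>). This uses that \<open>(s - 1) L s\<close> is entire and
  grows polynomially (\<open>entire_multiple_of_L\<close>), and that GRH, which speaks of the open critical strip,
  is complemented by the absence of zeros on the line \<open>Re s = 1\<close>
  (\<open>dirichlet_L_nonzero_line_1\<close>).
\<close>

section \<open>Dirichlet characters\<close>

lemma sum_powers_root_of_unity:
  fixes n j :: nat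
  assumes "n > 0" "j < n"
  shows "(\<Sum>l<n. inverse (exp (2 * of_real pi * \<i> * of_nat l / of_nat n)) ^ j) =
           (if j = 0 then of_nat n else (0::complex))"
proof (cases "j = 0")
  case False
  define z where "z = inverse (exp (2 * of_real pi * \<i> * of_nat j / of_nat n) :: complex)"
  have "\<not> n dvd j"
    using assms False by (auto dest: dvd_imp_le)
  then have z1: "z \<noteq> 1"
    using complex_root_unity_eq_1[of n j] assms by (simp add: z_def)
  have zn: "z ^ n = 1"
    using assms by (simp add: z_def power_inverse complex_root_unity)
  have "(\<Sum>l<n. inverse (exp (2 * of_real pi * \<i> * of_nat l / of_nat n)) ^ j) = (\<Sum>l<n. z ^ l)"
    by (intro sum.cong refl)
       (simp add: z_def power_inverse mult_ac flip: exp_of_nat_mult)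
  also have "\<dots> = 0"
    using z1 zn by (simp add: geometric_sum)
  finally show ?thesis
    using False by simp
qed simp

text \<open>
  The operators \<open>f \<mapsto> (x \<mapsto> f (h x))\<close> on periodic functions commute and, by Euler's theorem,
  have finite order. So a nonzero function is the sum of its projections to the eigenspaces of one
  such operator, and these projections respect all eigenvalue equations that held before. Starting
  from the indicator function of the class of 1 and refining it for one unit after the other, one
  arrives at a common eigenvector, which is a multiple of a character.
\<close>

lemma shift_eigenvector_decomposition:
  fixes f :: "nat \<Rightarrow> complex"
  assumes N: "N > 0" and h: "coprime h N"
    and per: "\<forall>x y. [x = y] (mod N) \<longrightarrow> f x = f y"
    and unit: "\<forall>x. \<not> coprime x N \<longrightarrow> f x = 0"
  shows "\<exists>(P :: nat \<Rightarrow> nat \<Rightarrow> complex) \<omega> n. n > 0 \<and> (\<forall>x. of_nat n * f x = (\<Sum>l<n. P l x)) \<and>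
           (\<forall>l x. P l (h * x) = \<omega> l * P l x) \<and>
           (\<forall>l x y. [x = y] (mod N) \<longrightarrow> P l x = P l y) \<and>
           (\<forall>l x. \<not> coprime x N \<longrightarrow> P l x = 0) \<and>
           (\<forall>l b c. (\<forall>x. f (b * x) = c * f x) \<longrightarrow> (\<forall>x. P l (b * x) = c * P l x))"
proof -
  define n where "n = totient N"
  have n: "n > 0"
    using N by (simp add: n_def)
  define \<omega> :: "nat \<Rightarrow> complex" where "\<omega> l = exp (2 * of_real pi * \<i> * of_nat l / of_nat n)" for l
  define P where "P l x = (\<Sum>j<n. inverse (\<omega> l) ^ j * f (h ^ j * x))" for l x
  have \<omega>: "\<omega> l \<noteq> 0" "\<omega> l ^ n = 1" for l
    using n by (simp_all add: \<omega>_def complex_root_unity)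
  show ?thesis
  proof (intro exI conjI allI impI)
    show "n > 0" by fact
    show "of_nat n * f x = (\<Sum>l<n. P l x)" for x
    proof -
      have "(\<Sum>l<n. P l x) = (\<Sum>j<n. (\<Sum>l<n. inverse (\<omega> l) ^ j) * f (h ^ j * x))"
        unfolding P_def by (subst sum.swap) (simp add: sum_distrib_right)
      also have "\<dots> = (\<Sum>j<n. if j = 0 then of_nat n * f x else 0)"
        by (intro sum.cong refl) (use n in \<open>auto simp: \<omega>_def sum_powers_root_of_unity\<close>)
      finally show ?thesis
        using n by simp
    qed
    show "P l (h * x) = \<omega> l * P l x" for l x
    proof -
      define t where "t j = inverse (\<omega> l) ^ j * f (h ^ j * x)" for j
      have "[h ^ n * x = 1 * x] (mod N)"
        unfolding n_def using h by (intro cong_mult euler_theorem) auto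
      then have tn: "t n = t 0"
        using per[rule_format, of "h ^ n * x" x] \<omega>[of l] by (simp add: t_def power_inverse)
      have "P l (h * x) = (\<Sum>j<n. \<omega> l * t (Suc j))"
        unfolding P_def t_def using \<omega>[of l]
        by (intro sum.cong refl) (simp add: field_simps)
      also have "\<dots> = \<omega> l * (\<Sum>j<n. t (Suc j))"
        by (simp add: sum_distrib_left)
      also have "(\<Sum>j<n. t (Suc j)) = (\<Sum>j<n. t j)"
        using tn sum.lessThan_Suc[of t n] sum.lessThan_Suc_shift[of t n] by simp
      finally show ?thesis
        by (simp add: P_def t_def)
    qed
    show "P l x = P l y" if "[x = y] (mod N)" for l x y
      unfolding P_def using that
      by (intro sum.cong refl arg_cong2[where f = "(*)"] per[rule_format] cong_mult) auto
    show "P l x = 0" if "\<not> coprime x N" for l x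
      unfolding P_def using that by (intro sum.neutral ballI) (auto intro!: unit[rule_format])
    show "P l (b * x) = c * P l x" if "\<forall>x. f (b * x) = c * f x" for l b c x
    proof -
      have "f (h ^ j * (b * x)) = c * f (h ^ j * x)" for j
        using that[rule_format, of "h ^ j * x"] by (simp add: mult_ac)
      then show ?thesis
        by (simp add: P_def sum_distrib_left mult_ac)
    qed
  qed
qed

lemma common_shift_eigenvector:
  fixes N g :: nat
  assumes N: "N > 0" and g: "coprime g N" "\<not> [g = 1] (mod N)"
    and S: "finite S" "\<forall>h \<in> S. coprime h N"
  shows "\<exists>f c x0. (\<forall>x y. [x = y] (mod N) \<longrightarrow> f x = f y) \<and> (\<forall>x. \<not> coprime x N \<longrightarrow> f x = 0) \<and>
           f x0 \<noteq> (0::complex) \<and> (\<forall>h \<in> insert g S. \<forall>x. f (h * x) = c h * f x) \<and> c g \<noteq> 1"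
  using S
proof (induction S rule: finite_induct)
  case empty
  define f :: "nat \<Rightarrow> complex" where "f x = (if [x = 1] (mod N) then 1 else 0)" for x
  have per: "\<forall>x y. [x = y] (mod N) \<longrightarrow> f x = f y"
    unfolding f_def by (meson cong_sym cong_trans)
  have unit: "\<forall>x. \<not> coprime x N \<longrightarrow> f x = 0"
    using cong_imp_coprime[of 1 _ N] by (auto simp: f_def cong_sym_eq)
  obtain P :: "nat \<Rightarrow> nat \<Rightarrow> complex" and \<omega> n where "n > (0::nat)"
    "\<forall>x. of_nat n * f x = (\<Sum>l<n. P l x)"
    "\<forall>l x. P l (g * x) = \<omega> l * P l x"
    "\<forall>l x y. [x = y] (mod N) \<longrightarrow> P l x = P l y"
    "\<forall>l x. \<not> coprime x N \<longrightarrow> P l x = 0"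
    "\<forall>l b c. (\<forall>x. f (b * x) = c * f x) \<longrightarrow> (\<forall>x. P l (b * x) = c * P l x)"
    using shift_eigenvector_decomposition[where f = f, OF N g(1) per unit] by (elim exE conjE) (rule that)
  note P = this[rule_format]
  \<comment> \<open>\<open>f\<close> is not invariant under the shift by \<open>g\<close>, so it is not its own projection to the eigenvalue 1.\<close>
  have "\<exists>l x. \<omega> l \<noteq> 1 \<and> P l x \<noteq> 0"
  proof (rule ccontr)
    assume "\<not> ?thesis"
    then have "P l (g * x) = P l x" for l x
      using P(3)[of l x] by (cases "\<omega> l = 1") auto
    then have "of_nat n * f (g * 1) = of_nat n * f 1"
      by (simp only: P(2))
    then have "f g = f 1"
      using P(1) by simp
    then show False
      using g(2) by (auto simp: f_def split: if_splits)
  qed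
  then obtain l x0 where "\<omega> l \<noteq> 1" "P l x0 \<noteq> 0"
    by blast
  then show ?case
    using P by (intro exI[of _ "P l"] exI[of _ "\<lambda>_. \<omega> l"] exI[of _ x0]) auto
next
  case (insert h S)
  then have "\<forall>h \<in> S. coprime h N" and hN: "coprime h N"
    by blast+
  from insert.IH[OF this(1)] obtain f :: "nat \<Rightarrow> complex" and c x0 where
    "\<forall>x y. [x = y] (mod N) \<longrightarrow> f x = f y" "\<forall>x. \<not> coprime x N \<longrightarrow> f x = 0" "f x0 \<noteq> 0"
    "\<forall>b \<in> insert g S. \<forall>x. f (b * x) = c b * f x" "c g \<noteq> 1"
    by (elim exE conjE) (rule that)
  note f0 = this and f = this[rule_format]
  obtain P :: "nat \<Rightarrow> nat \<Rightarrow> complex" and \<omega> n where "n > (0::nat)"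
    "\<forall>x. of_nat n * f x = (\<Sum>l<n. P l x)"
    "\<forall>l x. P l (h * x) = \<omega> l * P l x"
    "\<forall>l x y. [x = y] (mod N) \<longrightarrow> P l x = P l y"
    "\<forall>l x. \<not> coprime x N \<longrightarrow> P l x = 0"
    "\<forall>l b c. (\<forall>x. f (b * x) = c * f x) \<longrightarrow> (\<forall>x. P l (b * x) = c * P l x)"
    using shift_eigenvector_decomposition[where f = f, OF N hN f0(1,2)] by (elim exE conjE) (rule that)
  note P = this[rule_format]
  have "(\<Sum>l<n. P l x0) \<noteq> 0"
    using P(1,2) f(3) by (metis mult_eq_0_iff neq0_conv of_nat_eq_0_iff)
  then obtain l where l: "P l x0 \<noteq> 0"
    by (meson sum.neutral)
  have *: "P l (b * x) = c b * P l x" if "b \<in> insert g S" for b x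
    using P(6)[of b "c b"] f(4)[OF that] by blast
  have eq: "P l (b * x) = (c(h := if h \<in> insert g S then c h else \<omega> l)) b * P l x"
    if "b \<in> insert g (insert h S)" for b x
    using that *[of b x] P(3)[of l x] by auto
  show ?case
    by (rule exI[of _ "P l"], rule exI[of _ "c(h := if h \<in> insert g S then c h else \<omega> l)"],
        rule exI[of _ x0]) (use eq P(4,5) l f(5) in auto)
qed

lemma dirichlet_characterD:
  assumes "dirichlet_character N \<psi>"
  shows "N > 0" "\<psi> (a * b) = \<psi> a * \<psi> b" "\<psi> (a + N) = \<psi> a" "\<psi> a \<noteq> 0 \<longleftrightarrow> coprime a N"
    "\<psi> 1 = 1" "\<psi> (a ^ n) = \<psi> a ^ n"
    "[x = y] (mod N) \<Longrightarrow> \<psi> x = \<psi> y"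
proof -
  show N: "N > 0" and mult: "\<And>a b. \<psi> (a * b) = \<psi> a * \<psi> b"
    and per: "\<And>a. \<psi> (a + N) = \<psi> a" and "\<psi> a \<noteq> 0 \<longleftrightarrow> coprime a N"
    using assms unfolding dirichlet_character_def by blast+
  have "\<psi> 1 \<noteq> 0"
    using assms unfolding dirichlet_character_def by auto
  then show one: "\<psi> 1 = 1"
    using mult[of 1 1] by simp
  show "\<psi> (a ^ n) = \<psi> a ^ n"
    using mult one by (induction n) auto
  have per': "\<psi> (a + k * N) = \<psi> a" for a k
  proof (induction k)
    case (Suc k)
    show ?case
      using per[of "a + k * N"] Suc by (simp add: algebra_simps)
  qed simp
  have "\<psi> (z mod N) = \<psi> z" for z
    using per'[of "z mod N" "z div N"] by (simp add: mult.commute)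
  then show "[x = y] (mod N) \<Longrightarrow> \<psi> x = \<psi> y"
    unfolding cong_def by metis
qed

lemma dirichlet_character_norm:
  assumes "dirichlet_character N \<psi>" "coprime a N"
  shows "norm (\<psi> a) = 1" "\<psi> a ^ totient N = 1"
proof -
  have "\<psi> (a ^ totient N) = \<psi> 1"
    using assms by (intro dirichlet_characterD(7)[OF assms(1)] euler_theorem) auto
  then show *: "\<psi> a ^ totient N = 1"
    using dirichlet_characterD(5,6)[OF assms(1)] by simp
  then have "norm (\<psi> a) ^ totient N = 1"
    by (metis norm_one norm_power)
  moreover have "totient N > 0"
    using dirichlet_characterD(1)[OF assms(1)] by simp
  ultimately show "norm (\<psi> a) = 1"
    by (metis norm_ge_zero power_eq_1_iff neq0_conv real_norm_def abs_norm_cancel)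
qed

lemma dirichlet_character_norm_le:
  assumes "dirichlet_character N \<psi>"
  shows "norm (\<psi> a) \<le> 1"
  using dirichlet_character_norm(1)[OF assms, of a] dirichlet_characterD(4)[OF assms, of a]
  by (cases "coprime a N") auto

lemma dirichlet_character_mult:
  assumes "dirichlet_character N \<psi>" "dirichlet_character N \<xi>"
  shows "dirichlet_character N (\<lambda>a. \<psi> a * \<xi> a)"
  using assms unfolding dirichlet_character_def by auto

lemma dirichlet_character_cnj:
  assumes "dirichlet_character N \<psi>"
  shows "dirichlet_character N (\<lambda>a. cnj (\<psi> a))"
  using assms unfolding dirichlet_character_def by auto

lemma finite_dirichlet_characters: "finite {\<psi>. dirichlet_character N \<psi>}"
proof (cases "N > 0")
  case True
  define B where "B = insert 0 {z::complex. z ^ totient N = 1}"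
  define F where "F = {f::nat \<Rightarrow> complex. \<forall>x. (x \<in> {..<N} \<longrightarrow> f x \<in> B) \<and> (x \<notin> {..<N} \<longrightarrow> f x = 0)}"
  have "finite B"
    using True by (auto simp: B_def intro!: finite_roots_unity Suc_leI)
  then have "finite F"
    unfolding F_def by (intro finite_set_of_finite_funs) auto
  moreover have "(\<lambda>\<psi> x. if x < N then \<psi> x else 0) ` {\<psi>. dirichlet_character N \<psi>} \<subseteq> F"
    using dirichlet_character_norm(2) dirichlet_characterD(4)
    by (fastforce simp: F_def B_def)
  moreover have "inj_on (\<lambda>\<psi> x. if x < N then \<psi> x else 0) {\<psi>. dirichlet_character N \<psi>}"
  proof (rule inj_onI, clarsimp)
    fix \<psi> \<xi> assume *: "dirichlet_character N \<psi>" "dirichlet_character N \<xi>"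
      and eq: "(\<lambda>x. if x < N then \<psi> x else 0) = (\<lambda>x. if x < N then \<xi> x else 0)"
    show "\<psi> = \<xi>"
    proof
      fix x
      have "\<psi> (x mod N) = \<xi> (x mod N)"
        using fun_cong[OF eq, of "x mod N"] True by simp
      then show "\<psi> x = \<xi> x"
        using *[THEN dirichlet_characterD(7), of "x mod N" x] by (simp add: cong_def)
    qed
  qed
  ultimately show ?thesis
    by (meson finite_imageD finite_subset)
qed (auto simp: dirichlet_character_def)

text \<open>
  The common eigenvector is determined by its value at one unit \<open>x0\<close>, so its quotient by that value
  is a character; it takes at \<open>g\<close> the eigenvalue of the shift by \<open>g\<close>, which was chosen different from 1.
\<close>

lemma dirichlet_character_separating:
  assumes N: "N > 0" and g: "coprime g N" "\<not> [g = 1] (mod N)"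
  obtains \<psi> where "dirichlet_character N \<psi>" "\<psi> g \<noteq> 1"
proof -
  have "\<forall>h \<in> {h. h < N \<and> coprime h N}. coprime h N"
    by blast
  moreover have "finite {h. h < N \<and> coprime h N}"
    by simp
  ultimately have "\<exists>f c x0. (\<forall>x y. [x = y] (mod N) \<longrightarrow> f x = f y) \<and> (\<forall>x. \<not> coprime x N \<longrightarrow> f x = 0) \<and>
           f x0 \<noteq> (0::complex) \<and> (\<forall>h \<in> insert g {h. h < N \<and> coprime h N}. \<forall>x. f (h * x) = c h * f x) \<and> c g \<noteq> 1"
    by (intro common_shift_eigenvector[OF N g])
  then
  obtain f :: "nat \<Rightarrow> complex" and c x0 where
    "\<forall>x y. [x = y] (mod N) \<longrightarrow> f x = f y" "\<forall>x. \<not> coprime x N \<longrightarrow> f x = 0" "f x0 \<noteq> 0"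
    "\<forall>h \<in> insert g {h. h < N \<and> coprime h N}. \<forall>x. f (h * x) = c h * f x" and cg: "c g \<noteq> 1"
    by (elim exE conjE) (rule that)
  note f = this(1-3)[rule_format] and eig = this(4)[rule_format]
  define \<psi> where "\<psi> a = f (a * x0) / f x0" for a
  have x0: "coprime x0 N"
    using f(2,3) by blast
  have eig': "f (a * x) = \<psi> a * f x" if "coprime a N" for a x
  proof -
    have *: "f (a * y) = c (a mod N) * f y" for y
    proof -
      have "f (a * y) = f (a mod N * y)"
        by (rule f(1)) (simp add: cong_def mod_mult_left_eq)
      also have "\<dots> = c (a mod N) * f y"
        using that N by (intro eig) (auto simp: coprime_mod_left_iff)
      finally show ?thesis .
    qed
    show ?thesis
      using f(3) *[of x] *[of x0] by (simp add: \<psi>_def)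
  qed
  have \<psi>0: "\<psi> a = 0" if "\<not> coprime a N" for a
    using that x0 f(2) by (simp add: \<psi>_def)
  have mult: "\<psi> (a * b) = \<psi> a * \<psi> b" for a b
  proof (cases "coprime a N")
    case True
    then show ?thesis
      using eig'[of a "b * x0"] by (simp add: \<psi>_def mult.assoc)
  qed (simp add: \<psi>0)
  have nz: "\<psi> a \<noteq> 0" if "coprime a N" for a
  proof -
    have one: "\<psi> 1 = 1"
      using f(3) by (simp add: \<psi>_def)
    have "\<psi> (a ^ k) = \<psi> a ^ k" for k
      by (induction k) (use one in \<open>simp_all add: mult\<close>)
    moreover have "\<psi> (a ^ totient N) = \<psi> 1"
      using f(1)[OF cong_scalar_right[OF euler_theorem[OF that], of x0]] by (simp add: \<psi>_def)
    ultimately show ?thesis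
      using N one by (auto simp: zero_power)
  qed
  have "\<psi> (a + N) = \<psi> a" for a
  proof -
    have "f ((a + N) * x0) = f (a * x0)"
      by (rule f(1)) (simp add: cong_def algebra_simps)
    then show ?thesis
      by (simp add: \<psi>_def)
  qed
  then have "dirichlet_character N \<psi>"
    unfolding dirichlet_character_def using N mult nz \<psi>0 by blast
  moreover have "\<psi> g \<noteq> 1"
    using eig[of g x0] cg f(3) by (simp add: \<psi>_def)
  ultimately show thesis
    using that by blast
qed

text \<open>
  If \<open>n\<close> and \<open>a\<close> are incongruent units, some character separates them. Multiplication by this character
  permutes the summands and multiplies the sum by a number other than 1.
\<close>

theorem dirichlet_character_orthogonality:
  assumes N: "N > 0" and a: "coprime a N"
  shows "(\<Sum>\<psi> | dirichlet_character N \<psi>. cnj (\<psi> a) * \<psi> n) =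
           (if [n = a] (mod N) then of_nat (card {\<psi>. dirichlet_character N \<psi>}) else 0)"
proof (cases "[n = a] (mod N)")
  case True
  have "cnj (\<psi> a) * \<psi> n = 1" if "dirichlet_character N \<psi>" for \<psi>
    using dirichlet_character_norm(1)[OF that a] dirichlet_characterD(7)[OF that True]
    by (simp add: complex_norm_square[symmetric] mult.commute)
  then show ?thesis
    using True by simp
next
  case False
  show ?thesis
  proof (cases "coprime n N")
    case True
    obtain b where "[n * b = Suc 0] (mod N)"
      using cong_solve_coprime_nat[OF True] by blast
    then have b: "[b * n = 1] (mod N)"
      by (simp add: mult.commute)
    have "coprime (b * n) N"
      using cong_imp_coprime[OF cong_sym[OF b]] by simp
    then have cb: "coprime b N"
      by simp
    have "\<not> [b * a = 1] (mod N)"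
    proof
      assume "[b * a = 1] (mod N)"
      then have "[b * n = b * a] (mod N)"
        using b by (meson cong_sym cong_trans)
      then show False
        using False cb by (simp add: cong_mult_lcancel_nat)
    qed
    moreover have "coprime (b * a) N"
      using cb a by simp
    ultimately obtain \<psi>' where \<psi>': "dirichlet_character N \<psi>'" "\<psi>' (b * a) \<noteq> 1"
      using dirichlet_character_separating[OF N] by metis
    define S where "S = (\<Sum>\<psi> | dirichlet_character N \<psi>. cnj (\<psi> a) * \<psi> n)"
    have inv: "cnj (\<psi>' m) * (\<psi>' m * \<xi> m) = \<xi> m" "\<psi>' m * (cnj (\<psi>' m) * \<xi> m) = \<xi> m"
      "cnj (\<psi>' m) * (\<psi>' m * cnj (\<xi> m)) = cnj (\<xi> m)" if "dirichlet_character N \<xi>" for m \<xi>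
    proof -
      have *: "cnj (\<psi>' m) * \<psi>' m = 1 \<or> \<xi> m = 0"
        using dirichlet_character_norm(1)[OF \<psi>'(1), of m] dirichlet_characterD(4)[OF that, of m]
        by (cases "coprime m N") (auto simp: complex_norm_square[symmetric] mult.commute)
      then show "cnj (\<psi>' m) * (\<psi>' m * \<xi> m) = \<xi> m" "\<psi>' m * (cnj (\<psi>' m) * \<xi> m) = \<xi> m"
        "cnj (\<psi>' m) * (\<psi>' m * cnj (\<xi> m)) = cnj (\<xi> m)"
        by (auto simp flip: mult.assoc simp: mult.commute[of "\<psi>' m" "cnj (\<psi>' m)"])
    qed
    have "S = (\<Sum>\<psi> | dirichlet_character N \<psi>. cnj (\<psi>' a * \<psi> a) * (\<psi>' n * \<psi> n))"
      unfolding S_def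
    proof (rule sum.reindex_bij_witness[where i = "\<lambda>\<psi> m. \<psi>' m * \<psi> m" and j = "\<lambda>\<psi> m. cnj (\<psi>' m) * \<psi> m"],
        goal_cases)
      case (5 \<psi>)
      then have "dirichlet_character N \<psi>"
        by simp
      then show ?case
        by (simp only: complex_cnj_mult complex_cnj_cnj inv)
    qed (use \<psi>' in \<open>auto intro!: dirichlet_character_mult dirichlet_character_cnj simp: inv\<close>)
    also have "\<dots> = (cnj (\<psi>' a) * \<psi>' n) * S"
      by (simp add: S_def sum_distrib_left mult_ac)
    finally have "S = 0 \<or> cnj (\<psi>' a) * \<psi>' n = 1"
      by auto
    moreover have "cnj (\<psi>' a) * \<psi>' n \<noteq> 1"
    proof
      assume *: "cnj (\<psi>' a) * \<psi>' n = 1"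
      have "\<psi>' a * (cnj (\<psi>' a) * \<psi>' n) = \<psi>' n"
        using dirichlet_character_norm(1)[OF \<psi>'(1) a]
        by (simp add: complex_norm_square[symmetric] flip: mult.assoc)
      then have "\<psi>' a = \<psi>' n"
        using * by simp
      then have "\<psi>' (b * a) = \<psi>' (b * n)"
        using dirichlet_characterD(2)[OF \<psi>'(1)] by simp
      also have "\<dots> = 1"
        using dirichlet_characterD(5)[OF \<psi>'(1)] dirichlet_characterD(7)[OF \<psi>'(1) b] by simp
      finally show False
        using \<psi>'(2) by simp
    qed
    ultimately show ?thesis
      using False by (simp add: S_def)
  next
    case ncop: False
    have "cnj (\<psi> a) * \<psi> n = 0" if "dirichlet_character N \<psi>" for \<psi>
      using dirichlet_characterD(4)[OF that, of n] ncop by auto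
    then have "(\<Sum>\<psi> | dirichlet_character N \<psi>. cnj (\<psi> a) * \<psi> n) = 0"
      by (intro sum.neutral) blast
    then show ?thesis
      using False by simp
  qed
qed

section \<open>Analytic continuation of Dirichlet L-functions\<close>

lemma holomorphic_series:
  assumes S: "open S" and hol: "\<And>n::nat. f n holomorphic_on S"
    and dom: "\<And>x. x \<in> S \<Longrightarrow> \<exists>d h. 0 < d \<and> summable h \<and> (\<forall>n. \<forall>y \<in> ball x d \<inter> S. norm (f n y) \<le> h n)"
  obtains g where "g holomorphic_on S" "\<And>s. s \<in> S \<Longrightarrow> (\<lambda>n. f n s) sums g s"
    "\<And>s. s \<in> S \<Longrightarrow> (\<lambda>n. deriv (f n) s) sums deriv g s"
proof -
  have "(f n has_field_derivative deriv (f n) x) (at x)" if "x \<in> S" for n x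
    using holomorphic_derivI[OF hol S that] .
  moreover have "\<exists>d h. 0 < d \<and> summable h \<and> (\<forall>\<^sub>F n in sequentially. \<forall>y \<in> ball x d \<inter> S. norm (f n y) \<le> h n)" if xS: "x \<in> S" for x
  proof -
    obtain d h where "0 < d" "summable h" "\<forall>n. \<forall>y \<in> ball x d \<inter> S. norm (f n y) \<le> h n"
      using dom[OF xS] by blast
    then show ?thesis
      by (intro exI[of _ d] exI[of _ h]) (auto intro!: always_eventually)
  qed
  ultimately obtain g g' where g: "\<forall>x \<in> S. ((\<lambda>n. f n x) sums g x) \<and> ((\<lambda>n. deriv (f n) x) sums g' x) \<and> (g has_field_derivative g' x) (at x)"
    using series_and_derivative_comparison_local[OF S, of f "\<lambda>n. deriv (f n)"] by blast
  then have "g holomorphic_on S"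
    using S holomorphic_on_open by blast
  then show thesis
    using that g DERIV_imp_deriv by metis
qed

text \<open>
  The series over the progression \<open>N n + r\<close> is, up to a factor \<open>N powr (- s)\<close>, the Hurwitz zeta
  function at \<open>r / N\<close>; L-functions modulo \<open>N\<close> are linear combinations of such series.
\<close>

locale progression =
  fixes N r :: nat
  assumes N: "N \<ge> 1" and r: "r \<ge> 1"
begin

definition x :: "nat \<Rightarrow> real" where
  "x n = real (N * n + r)"

lemma x_ge: "x n \<ge> real n + 1"
proof -
  have "n + 1 \<le> N * n + r"
    using N r by (intro add_mono) auto
  then show ?thesis
    unfolding x_def by (metis of_nat_1 of_nat_add of_nat_mono)
qed

lemma x_Suc: "x (Suc n) = x n + real N"
  by (simp add: x_def algebra_simps)

lemma x_pos: "x n > 0" and x_ge_1: "x n \<ge> 1"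
  using x_ge[of n] by linarith+

lemma summable_x_powr:
  assumes "p > 1"
  shows "summable (\<lambda>n. x n powr (- p))"
proof (rule summable_comparison_test')
  have "summable (\<lambda>n. real n powr (- p))"
    using assms by (subst summable_real_powr_iff) auto
  then show "summable (\<lambda>n. (real n + 1) powr (- p))"
    using summable_Suc_iff[of "\<lambda>n. real n powr (- p)"] by (simp add: add.commute)
  show "norm (x n powr (- p)) \<le> (real n + 1) powr (- p)" if "n \<ge> 0" for n
    using x_ge[of n] assms by (simp, intro powr_mono2') auto
qed

definition falling :: "nat \<Rightarrow> complex \<Rightarrow> complex" where
  "falling j w = (\<Prod>l<j. w - of_nat l)"

lemma falling_simps: "falling 0 w = 1" "falling (Suc j) w = falling j w * (w - of_nat j)"
  by (simp_all add: falling_def)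

text \<open>The remainder of the Taylor expansion of \<open>u powr (1 - s)\<close> of order \<open>J\<close> at \<open>x n\<close>, taken at
  \<open>x n + N = x (Suc n)\<close>.\<close>

definition rem :: "nat \<Rightarrow> nat \<Rightarrow> complex \<Rightarrow> complex" where
  "rem J n s = of_real (x (Suc n)) powr (1 - s)
     - (\<Sum>j\<le>J. falling j (1 - s) * of_real (x n) powr (1 - s - of_nat j) * of_nat N ^ j / fact j)"

lemma norm_rem_le:
  assumes "Re s \<ge> - real J"
  shows "norm (rem J n s) \<le> norm (falling (Suc J) (1 - s)) * real N ^ Suc J * x n powr (- Re s - real J)"
proof -
  define f where "f j u = falling j (1 - s) * u powr (1 - s - of_nat j)" for j u
  define S where "S = closed_segment (of_real (x n)) (of_real (x (Suc n)) :: complex)"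
  have SE: "\<exists>t. u = of_real t \<and> t \<ge> x n" if "u \<in> S" for u
    using that x_Suc[of n] unfolding S_def closed_segment_of_real
    by (auto simp: closed_segment_eq_real_ivl)
  define B where "B = norm (falling (Suc J) (1 - s)) * x n powr (- Re s - real J)"
  have "norm (f 0 (of_real (x (Suc n))) - (\<Sum>i\<le>J. f i (of_real (x n)) * (of_real (x (Suc n)) - of_real (x n)) ^ i / fact i))
      \<le> B * norm (of_real (x (Suc n)) - of_real (x n) :: complex) ^ Suc J / fact J"
  proof (rule complex_Taylor[where S = S])
    fix i u assume u: "u \<in> S" "i \<le> J"
    then have "u \<notin> \<real>\<^sub>\<le>\<^sub>0"
      using SE[OF u(1)] x_pos[of n] by auto
    then have "((\<lambda>u. u powr (1 - s - of_nat i)) has_field_derivative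
        (1 - s - of_nat i) * u powr (1 - s - of_nat i - 1)) (at u within S)"
      by (rule has_field_derivative_at_within[OF has_field_derivative_powr])
    from DERIV_cmult[OF this, of "falling i (1 - s)"]
    have "(f i has_field_derivative falling i (1 - s) * ((1 - s - of_nat i) * u powr (1 - s - of_nat i - 1))) (at u within S)"
      unfolding f_def .
    moreover have "falling i (1 - s) * ((1 - s - of_nat i) * u powr (1 - s - of_nat i - 1)) = f (Suc i) u"
      by (simp add: f_def falling_simps diff_diff_eq add_ac)
    ultimately show "(f i has_field_derivative f (Suc i) u) (at u within S)"
      by simp
  next
    fix u assume "u \<in> S"
    then obtain t where t: "u = of_real t" "t \<ge> x n"
      using SE by blast
    have "t powr (- Re s - real J) \<le> x n powr (- Re s - real J)"
      using t x_pos[of n] assms by (intro powr_mono2') auto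
    then show "norm (f (Suc J) u) \<le> B"
      using t x_pos[of n] unfolding f_def B_def norm_mult
      by (intro mult_left_mono) (auto simp: norm_powr_real_powr)
  qed (auto simp: S_def)
  also have "norm (of_real (x (Suc n)) - of_real (x n) :: complex) = real N"
    by (simp add: x_Suc)
  also have "(of_real (x (Suc n)) - of_real (x n) :: complex) = of_nat N"
    by (simp add: x_Suc)
  also have "f 0 (of_real (x (Suc n))) - (\<Sum>i\<le>J. f i (of_real (x n)) * of_nat N ^ i / fact i) = rem J n s"
    by (simp add: f_def rem_def falling_simps)
  also have "B * real N ^ Suc J / fact J \<le> B * real N ^ Suc J / 1"
    by (intro divide_left_mono) (auto simp: B_def fact_ge_1)
  finally show ?thesis
    by (simp add: B_def mult_ac)
qed

lemma holomorphic_falling [holomorphic_intros]: "f holomorphic_on A \<Longrightarrow> (\<lambda>s. falling j (f s)) holomorphic_on A"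
  unfolding falling_def by (intro holomorphic_intros)

lemma holomorphic_x_powr [holomorphic_intros]:
  "f holomorphic_on A \<Longrightarrow> (\<lambda>s. of_real (x n) powr f s) holomorphic_on A"
  using x_pos[of n] by (intro holomorphic_intros) auto

lemma norm_falling_le: "norm (falling j w) \<le> (norm w + real j) ^ j"
proof -
  have "norm (falling j w) \<le> (\<Prod>l<j. norm w + real j)"
    unfolding falling_def prod_norm[symmetric]
  proof (rule prod_mono, safe)
    fix l assume "l < j"
    then show "norm (w - of_nat l) \<le> norm w + real j"
      using norm_triangle_ineq4[of w "of_nat l"] by simp
  qed simp
  then show ?thesis
    by simp
qed

lemma rem_sum_holomorphic:
  assumes J: "J \<ge> 1"
  obtains U where "U holomorphic_on {s. Re s > 1 - real J}"
    "\<And>s. Re s > 1 - real J \<Longrightarrow> (\<lambda>n. rem J n s) sums U s"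
proof -
  have "\<exists>d h. 0 < d \<and> summable h \<and> (\<forall>n. \<forall>y \<in> ball s d \<inter> {s. Re s > 1 - real J}. norm (rem J n y) \<le> h n)"
    if s: "s \<in> {s. Re s > 1 - real J}" for s
  proof -
    define d where "d = (Re s - (1 - real J)) / 2"
    have d: "d > 0"
      using s by (simp add: d_def)
    define C where "C = (norm s + d + 1 + real (Suc J)) ^ Suc J * real N ^ Suc J"
    have "norm (rem J n y) \<le> C * x n powr (- (1 + d))" if y: "y \<in> ball s d" for n y
    proof -
      have ny: "norm (y - s) < d"
        using y by (simp add: dist_norm norm_minus_commute)
      have Re: "Re y \<ge> 1 - real J + d"
        using ny abs_Re_le_cmod[of "y - s"] by (auto simp: d_def field_simps)
      have "norm (1 - y) \<le> norm s + d + 1"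
        using norm_triangle_ineq4[of 1 y] norm_triangle_ineq[of "y - s" s] ny by simp
      then have "norm (falling (Suc J) (1 - y)) \<le> (norm s + d + 1 + real (Suc J)) ^ Suc J"
        by (intro order_trans[OF norm_falling_le] power_mono add_right_mono) auto
      moreover have "x n powr (- Re y - real J) \<le> x n powr (- (1 + d))"
        using Re x_ge_1[of n] by (intro powr_mono) auto
      ultimately have "norm (falling (Suc J) (1 - y)) * real N ^ Suc J * x n powr (- Re y - real J) \<le> C * x n powr (- (1 + d))"
        unfolding C_def using d by (intro mult_mono) auto
      then show ?thesis
        using norm_rem_le[of J y n] Re d by simp
    qed
    moreover have "summable (\<lambda>n. C * x n powr (- (1 + d)))"
      using d by (intro summable_mult summable_x_powr) auto
    ultimately show ?thesis
      using d by blast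
  qed
  note dom = this
  show thesis
  proof (rule holomorphic_series[of "{s. Re s > 1 - real J}" "rem J"])
    show "open {s. Re s > 1 - real J}"
      by (rule open_halfspace_Re_gt)
    show "rem J n holomorphic_on {s. Re s > 1 - real J}" for n
      unfolding rem_def by (intro holomorphic_intros) auto
    fix g assume "g holomorphic_on {s. Re s > 1 - real J}" "\<And>s. s \<in> {s. Re s > 1 - real J} \<Longrightarrow> (\<lambda>n. rem J n s) sums g s"
    then show thesis
      using that[of g] by simp
  qed (rule dom)
qed

definition Z :: "complex \<Rightarrow> complex" where
  "Z s = (\<Sum>n. of_real (x n) powr (- s))"

lemma Z_sums:
  assumes "Re s > 1"
  shows "(\<lambda>n. of_real (x n) powr (- s)) sums Z s"
proof -
  have "summable (\<lambda>n. norm (of_real (x n) powr (- s)))"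
    using summable_x_powr[OF assms] x_pos by (simp add: norm_powr_real_powr less_imp_le)
  then show ?thesis
    unfolding Z_def by (rule summable_sums[OF summable_norm_cancel])
qed

text \<open>
  Summing the Taylor expansions over the progression: the values at the ends of the steps
  telescope, and the terms of order \<open>j\<close> add up to a multiple of \<open>Z (s + j - 1)\<close>. For \<open>j = 1\<close> this is a
  multiple of \<open>Z s\<close> itself, so that \<open>Z s\<close> is expressed by values of \<open>Z\<close> further to the right.
\<close>

lemma Z_recursion:
  assumes s: "Re s > 1" and J: "J \<ge> 1" and U: "(\<lambda>n. rem J n s) sums U"
  shows "of_nat N * (s - 1) * Z s = U + of_real (x 0) powr (1 - s)
     + (\<Sum>j=2..J. falling j (1 - s) * of_nat N ^ j / fact j * Z (s + of_nat j - 1))"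
proof -
  define c where "c j = falling j (1 - s) * of_nat N ^ j / fact j" for j
  have "(\<lambda>n. x n powr (1 - Re s)) \<longlonglongrightarrow> 0"
  proof (rule tendsto_neg_powr)
    show "filterlim x at_top sequentially"
      by (rule filterlim_at_top_mono[OF filterlim_real_sequentially])
         (use x_ge in \<open>auto intro!: always_eventually order_trans[OF _ x_ge]\<close>)
  qed (use s in auto)
  then have "(\<lambda>n. of_real (x n) powr (1 - s)) \<longlonglongrightarrow> 0"
    using x_pos by (subst tendsto_norm_zero_iff[symmetric]) (simp add: norm_powr_real_powr less_imp_le)
  from telescope_sums[OF this]
  have tele: "(\<lambda>n. of_real (x (Suc n)) powr (1 - s) - of_real (x n) powr (1 - s)) sums (0 - of_real (x 0) powr (1 - s))" .
  have Zj: "(\<lambda>n. c j * of_real (x n) powr (1 - s - of_nat j)) sums (c j * Z (s + of_nat j - 1))" if "j \<ge> 1" for j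
  proof -
    have "Re (s + of_nat j - 1) > 1"
      using s that by simp
    from sums_mult[OF Z_sums[OF this], of "c j"] show ?thesis
      by (simp add: algebra_simps)
  qed
  have rem_eq: "rem J n s = (of_real (x (Suc n)) powr (1 - s) - of_real (x n) powr (1 - s))
      - (\<Sum>j=1..J. c j * of_real (x n) powr (1 - s - of_nat j))" for n
  proof -
    have "{..J} = insert 0 {1..J}"
      by auto
    then show ?thesis
      by (simp add: rem_def c_def falling_simps mult_ac)
  qed
  have "(\<lambda>n. rem J n s) sums (0 - of_real (x 0) powr (1 - s) - (\<Sum>j=1..J. c j * Z (s + of_nat j - 1)))"
    unfolding rem_eq by (intro sums_diff tele sums_sum Zj) auto
  then have "U = 0 - of_real (x 0) powr (1 - s) - (\<Sum>j=1..J. c j * Z (s + of_nat j - 1))"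
    using U sums_unique2 by blast
  also have "{1..J} = insert 1 {2..J}"
    using J by auto
  finally have "U = - (of_real (x 0) powr (1 - s)) - c 1 * Z s - (\<Sum>j=2..J. c j * Z (s + of_nat j - 1))"
    by simp
  moreover have "c 1 = of_nat N * (1 - s)"
    by (simp add: c_def falling_def)
  ultimately have "U = - (of_real (x 0) powr (1 - s)) - of_nat N * (1 - s) * Z s - (\<Sum>j=2..J. c j * Z (s + of_nat j - 1))"
    by metis
  then have "of_nat N * (s - 1) * Z s = U + of_real (x 0) powr (1 - s) + (\<Sum>j=2..J. c j * Z (s + of_nat j - 1))"
    by (simp add: algebra_simps)
  then show ?thesis
    by (simp only: c_def)
qed

text \<open>
  The recursion with \<open>J = K + 1\<close> extends the function from \<open>Re s > 1 - K\<close> to \<open>Re s > - K\<close>. The pole of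
  \<open>Z (s + j - 1)\<close> at \<open>s = 2 - j\<close> is cancelled by the last factor of the falling factorial.
\<close>

lemma continuation_halfplane:
  "\<exists>H. H holomorphic_on {s. Re s > 1 - real K} \<and> (\<forall>s. Re s > 1 \<longrightarrow> H s = of_nat N * (s - 1) * Z s)"
proof (induction K)
  case 0
  have "\<exists>d h. 0 < d \<and> summable h \<and> (\<forall>n. \<forall>y \<in> ball s d \<inter> {s. Re s > 1}. norm (of_real (x n) powr (- y) :: complex) \<le> h n)"
    if s: "s \<in> {s. Re s > 1}" for s
  proof -
    define d where "d = (Re s - 1) / 2"
    have d: "d > 0"
      using s by (simp add: d_def)
    have "norm (of_real (x n) powr (- y) :: complex) \<le> x n powr (- (1 + d))" if y: "y \<in> ball s d" for n y
    proof -
      have "Re y \<ge> 1 + d"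
        using y abs_Re_le_cmod[of "y - s"] by (auto simp: d_def field_simps dist_norm norm_minus_commute)
      then show ?thesis
        using x_ge_1[of n] by (simp add: norm_powr_real_powr powr_mono)
    qed
    then show ?thesis
      using d summable_x_powr[of "1 + d"] by (intro exI[of _ d] exI[of _ "\<lambda>n. x n powr (- (1 + d))"]) auto
  qed
  note dom = this
  obtain g where g: "g holomorphic_on {s. Re s > 1}" "\<And>s. s \<in> {s. Re s > 1} \<Longrightarrow> (\<lambda>n. of_real (x n) powr (- s)) sums g s"
  proof (rule holomorphic_series[of "{s. Re s > 1}" "\<lambda>n s. of_real (x n) powr (- s)"])
    show "open {s. Re s > 1}"
      by (rule open_halfspace_Re_gt)
    show "(\<lambda>s. of_real (x n) powr (- s)) holomorphic_on {s. Re s > 1}" for n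
      by (intro holomorphic_intros)
  qed (rule dom, assumption, rule that)
  have "g s = Z s" if "Re s > 1" for s
    using g(2)[of s] Z_sums[OF that] that sums_unique2 by blast
  then show ?case
    using g(1) by (intro exI[of _ "\<lambda>s. of_nat N * (s - 1) * g s"]) (auto intro!: holomorphic_intros)
next
  case (Suc K)
  then obtain H where H: "H holomorphic_on {s. Re s > 1 - real K}" "\<And>s. Re s > 1 \<Longrightarrow> H s = of_nat N * (s - 1) * Z s"
    by blast
  obtain U where U: "U holomorphic_on {s. Re s > 1 - real (Suc K)}"
    "\<And>s. Re s > 1 - real (Suc K) \<Longrightarrow> (\<lambda>n. rem (Suc K) n s) sums U s"
    using rem_sum_holomorphic[of "Suc K"] by auto
  define G where "G s = U s + of_real (x 0) powr (1 - s)
      - (\<Sum>j=2..Suc K. falling (j - 1) (1 - s) * of_nat N ^ (j - 1) / fact j * H (s + of_nat (j - 1)))" for s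
  have "(\<lambda>s. H (s + of_nat (j - 1))) holomorphic_on {s. Re s > 1 - real (Suc K)}" if "j \<in> {2..Suc K}" for j
    using that by (intro holomorphic_on_compose_gen[OF _ H(1), unfolded o_def] holomorphic_intros) auto
  then have "G holomorphic_on {s. Re s > 1 - real (Suc K)}"
    unfolding G_def by (intro holomorphic_intros U) auto
  moreover have "G s = of_nat N * (s - 1) * Z s" if s: "Re s > 1" for s
  proof -
    have *: "- (falling (j - 1) (1 - s) * of_nat N ^ (j - 1) / fact j * H (s + of_nat (j - 1))) =
        falling j (1 - s) * of_nat N ^ j / fact j * Z (s + of_nat j - 1)" if j: "j \<in> {2..Suc K}" for j
    proof -
      obtain i where i: "j = Suc i"
        using j by (cases j) auto
      define q where "q = s + of_nat i - 1"
      have "H (s + of_nat i) = of_nat N * q * Z (s + of_nat i)"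
        unfolding q_def using s by (intro H(2)) auto
      moreover have "falling j (1 - s) = falling i (1 - s) * (- q)"
        by (simp add: i falling_simps q_def)
      ultimately show ?thesis
        by (simp add: i)
    qed
    have "G s = U s + of_real (x 0) powr (1 - s)
      + (\<Sum>j=2..Suc K. - (falling (j - 1) (1 - s) * of_nat N ^ (j - 1) / fact j * H (s + of_nat (j - 1))))"
      by (simp only: G_def sum_negf) simp
    also have "\<dots> = U s + of_real (x 0) powr (1 - s)
      + (\<Sum>j=2..Suc K. falling j (1 - s) * of_nat N ^ j / fact j * Z (s + of_nat j - 1))"
      using * by (intro arg_cong2[where f = "(+)"] sum.cong refl) blast
    also have "\<dots> = of_nat N * (s - 1) * Z s"
      using Z_recursion[OF s _ U(2)] s by simp
    finally show ?thesis .
  qed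
  ultimately show ?case
    by blast
qed

lemma entire_continuation:
  obtains H where "H holomorphic_on UNIV" "\<And>s. Re s > 1 \<Longrightarrow> H s = of_nat N * (s - 1) * Z s"
proof -
  obtain h where h: "\<And>K. h K holomorphic_on {s. Re s > 1 - real K}"
    "\<And>K s. Re s > 1 \<Longrightarrow> h K s = of_nat N * (s - 1) * Z s"
    using continuation_halfplane by metis
  have agree: "h K s = h L s" if "K \<le> L" "Re s > 1 - real K" for K L s
  proof (rule analytic_continuation_open[where f = "h K" and g = "h L" and s = "{s. Re s > 1}" and s' = "{s. Re s > 1 - real K}"])
    show "h L holomorphic_on {s. Re s > 1 - real K}"
      using that by (intro holomorphic_on_subset[OF h(1)[of L]]) auto
    show "{s. Re s > 1} \<noteq> {}"
      by (auto intro!: exI[of _ 2])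
    show "connected {s. Re s > 1 - real K}"
      by (intro convex_connected convex_halfspace_Re_gt)
  qed (use h that in \<open>auto simp: open_halfspace_Re_gt\<close>)
  \<comment> \<open>The continuations agree on common half-planes, so any index that covers \<open>s\<close> may be chosen.\<close>
  define H where "H s = h (nat \<lceil>2 - Re s\<rceil>) s" for s
  have H_eq: "H s = h K s" if "Re s > 1 - real K" for K s
  proof -
    have "Re s > 1 - real (nat \<lceil>2 - Re s\<rceil>)"
      by linarith
    then show ?thesis
      unfolding H_def using that agree by (metis nat_le_linear)
  qed
  have "H holomorphic_on {s. Re s > 1 - real K}" for K
    by (subst holomorphic_cong[OF refl H_eq]) (use h(1)[of K] in auto)
  then have "H holomorphic_on (\<Union>K. {s. Re s > 1 - real K})"
    by (intro holomorphic_on_UN_open) (auto simp: open_halfspace_Re_gt)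
  also have "(\<Union>K. {s. Re s > 1 - real K}) = UNIV"
  proof safe
    fix s show "s \<in> (\<Union>K. {s. Re s > 1 - real K})"
      by (rule UN_I[of "nat \<lceil>2 - Re s\<rceil>"], simp, simp, linarith)
  qed auto
  finally have "H holomorphic_on UNIV" .
  moreover have "H s = of_nat N * (s - 1) * Z s" if "Re s > 1" for s
    using H_eq[of 0 s] h(2)[of s 0] that by simp
  ultimately show thesis
    using that by blast
qed

text \<open>
  On \<open>Re s > 0\<close> the recursion of order 1 represents \<open>H\<close> by \<open>r powr (1 - s)\<close> and the sum of the
  remainders. That sum vanishes at 1, and it is \<open>O((1 + \<bar>s\<bar>)\<^sup>2)\<close> for \<open>Re s \<ge> 1 / 10\<close>.
\<close>

lemma entire_continuation_growth:
  assumes H: "H holomorphic_on UNIV" "\<And>s. Re s > 1 \<Longrightarrow> H s = of_nat N * (s - 1) * Z s"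
  shows "H 1 = 1" "\<exists>C. \<forall>s. Re s \<ge> 1 / 10 \<longrightarrow> norm (H s) \<le> C * (1 + norm s)\<^sup>2"
proof -
  obtain U where U: "U holomorphic_on {s. Re s > 1 - real 1}"
    "\<And>s. Re s > 1 - real 1 \<Longrightarrow> (\<lambda>n. rem 1 n s) sums U s"
    using rem_sum_holomorphic[of 1] by auto
  have H_eq: "H s = U s + of_real (x 0) powr (1 - s)" if "Re s > 0" for s
  proof (rule analytic_continuation_open[where f = H and g = "\<lambda>s. U s + of_real (x 0) powr (1 - s)" and
        s = "{s. Re s > 1}" and s' = "{s. Re s > 0}"])
    show "{s. Re s > 1} \<noteq> {}"
      by (auto intro!: exI[of _ 2])
    show "connected {s. Re s > 0}"
      by (intro convex_connected convex_halfspace_Re_gt)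
    show "(\<lambda>s. U s + of_real (x 0) powr (1 - s)) holomorphic_on {s. Re s > 0}"
      using U by (intro holomorphic_intros) auto
    show "H z = U z + of_real (x 0) powr (1 - z)" if "z \<in> {s. Re s > 1}" for z
      using H(2)[of z] Z_recursion[of z 1 "U z"] U(2)[of z] that by simp
  qed (use H that in \<open>auto simp: open_halfspace_Re_gt intro: holomorphic_on_subset\<close>)
  define \<sigma> where "\<sigma> = (\<Sum>n. x n powr (- (11 / 10)))"
  have \<sigma>: "(\<lambda>n. x n powr (- (11 / 10))) sums \<sigma>"
    unfolding \<sigma>_def by (intro summable_sums summable_x_powr) auto
  have \<sigma>0: "\<sigma> \<ge> 0"
    unfolding \<sigma>_def using \<sigma> by (intro suminf_nonneg) (auto simp: sums_iff)
  have U_le: "norm (U s) \<le> norm (falling 2 (1 - s)) * real N ^ 2 * \<sigma>" if s: "Re s \<ge> 1 / 10" for s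
  proof -
    have le: "norm (rem 1 n s) \<le> norm (falling 2 (1 - s)) * real N ^ 2 * x n powr (- (11 / 10))" for n
    proof -
      have "norm (rem 1 n s) \<le> norm (falling (Suc 1) (1 - s)) * real N ^ Suc 1 * x n powr (- Re s - real 1)"
        using s by (intro norm_rem_le) auto
      also have "\<dots> \<le> norm (falling (Suc 1) (1 - s)) * real N ^ Suc 1 * x n powr (- (11 / 10))"
        using s x_ge_1[of n] by (intro mult_left_mono powr_mono) auto
      finally show ?thesis
        by (simp add: numeral_2_eq_2)
    qed
    have sm: "summable (\<lambda>n. norm (falling 2 (1 - s)) * real N ^ 2 * x n powr (- (11 / 10)))"
      using \<sigma> by (intro summable_mult) (simp add: sums_iff)
    have "U s = (\<Sum>n. rem 1 n s)"
      using U(2)[of s] s by (simp add: sums_iff)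
    then have "norm (U s) \<le> (\<Sum>n. norm (falling 2 (1 - s)) * real N ^ 2 * x n powr (- (11 / 10)))"
      using norm_suminf_le[OF le sm] by simp
    also have "\<dots> = norm (falling 2 (1 - s)) * real N ^ 2 * \<sigma>"
      using \<sigma> by (subst suminf_mult) (auto simp: sums_iff)
    finally show ?thesis .
  qed
  have "U 1 = 0"
    using U_le[of 1] by (simp add: falling_def numeral_2_eq_2)
  then show "H 1 = 1"
    using H_eq[of 1] x_pos[of 0] by simp
  have "norm (H s) \<le> (real r + real N ^ 2 * \<sigma>) * (1 + norm s)\<^sup>2" if s: "Re s \<ge> 1 / 10" for s
  proof -
    have "falling 2 (1 - s) = (1 - s) * (- s)"
      by (simp add: falling_def numeral_2_eq_2)
    then have "norm (falling 2 (1 - s)) = norm (1 - s) * norm s"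
      by (simp add: norm_mult)
    also have "\<dots> \<le> (1 + norm s) * (1 + norm s)"
      using norm_triangle_ineq4[of 1 s] by (intro mult_mono) auto
    finally have f: "norm (falling 2 (1 - s)) \<le> (1 + norm s)\<^sup>2"
      by (simp add: power2_eq_square)
    have "norm (falling 2 (1 - s)) * (real N ^ 2 * \<sigma>) \<le> (1 + norm s)\<^sup>2 * (real N ^ 2 * \<sigma>)"
      using f \<sigma>0 by (intro mult_right_mono) auto
    then have 1: "norm (U s) \<le> real N ^ 2 * \<sigma> * (1 + norm s)\<^sup>2"
      using U_le[OF s] by (simp add: mult_ac)
    have "norm (of_real (x 0) powr (1 - s) :: complex) = x 0 powr (1 - Re s)"
      using x_pos[of 0] by (simp add: norm_powr_real_powr)
    also have "\<dots> \<le> x 0 powr 1"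
      using s x_ge_1[of 0] by (intro powr_mono) auto
    also have "\<dots> = real r * 1"
      using r by (simp add: x_def)
    also have "\<dots> \<le> real r * (1 + norm s)\<^sup>2"
      by (intro mult_left_mono one_le_power) auto
    finally have 2: "norm (of_real (x 0) powr (1 - s) :: complex) \<le> real r * (1 + norm s)\<^sup>2" .
    have "norm (H s) \<le> norm (U s) + norm (of_real (x 0) powr (1 - s) :: complex)"
      using H_eq[of s] s norm_triangle_ineq by simp
    then show ?thesis
      using 1 2 by (simp add: algebra_simps)
  qed
  then show "\<exists>C. \<forall>s. Re s \<ge> 1 / 10 \<longrightarrow> norm (H s) \<le> C * (1 + norm s)\<^sup>2"
    by blast
qed

end

lemma sum_character_shift:
  assumes "dirichlet_character N \<psi>"
  shows "(\<Sum>i<N. \<psi> (Suc i)) = (\<Sum>i<N. \<psi> i)"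
proof -
  have "\<psi> N = \<psi> 0"
    using dirichlet_characterD(3)[OF assms, of 0] by simp
  then show ?thesis
    using sum.lessThan_Suc[of \<psi> N] sum.lessThan_Suc_shift[of \<psi> N] by simp
qed

lemma sum_nonprincipal_character:
  assumes ch: "dirichlet_character N \<psi>" and np: "\<not> principal_character \<psi>"
  shows "(\<Sum>i<N. \<psi> (Suc i)) = 0"
proof -
  note D = dirichlet_characterD[OF ch]
  obtain g where g: "\<psi> g \<noteq> 0" "\<psi> g \<noteq> 1"
    using np by (auto simp: principal_character_def)
  then have cop: "coprime g N"
    using D(4) by blast
  have bij: "bij_betw (\<lambda>i. g * i mod N) {..<N} {..<N}"
  proof -
    have "inj_on (\<lambda>i. g * i mod N) {..<N}"
    proof (rule inj_onI)
      fix i j assume ij: "i \<in> {..<N}" "j \<in> {..<N}" and "g * i mod N = g * j mod N"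
      then have "[g * i = g * j] (mod N)"
        by (simp add: cong_def)
      then have "[i = j] (mod N)"
        using cop by (simp add: cong_mult_lcancel_nat)
      then show "i = j"
        using ij by (simp add: cong_def)
    qed
    moreover have "(\<lambda>i. g * i mod N) ` {..<N} \<subseteq> {..<N}"
      using D(1) by auto
    ultimately show ?thesis
      by (simp add: bij_betw_def endo_inj_surj)
  qed
  have "\<psi> g * (\<Sum>i<N. \<psi> i) = (\<Sum>i<N. \<psi> (g * i mod N))"
    unfolding sum_distrib_left
    by (intro sum.cong refl) (use D(2) D(7) in \<open>metis cong_mod_left cong_refl\<close>)
  also have "\<dots> = (\<Sum>i<N. \<psi> i)"
    by (rule sum.reindex_bij_betw[OF bij])
  finally have "(\<Sum>i<N. \<psi> i) = 0"
    using g(2) by simp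
  then show ?thesis
    using sum_character_shift[OF ch] by simp
qed

lemma dirichlet_series_summable:
  assumes "dirichlet_character N \<psi>" "Re s > 1"
  shows "summable (\<lambda>n. norm (\<psi> (Suc n) / of_nat (Suc n) powr s))"
proof (rule summable_comparison_test')
  have "summable (\<lambda>n. real n powr (- Re s))"
    using assms by (subst summable_real_powr_iff) auto
  then show "summable (\<lambda>n. real (Suc n) powr (- Re s))"
    by (subst summable_Suc_iff)
  fix n :: nat
  have "norm (of_nat (Suc n) powr s :: complex) = real (Suc n) powr Re s"
    using norm_powr_real_powr[of "of_nat (Suc n)" s] by simp
  moreover have "norm (\<psi> (Suc n)) \<le> 1"
    by (rule dirichlet_character_norm_le[OF assms(1)])
  ultimately show "norm (norm (\<psi> (Suc n) / of_nat (Suc n) powr s)) \<le> real (Suc n) powr (- Re s)"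
    by (simp add: norm_divide powr_minus field_simps del: of_nat_Suc)
qed

text \<open>
  All residue classes contribute the same value at 1, so \<open>E 1\<close> is the mean value of \<open>\<psi>\<close>.
\<close>

lemma exists_entire_multiple_of_L:
  assumes ch: "dirichlet_character N \<psi>"
  obtains E C where "E holomorphic_on UNIV"
    "\<And>s. Re s > 1 \<Longrightarrow> (\<lambda>n. \<psi> (Suc n) / of_nat (Suc n) powr s) sums (E s / (s - 1))"
    "E 1 = 0 \<longleftrightarrow> \<not> principal_character \<psi>"
    "\<And>s. Re s \<ge> 1 / 10 \<Longrightarrow> norm (E s) \<le> C * (1 + norm s)\<^sup>2"
proof -
  note D = dirichlet_characterD[OF ch]
  have prog: "progression N (Suc i)" for i
    using D(1) by unfold_locales auto
  have "\<forall>i. \<exists>H. H holomorphic_on UNIV \<and> (\<forall>s. Re s > 1 \<longrightarrow> H s = of_nat N * (s - 1) * progression.Z N (Suc i) s)"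
    using progression.entire_continuation[OF prog] by metis
  then obtain H where H: "\<And>i. H i holomorphic_on UNIV"
    "\<And>i s. Re s > 1 \<Longrightarrow> H i s = of_nat N * (s - 1) * progression.Z N (Suc i) s"
    by metis
  have H1: "H i 1 = 1" for i
    by (rule progression.entire_continuation_growth(1)[OF prog H])
  have "\<forall>i. \<exists>C. \<forall>s. Re s \<ge> 1 / 10 \<longrightarrow> norm (H i s) \<le> C * (1 + norm s)\<^sup>2"
    using progression.entire_continuation_growth(2)[OF prog H] by blast
  then obtain C where C: "\<And>i s. Re s \<ge> 1 / 10 \<Longrightarrow> norm (H i s) \<le> C i * (1 + norm s)\<^sup>2"
    by metis
  define E where "E s = (\<Sum>i<N. \<psi> (Suc i) * H i s) / of_nat N" for s
  show thesis
  proof (rule that[of E "\<Sum>i<N. C i"])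
    show "E holomorphic_on UNIV"
      unfolding E_def using D(1) by (intro holomorphic_intros H) auto
    fix s :: complex
    {
      assume s: "Re s > 1"
      let ?a = "\<lambda>n. \<psi> (Suc n) / of_nat (Suc n) powr s"
      have per: "\<psi> (n * N + m) = \<psi> m" for n m
        by (rule D(7)) (simp add: cong_def)
      have "(\<lambda>n. \<Sum>i<N. \<psi> (Suc i) * of_real (progression.x N (Suc i) n) powr (- s)) sums (\<Sum>i<N. \<psi> (Suc i) * progression.Z N (Suc i) s)"
        by (intro sums_sum sums_mult progression.Z_sums[OF prog s])
      also have "(\<lambda>n. \<Sum>i<N. \<psi> (Suc i) * of_real (progression.x N (Suc i) n) powr (- s)) = (\<lambda>n. sum ?a {n * N..<n * N + N})"
      proof
        fix n
        have "sum ?a {n * N..<n * N + N} = (\<Sum>i<N. ?a (n * N + i))"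
          using sum.shift_bounds_nat_ivl[of ?a 0 "n * N" N] by (simp add: add.commute atLeast0LessThan)
        also have "\<dots> = (\<Sum>i<N. \<psi> (Suc i) * of_real (progression.x N (Suc i) n) powr (- s))"
        proof (intro sum.cong refl)
          fix i
          have "\<psi> (Suc (n * N + i)) = \<psi> (Suc i)"
            using per[of n "Suc i"] by simp
          then show "?a (n * N + i) = \<psi> (Suc i) * of_real (progression.x N (Suc i) n) powr (- s)"
            by (simp add: progression.x_def[OF prog] powr_minus divide_inverse mult_ac add_ac)
        qed
        finally show "(\<Sum>i<N. \<psi> (Suc i) * of_real (progression.x N (Suc i) n) powr (- s)) = sum ?a {n * N..<n * N + N}"
          by simp
      qed
      also have "(\<Sum>i<N. \<psi> (Suc i) * progression.Z N (Suc i) s) = E s / (s - 1)"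
      proof -
        have "s \<noteq> 1"
          using s by auto
        then have "progression.Z N (Suc i) s = H i s / (of_nat N * (s - 1))" for i
          using H(2)[OF s, of i] D(1) by simp
        then show ?thesis
          by (simp add: E_def sum_divide_distrib)
      qed
      finally have blocks: "(\<lambda>n. sum ?a {n * N..<n * N + N}) sums (E s / (s - 1))" .
      have sm: "summable ?a"
        by (rule summable_norm_cancel[OF dirichlet_series_summable[OF ch s]])
      have "suminf ?a = E s / (s - 1)"
        by (rule sums_unique2[OF sums_group[OF summable_sums[OF sm] D(1)] blocks])
      then show "?a sums (E s / (s - 1))"
        using summable_sums[OF sm] by simp
    }
    {
      assume s: "Re s \<ge> 1 / 10"
      have "norm (E s) \<le> norm (\<Sum>i<N. \<psi> (Suc i) * H i s) / 1"
        unfolding E_def norm_divide using D(1) by (intro divide_left_mono) auto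
      also have "norm (\<Sum>i<N. \<psi> (Suc i) * H i s) \<le> (\<Sum>i<N. C i * (1 + norm s)\<^sup>2)"
      proof (rule sum_norm_le)
        fix i
        have "norm (\<psi> (Suc i) * H i s) \<le> 1 * (C i * (1 + norm s)\<^sup>2)"
          unfolding norm_mult by (intro mult_mono dirichlet_character_norm_le[OF ch] C[OF s]) auto
        then show "norm (\<psi> (Suc i) * H i s) \<le> C i * (1 + norm s)\<^sup>2"
          by simp
      qed
      finally show "norm (E s) \<le> (\<Sum>i<N. C i) * (1 + norm s)\<^sup>2"
        by (simp add: sum_distrib_right)
    }
    show "E 1 = 0 \<longleftrightarrow> \<not> principal_character \<psi>"
    proof (cases "principal_character \<psi>")
      case True
      have "(\<Sum>i<N. \<psi> (Suc i)) = of_real (\<Sum>i<N. Re (\<psi> (Suc i)))"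
      proof -
        have "\<psi> (Suc i) = of_real (Re (\<psi> (Suc i)))" for i
          using True by (cases "\<psi> (Suc i) = 0") (auto simp: principal_character_def)
        then show ?thesis
          by (metis (no_types, lifting) of_real_sum sum.cong)
      qed
      moreover have "(\<Sum>i<N. Re (\<psi> (Suc i))) > 0"
      proof (rule sum_pos2[of _ 0])
        fix i show "Re (\<psi> (Suc i)) \<ge> 0"
          using True by (cases "\<psi> (Suc i) = 0") (auto simp: principal_character_def)
      qed (use D(1) D(5) in auto)
      ultimately have "(\<Sum>i<N. \<psi> (Suc i)) \<noteq> 0"
        by (metis of_real_eq_0_iff less_irrefl)
      then show ?thesis
        using True D(1) by (simp add: E_def H1)
    next
      case False
      then show ?thesis
        using sum_nonprincipal_character[OF ch] by (simp add: E_def H1)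
    qed
  qed
qed

lemma dirichlet_L_continuation:
  assumes ch: "dirichlet_character N \<psi>"
  shows "dirichlet_L \<psi> holomorphic_on (if principal_character \<psi> then - {1} else UNIV)"
    and "Re s > 1 \<Longrightarrow> (\<lambda>n. \<psi> (Suc n) / of_nat (Suc n) powr s) sums dirichlet_L \<psi> s"
proof -
  let ?P = "\<lambda>f. f holomorphic_on (if principal_character \<psi> then - {1} else UNIV) \<and>
     (\<forall>s. Re s > 1 \<longrightarrow> (\<lambda>n. \<psi> (Suc n) / of_nat (Suc n) powr s) sums f s)"
  obtain E where E: "E holomorphic_on UNIV"
    "\<And>s. Re s > 1 \<Longrightarrow> (\<lambda>n. \<psi> (Suc n) / of_nat (Suc n) powr s) sums (E s / (s - 1))"
    "E 1 = 0 \<longleftrightarrow> \<not> principal_character \<psi>"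
    by (rule exists_entire_multiple_of_L[OF ch]) (rule that)
  have "\<exists>f. ?P f"
  proof (cases "principal_character \<psi>")
    case True
    then show "\<exists>f. ?P f"
      using E by (intro exI[of _ "\<lambda>s. E s / (s - 1)"]) (auto intro!: holomorphic_intros intro: holomorphic_on_subset)
  next
    case False
    have "(\<lambda>s. if s = 1 then deriv E 1 else (E s - E 1) / (s - 1)) holomorphic_on UNIV"
      by (intro pole_lemma_open E) auto
    moreover have "(if s = 1 then deriv E 1 else (E s - E 1) / (s - 1)) = E s / (s - 1)" if "Re s > 1" for s
      using that E(3) False by auto
    ultimately show "\<exists>f. ?P f"
      using E(2) False by (intro exI[of _ "\<lambda>s. if s = 1 then deriv E 1 else (E s - E 1) / (s - 1)"]) simp
  qed
  then have "?P (dirichlet_L \<psi>)"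
    unfolding dirichlet_L_def by (rule someI_ex)
  then show "dirichlet_L \<psi> holomorphic_on (if principal_character \<psi> then - {1} else UNIV)"
    and "Re s > 1 \<Longrightarrow> (\<lambda>n. \<psi> (Suc n) / of_nat (Suc n) powr s) sums dirichlet_L \<psi> s"
    by blast+
qed

text \<open>
  Multiplication by \<open>s - 1\<close> makes principal and nonprincipal characters alike: the product is entire,
  and it has polynomial growth away from the half-plane \<open>Re s < 1 / 10\<close>.
\<close>

proposition entire_multiple_of_L:
  assumes ch: "dirichlet_character N \<psi>"
  obtains E C where "E holomorphic_on UNIV" "\<And>s. s \<noteq> 1 \<Longrightarrow> E s = (s - 1) * dirichlet_L \<psi> s"
    "E 1 = 0 \<longleftrightarrow> \<not> principal_character \<psi>"
    "\<And>s. Re s \<ge> 1 / 10 \<Longrightarrow> norm (E s) \<le> C * (1 + norm s)\<^sup>2"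
proof -
  obtain E C where E: "E holomorphic_on UNIV"
    "\<And>s. Re s > 1 \<Longrightarrow> (\<lambda>n. \<psi> (Suc n) / of_nat (Suc n) powr s) sums (E s / (s - 1))"
    "E 1 = 0 \<longleftrightarrow> \<not> principal_character \<psi>"
    "\<And>s. Re s \<ge> 1 / 10 \<Longrightarrow> norm (E s) \<le> C * (1 + norm s)\<^sup>2"
    by (rule exists_entire_multiple_of_L[OF ch]) (rule that)
  have "E s = (s - 1) * dirichlet_L \<psi> s" if "s \<noteq> 1" for s
  proof (rule analytic_continuation_open[where f = E and g = "\<lambda>s. (s - 1) * dirichlet_L \<psi> s" and
        s = "{s. Re s > 1}" and s' = "- {1}"])
    show "{s. Re s > 1} \<noteq> {}"
      by (auto intro!: exI[of _ 2])
    show "connected (- {1::complex})"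
      by (rule connected_punctured_universe) simp
    have "dirichlet_L \<psi> holomorphic_on - {1}"
      by (rule holomorphic_on_subset[OF dirichlet_L_continuation(1)[OF ch]]) auto
    then show "(\<lambda>s. (s - 1) * dirichlet_L \<psi> s) holomorphic_on - {1}"
      by (intro holomorphic_intros)
    fix z assume z: "z \<in> {s. Re s > 1}"
    then have "dirichlet_L \<psi> z = E z / (z - 1)"
      using dirichlet_L_continuation(2)[OF ch] E(2) sums_unique2 by blast
    then show "E z = (z - 1) * dirichlet_L \<psi> z"
      using z by auto
  qed (use E that in \<open>auto simp: open_halfspace_Re_gt intro: holomorphic_on_subset\<close>)
  then show thesis
    using E that by blast
qed

section \<open>Dirichlet series to the right of the line of absolute convergence\<close>

text \<open>
  A growth condition that is preserved by the factors \<open>ln n\<close> of the derivatives and ensures absolute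
  convergence for \<open>Re s > 1\<close>.
\<close>

definition subpolynomial :: "(nat \<Rightarrow> complex) \<Rightarrow> bool" where
  "subpolynomial a \<longleftrightarrow> (\<forall>\<eta>>0. \<exists>C. \<forall>n>0. norm (a n) \<le> C * real n powr \<eta>)"

text \<open>The term for \<open>n = 0\<close> vanishes because of the convention \<open>0 powr z = 0\<close>.\<close>

definition dseries :: "(nat \<Rightarrow> complex) \<Rightarrow> complex \<Rightarrow> complex" where
  "dseries a s = (\<Sum>n. a n * of_nat n powr (- s))"

lemma norm_of_nat_powr: "norm (of_nat n powr s :: complex) = real n powr Re s"
  using norm_powr_real_powr[of "of_nat n" s] by simp

lemma subpolynomialI_bounded:
  assumes "\<And>n. n > 0 \<Longrightarrow> norm (a n) \<le> B"
  shows "subpolynomial a"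
  unfolding subpolynomial_def
proof (intro allI impI exI)
  fix \<eta> :: real and n :: nat assume "\<eta> > 0" "n > 0"
  have "norm (a n) \<le> B * 1"
    using assms[OF \<open>n > 0\<close>] by simp
  also have "\<dots> \<le> B * real n powr \<eta>"
    using \<open>\<eta> > 0\<close> \<open>n > 0\<close> assms[of n] order_trans[OF norm_ge_zero assms[of n]]
    by (intro mult_left_mono ge_one_powr_ge_zero) auto
  finally show "norm (a n) \<le> B * real n powr \<eta>" .
qed

lemma subpolynomial_ln_mult:
  assumes "subpolynomial a"
  shows "subpolynomial (\<lambda>n. a n * of_real (ln (real n)))"
  unfolding subpolynomial_def
proof (intro allI impI)
  fix \<eta> :: real assume \<eta>: "\<eta> > 0"
  then obtain C where C: "\<And>n. n > 0 \<Longrightarrow> norm (a n) \<le> C * real n powr (\<eta> / 2)"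
    using assms half_gt_zero unfolding subpolynomial_def by blast
  have "norm (a n * of_real (ln (real n))) \<le> (C * (2 / \<eta>)) * real n powr \<eta>" if "n > 0" for n
  proof -
    have "\<bar>ln (real n)\<bar> \<le> real n powr (\<eta> / 2) / (\<eta> / 2)"
      using ln_powr_bound[of "real n" "\<eta> / 2"] that \<eta> by simp
    then have "norm (a n * of_real (ln (real n))) \<le> (C * real n powr (\<eta> / 2)) * (real n powr (\<eta> / 2) / (\<eta> / 2))"
      unfolding norm_mult norm_of_real
      using C[OF that] order_trans[OF norm_ge_zero C[OF that]] by (intro mult_mono) auto
    also have "\<dots> = C * (2 / \<eta>) * (real n powr (\<eta> / 2) * real n powr (\<eta> / 2))"
      by simp
    also have "real n powr (\<eta> / 2) * real n powr (\<eta> / 2) = real n powr \<eta>"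
      by (simp flip: powr_add)
    finally show ?thesis .
  qed
  then show "\<exists>C. \<forall>n>0. norm (a n * of_real (ln (real n))) \<le> C * real n powr \<eta>"
    by blast
qed

lemma subpolynomial_comparison:
  assumes "subpolynomial b" "\<And>n. n > 0 \<Longrightarrow> norm (a n) \<le> norm (b n)"
  shows "subpolynomial a"
  using assms unfolding subpolynomial_def by (meson order_trans)

lemma dseries_term_le:
  assumes "subpolynomial a" "\<sigma> > 1"
  obtains h where "summable h" "\<And>n s. Re s \<ge> \<sigma> \<Longrightarrow> norm (a n * of_nat n powr (- s)) \<le> h n"
proof -
  define \<eta> where "\<eta> = (\<sigma> - 1) / 2"
  have \<eta>: "\<eta> > 0"
    using assms by (simp add: \<eta>_def)
  then obtain C where C: "\<And>n. n > 0 \<Longrightarrow> norm (a n) \<le> C * real n powr \<eta>"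
    using assms unfolding subpolynomial_def by blast
  have "summable (\<lambda>n. real n powr (\<eta> - \<sigma>))"
    using assms by (subst summable_real_powr_iff) (auto simp: \<eta>_def field_simps)
  then have "summable (\<lambda>n. C * real n powr (\<eta> - \<sigma>))"
    by (rule summable_mult)
  moreover have "norm (a n * of_nat n powr (- s)) \<le> C * real n powr (\<eta> - \<sigma>)" if s: "Re s \<ge> \<sigma>" for n s
  proof (cases "n = 0")
    case False
    have "real n powr (- Re s) \<le> real n powr (- \<sigma>)"
      using s False by (intro powr_mono) auto
    then have "norm (a n * of_nat n powr (- s)) \<le> (C * real n powr \<eta>) * real n powr (- \<sigma>)"
      unfolding norm_mult norm_of_nat_powr using C[of n] False order_trans[OF norm_ge_zero C[of n]]
      by (intro mult_mono) auto
    then show ?thesis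
      by (simp add: mult.assoc flip: powr_add)
  qed simp
  ultimately show thesis
    using that by blast
qed

lemma dseries_summable:
  assumes "subpolynomial a" "Re s > 1"
  shows "summable (\<lambda>n. norm (a n * of_nat n powr (- s)))" "(\<lambda>n. a n * of_nat n powr (- s)) sums dseries a s"
proof -
  obtain h where h: "summable h" "\<And>n s'. Re s' \<ge> Re s \<Longrightarrow> norm (a n * of_nat n powr (- s')) \<le> h n"
    by (rule dseries_term_le[OF assms]) (rule that)
  show *: "summable (\<lambda>n. norm (a n * of_nat n powr (- s)))"
    by (rule summable_comparison_test'[OF h(1), of 0]) (use h(2)[of s] in simp)
  show "(\<lambda>n. a n * of_nat n powr (- s)) sums dseries a s"
    unfolding dseries_def by (rule summable_sums[OF summable_norm_cancel[OF *]])
qed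

lemma has_field_derivative_dseries:
  assumes a: "subpolynomial a" and s: "Re s > 1"
  shows "(dseries a has_field_derivative - dseries (\<lambda>n. a n * of_real (ln (real n))) s) (at s)"
proof -
  let ?S = "{s. Re s > 1}"
  let ?f = "\<lambda>n s. a n * of_nat n powr (- s)"
  have deriv_f: "(?f n has_field_derivative - (a n * of_real (ln (real n)) * of_nat n powr (- s))) (at s)" for n s
  proof (cases "n = 0")
    case False
    have "((\<lambda>s. a n * exp (- s * of_real (ln (real n)))) has_field_derivative
        - (a n * of_real (ln (real n)) * exp (- s * of_real (ln (real n))))) (at s)"
      by (auto intro!: derivative_eq_intros)
    moreover have "of_nat n powr (- s) = exp (- s * of_real (ln (real n)))" for s :: complex
      using False by (simp add: powr_def Ln_of_nat)
    ultimately show ?thesis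
      by simp
  qed simp
  obtain g where g: "g holomorphic_on ?S" "\<And>s. s \<in> ?S \<Longrightarrow> (\<lambda>n. ?f n s) sums g s"
    "\<And>s. s \<in> ?S \<Longrightarrow> (\<lambda>n. deriv (?f n) s) sums deriv g s"
  proof (rule holomorphic_series[of ?S ?f])
    show "open ?S"
      by (rule open_halfspace_Re_gt)
    show "?f n holomorphic_on ?S" for n
      using deriv_f[of n] open_halfspace_Re_gt[of 1] by (auto simp: holomorphic_on_open)
    fix x assume x: "x \<in> ?S"
    define \<sigma> where "\<sigma> = (1 + Re x) / 2"
    have \<sigma>: "\<sigma> > 1" "Re x - \<sigma> > 0"
      using x by (auto simp: \<sigma>_def field_simps)
    obtain h where h: "summable h" "\<And>n s. Re s \<ge> \<sigma> \<Longrightarrow> norm (?f n s) \<le> h n"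
      by (rule dseries_term_le[OF a \<sigma>(1)]) (rule that)
    have "norm (?f n y) \<le> h n" if "y \<in> ball x (Re x - \<sigma>)" for n y
    proof -
      have "norm (x - y) < Re x - \<sigma>"
        using that by (simp add: dist_norm)
      then show ?thesis
        using abs_Re_le_cmod[of "x - y"] by (intro h(2)) auto
    qed
    then show "\<exists>d h. 0 < d \<and> summable h \<and> (\<forall>n. \<forall>y \<in> ball x d \<inter> ?S. norm (?f n y) \<le> h n)"
      using \<sigma> h(1) by (intro exI[of _ "Re x - \<sigma>"] exI[of _ h]) blast
  qed (rule that)
  have geq: "g z = dseries a z" if "z \<in> ?S" for z
    using sums_unique2[OF g(2)[OF that]] dseries_summable(2)[OF a, of z] that by blast
  have "deriv g s = - dseries (\<lambda>n. a n * of_real (ln (real n))) s"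
  proof -
    have 1: "(\<lambda>n. - (a n * of_real (ln (real n)) * of_nat n powr (- s))) sums deriv g s"
      using g(3)[of s] s DERIV_imp_deriv[OF deriv_f] by simp
    have 2: "(\<lambda>n. - (a n * of_real (ln (real n)) * of_nat n powr (- s))) sums - dseries (\<lambda>n. a n * of_real (ln (real n))) s"
      by (intro sums_minus dseries_summable(2)[OF subpolynomial_ln_mult[OF a] s])
    show ?thesis
      by (rule sums_unique2[OF 1 2])
  qed
  moreover have "(g has_field_derivative deriv g s) (at s)"
    by (rule holomorphic_derivI[OF g(1) open_halfspace_Re_gt]) (use s in simp)
  ultimately have "(g has_field_derivative - dseries (\<lambda>n. a n * of_real (ln (real n))) s) (at s)"
    by simp
  then show ?thesis
    by (rule has_field_derivative_transform_within_open[OF _ open_halfspace_Re_gt[of 1]]) (use s geq in auto)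
qed

text \<open>
  The double series over \<open>(d, m)\<close> converges absolutely and is rearranged according to \<open>n = d m\<close>.
\<close>

lemma dseries_mult:
  assumes a: "subpolynomial a" and b: "subpolynomial b" and s: "Re s > 1"
    and c: "subpolynomial c" "\<And>n. n > 0 \<Longrightarrow> c n = (\<Sum>d | d dvd n. a d * b (n div d))"
  shows "dseries a s * dseries b s = dseries c s"
proof -
  let ?A = "{0<..} :: nat set"
  let ?t = "\<lambda>a n. a n * of_nat n powr (- s) :: complex"
  have t: "(\<lambda>n. norm (?t f n)) summable_on ?A" "infsum (?t f) ?A = dseries f s" if f: "subpolynomial f" for f
  proof -
    note sm = dseries_summable[OF f s]
    have hs: "(?t f has_sum dseries f s) UNIV"
      by (rule norm_summable_imp_has_sum[OF sm])
    have "(\<lambda>n. norm (?t f n)) summable_on UNIV"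
      using norm_summable_imp_summable_on[of "\<lambda>n. norm (?t f n)"] sm(1) by simp
    then show "(\<lambda>n. norm (?t f n)) summable_on ?A"
      by (rule summable_on_subset_banach) simp
    have "infsum (?t f) ?A = infsum (?t f) UNIV"
      by (rule infsum_cong_neutral) auto
    also have "\<dots> = dseries f s"
      by (rule infsumI[OF hs])
    finally show "infsum (?t f) ?A = dseries f s" .
  qed
  let ?F = "\<lambda>(d, m). ?t a d * ?t b m"
  have absF: "(\<lambda>p. norm (?F p)) summable_on ?A \<times> ?A"
    unfolding Infinite_Sum.abs_summable_on_Sigma_iff
  proof (intro conjI ballI)
    fix d assume "d \<in> ?A"
    show "(\<lambda>y. norm (?F (d, y))) summable_on ?A"
      using t(1)[OF b] by (auto simp: norm_mult intro!: summable_on_cmult_right)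
  next
    have eq: "infsum (\<lambda>y. norm (?F (d, y))) ?A = norm (?t a d) * infsum (\<lambda>m. norm (?t b m)) ?A" for d
      by (simp add: norm_mult infsum_cmult_right' mult.assoc)
    have "(\<lambda>d. norm (?t a d) * infsum (\<lambda>m. norm (?t b m)) ?A) summable_on ?A"
      by (rule summable_on_cmult_left[OF t(1)[OF a]])
    moreover have "0 \<le> infsum (\<lambda>m. norm (?t b m)) ?A"
      by (rule infsum_nonneg) simp
    ultimately show "(\<lambda>d. norm (infsum (\<lambda>y. norm (?F (d, y))) ?A)) summable_on ?A"
      unfolding eq by (simp add: norm_mult)
  qed
  then have sumF: "?F summable_on ?A \<times> ?A"
    by (rule abs_summable_summable)
  have bij: "bij_betw (\<lambda>(n, d). (d, n div d)) (Sigma ?A (\<lambda>n. {d. d dvd n})) (?A \<times> ?A)"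
    by (rule bij_betwI[where g = "\<lambda>(d, m). (d * m, d)"]) (auto simp: div_greater_zero_iff dvd_pos_nat dvd_imp_le)
  have "dseries a s * dseries b s = infsum (\<lambda>d. ?t a d * infsum (?t b) ?A) ?A"
    by (simp add: infsum_cmult_left' t[OF a] t[OF b])
  also have "\<dots> = infsum (\<lambda>d. infsum (\<lambda>m. ?F (d, m)) ?A) ?A"
    by (simp add: infsum_cmult_right')
  also have "\<dots> = infsum ?F (?A \<times> ?A)"
    using infsum_Sigma'_banach[of "\<lambda>d m. ?F (d, m)" ?A "\<lambda>_. ?A"] sumF by simp
  also have "\<dots> = infsum (\<lambda>(n, d). ?F (d, n div d)) (Sigma ?A (\<lambda>n. {d. d dvd n}))"
  proof -
    show ?thesis
      using infsum_reindex_bij_betw[OF bij, of ?F] by (simp add: case_prod_unfold)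
  qed
  also have "\<dots> = infsum (\<lambda>n. infsum (\<lambda>d. ?F (d, n div d)) {d. d dvd n}) ?A"
  proof -
    have "(\<lambda>(n, d). ?F (d, n div d)) summable_on (Sigma ?A (\<lambda>n. {d. d dvd n}))"
      using summable_on_reindex_bij_betw[OF bij, of ?F] sumF by (simp add: case_prod_unfold)
    then show ?thesis
      using infsum_Sigma'_banach[of "\<lambda>n d. ?F (d, n div d)" ?A "\<lambda>n. {d. d dvd n}"] by simp
  qed
  also have "\<dots> = infsum (?t c) ?A"
  proof (rule infsum_cong)
    fix n assume n: "n \<in> ?A"
    have "?t a d * ?t b (n div d) = a d * b (n div d) * of_nat n powr (- s)" if dn: "d dvd n" for d
    proof -
      obtain m where m: "n = d * m"
        using dn by (rule dvdE)
      then have "(of_nat n :: complex) powr (- s) = of_nat d powr (- s) * of_nat m powr (- s)"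
        using powr_times_real[of "of_nat d" "of_nat m" "- s"] by simp
      then show ?thesis
        using m n by simp
    qed
    then have "(\<Sum>d | d dvd n. ?t a d * ?t b (n div d)) = (\<Sum>d | d dvd n. a d * b (n div d) * of_nat n powr (- s))"
      by (intro sum.cong refl) blast
    also have "\<dots> = ?t c n"
      using n c(2)[of n] by (simp add: sum_distrib_right)
    finally show "infsum (\<lambda>d. ?F (d, n div d)) {d. d dvd n} = ?t c n"
      using n by simp
  qed
  also have "\<dots> = dseries c s"
    by (rule t(2)[OF c(1)])
  finally show ?thesis .
qed

lemma mangoldt_le_ln: "mangoldt n \<le> ln (real n)" and mangoldt_nonneg: "(mangoldt n :: real) \<ge> 0"
proof -
  show "(mangoldt n :: real) \<ge> 0"
    by (cases "n > 1") (auto simp: mangoldt_def Suc_le_eq dest: primepow_gt_Suc_0)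
  show "mangoldt n \<le> ln (real n)"
  proof (cases "primepow n")
    case True
    then have "n > 1"
      using primepow_gt_Suc_0[of n] by simp
    then have "aprimedivisor n \<le> n" "aprimedivisor n > 0"
      using aprimedivisor_le_nat[of n] aprimedivisor_pos_nat[of n] by auto
    then show ?thesis
      using True by (simp add: mangoldt_def)
  next
    case False
    then show ?thesis
      by (cases "n = 0") (auto simp: mangoldt_def)
  qed
qed

lemma norm_mangoldt [simp]: "norm (mangoldt n :: complex) = mangoldt n"
  by (metis mangoldt_nonneg norm_of_real of_real_mangoldt abs_of_nonneg)

section \<open>The logarithmic derivative of an L-function\<close>

text \<open>The coefficients of \<open>- L'/L\<close>.\<close>

definition log_deriv_coeff :: "(nat \<Rightarrow> complex) \<Rightarrow> nat \<Rightarrow> complex" where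
  "log_deriv_coeff \<psi> n = \<psi> n * mangoldt n"

context
  fixes N \<psi>
  assumes ch: "dirichlet_character N \<psi>"
begin

lemma subpolynomial_character: "subpolynomial \<psi>"
  by (rule subpolynomialI_bounded[OF dirichlet_character_norm_le[OF ch]])

lemma norm_log_deriv_coeff_le: "norm (log_deriv_coeff \<psi> n) \<le> mangoldt n"
  using dirichlet_character_norm_le[OF ch, of n] mangoldt_nonneg[of n]
  by (simp add: log_deriv_coeff_def norm_mult mult_left_le_one_le)

lemma subpolynomial_log_deriv_coeff: "subpolynomial (log_deriv_coeff \<psi>)"
proof (rule subpolynomial_comparison)
  show "subpolynomial (\<lambda>n. 1 * of_real (ln (real n)))"
    by (intro subpolynomial_ln_mult subpolynomialI_bounded[of _ 1]) auto
  show "norm (log_deriv_coeff \<psi> n) \<le> norm (1 * of_real (ln (real n)) :: complex)" if "n > 0" for n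
    using order_trans[OF norm_log_deriv_coeff_le[of n] mangoldt_le_ln[of n]] by simp
qed

lemma dirichlet_L_eq_dseries:
  assumes "Re s > 1"
  shows "dirichlet_L \<psi> s = dseries \<psi> s"
proof -
  have "(\<lambda>n. \<psi> (Suc n) * of_nat (Suc n) powr (- s)) sums (dseries \<psi> s - \<psi> 0 * of_nat 0 powr (- s))"
    using dseries_summable(2)[OF subpolynomial_character assms] by (subst sums_Suc_iff) simp
  then have "(\<lambda>n. \<psi> (Suc n) / of_nat (Suc n) powr s) sums dseries \<psi> s"
    by (simp add: powr_minus divide_inverse)
  then show ?thesis
    using dirichlet_L_continuation(2)[OF ch assms] sums_unique2 by blast
qed

text \<open>
  The identity \<open>(\<Sum>d | d dvd n. \<Lambda> d) = ln n\<close>, multiplied by the completely multiplicative \<open>\<psi>\<close>.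
\<close>

lemma dseries_character_log_deriv:
  assumes "Re s > 1"
  shows "(dseries \<psi> has_field_derivative - (dseries \<psi> s * dseries (log_deriv_coeff \<psi>) s)) (at s)"
proof -
  have "dseries \<psi> s * dseries (log_deriv_coeff \<psi>) s = dseries (log_deriv_coeff \<psi>) s * dseries \<psi> s"
    by simp
  also have "\<dots> = dseries (\<lambda>n. \<psi> n * of_real (ln (real n))) s"
  proof (rule dseries_mult)
    fix n :: nat assume "n > 0"
    have "(\<Sum>d | d dvd n. log_deriv_coeff \<psi> d * \<psi> (n div d)) = (\<Sum>d | d dvd n. \<psi> n * mangoldt d)"
    proof (rule sum.cong[OF refl])
      fix d assume "d \<in> {d. d dvd n}"
      then have "\<psi> n = \<psi> d * \<psi> (n div d)"
        using dirichlet_characterD(2)[OF ch, of d "n div d"] by simp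
      then show "log_deriv_coeff \<psi> d * \<psi> (n div d) = \<psi> n * mangoldt d"
        by (simp add: log_deriv_coeff_def)
    qed
    also have "\<dots> = \<psi> n * of_real (ln (real n))"
      using mangoldt_sum[of n, where ?'a = complex] \<open>n > 0\<close> by (simp flip: sum_distrib_left)
    finally show "\<psi> n * of_real (ln (real n)) = (\<Sum>d | d dvd n. log_deriv_coeff \<psi> d * \<psi> (n div d))"
      by simp
  qed (use assms subpolynomial_character subpolynomial_log_deriv_coeff subpolynomial_ln_mult in auto)
  finally show ?thesis
    using has_field_derivative_dseries[OF subpolynomial_character assms] by simp
qed

lemma dirichlet_L_log_deriv:
  assumes "Re s > 1"
  shows "(dirichlet_L \<psi> has_field_derivative - (dirichlet_L \<psi> s * dseries (log_deriv_coeff \<psi>) s)) (at s)"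
  by (rule has_field_derivative_transform_within_open[OF _ open_halfspace_Re_gt[of 1], where f = "dseries \<psi>"])
     (use assms dseries_character_log_deriv dirichlet_L_eq_dseries in auto)

text \<open>The terms after the first one add up to at most \<open>\<Sum>n\<ge>2. 1 / n\<^sup>3 \<le> 1 / 2\<close>.\<close>

lemma norm_dirichlet_L_ge:
  assumes s: "Re s \<ge> 3"
  shows "norm (dirichlet_L \<psi> s) \<ge> 1 / 2"
proof -
  define t where "t n = \<psi> n * of_nat n powr (- s)" for n
  have t: "t sums dirichlet_L \<psi> s"
    using dseries_summable(2)[OF subpolynomial_character, of s] dirichlet_L_eq_dseries[of s] s
    by (simp add: t_def[abs_def])
  have t01: "t 0 = 0" "t 1 = 1"
    using dirichlet_characterD(5)[OF ch] by (auto simp: t_def)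
  have tail: "(\<lambda>n. t (n + 2)) sums (dirichlet_L \<psi> s - 1)"
    using sums_iff_shift[of t 2 "dirichlet_L \<psi> s - 1"] t t01 by (simp add: numeral_2_eq_2)
  have tele: "(\<lambda>n. (1 / 2) * (1 / real (Suc n) - 1 / real (Suc (Suc n)))) sums ((1 / 2) * (1 - 0))"
    using telescope_sums'[of "\<lambda>n. 1 / real (Suc n)" 0] LIMSEQ_inverse_real_of_nat
    by (intro sums_mult) (simp add: inverse_eq_divide)
  have le: "norm (t (n + 2)) \<le> (1 / 2) * (1 / real (Suc n) - 1 / real (Suc (Suc n)))" for n
  proof -
    define y where "y = real n + 1"
    have y: "y \<ge> 1"
      by (simp add: y_def)
    have "norm (t (n + 2)) \<le> 1 * real (n + 2) powr (- Re s)"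
      unfolding t_def norm_mult norm_of_nat_powr using dirichlet_character_norm_le[OF ch]
      by (intro mult_mono) auto
    also have "\<dots> \<le> 1 * real (n + 2) powr (- 3)"
      using s by (intro mult_left_mono powr_mono) auto
    also have "\<dots> = 1 / (y + 1) ^ 3"
      by (simp add: y_def powr_minus divide_inverse add_ac)
    also have "\<dots> \<le> (1 / 2) * (1 / y - 1 / (y + 1))"
    proof -
      have "(y + 1) ^ 2 \<ge> 2 * y"
        using y by (simp add: power2_eq_square algebra_simps)
      then have "(y + 1) * (2 * y) \<le> (y + 1) * (y + 1) ^ 2"
        using y by (intro mult_left_mono) auto
      then have "1 / (y + 1) ^ 3 \<le> 1 / ((y + 1) * (2 * y))"
        using y by (intro divide_left_mono) (auto simp: power3_eq_cube power2_eq_square)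
      also have "\<dots> = (1 / 2) * (1 / y - 1 / (y + 1))"
        using y by (simp add: field_simps)
      finally show ?thesis .
    qed
    finally show ?thesis
      by (simp add: y_def add_ac)
  qed
  have "norm (\<Sum>n. t (n + 2)) \<le> (\<Sum>n. (1 / 2) * (1 / real (Suc n) - 1 / real (Suc (Suc n))))"
    using tele by (intro norm_suminf_le le) (simp only: sums_iff)
  then have "norm (dirichlet_L \<psi> s - 1) \<le> 1 / 2"
    unfolding sums_unique[OF tele, symmetric] sums_unique[OF tail, symmetric] by simp
  then show ?thesis
    using norm_triangle_ineq2[of 1 "1 - dirichlet_L \<psi> s"] by (simp add: norm_minus_commute)
qed

text \<open>
  If \<open>Q\<close> is a primitive of \<open>- L'/L\<close>, then \<open>L exp Q\<close> is constant, and the constant is not 0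
  because \<open>L\<close> is close to 1 far to the right.
\<close>

lemma dirichlet_L_nonzero:
  assumes s: "Re s > 1"
  shows "dirichlet_L \<psi> s \<noteq> 0"
proof -
  let ?S = "{s. Re s > 1}" and ?P = "dseries (log_deriv_coeff \<psi>)"
  have "?P holomorphic_on ?S"
    using has_field_derivative_dseries[OF subpolynomial_log_deriv_coeff] open_halfspace_Re_gt[of 1]
    by (auto simp: holomorphic_on_open)
  then obtain Q where Q: "\<And>z. z \<in> ?S \<Longrightarrow> (Q has_field_derivative ?P z) (at z within ?S)"
    using holomorphic_convex_primitive'[OF convex_halfspace_Re_gt open_halfspace_Re_gt] by blast
  have "((\<lambda>z. dirichlet_L \<psi> z * exp (Q z)) has_field_derivative 0) (at z within ?S)" if z: "z \<in> ?S" for z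
  proof -
    have L: "(dirichlet_L \<psi> has_field_derivative - (dirichlet_L \<psi> z * ?P z)) (at z within ?S)"
      using dirichlet_L_log_deriv[of z] z by (simp add: has_field_derivative_at_within)
    show ?thesis
      by (rule derivative_eq_intros L Q[OF z] refl | simp)+
  qed
  then have "\<exists>c. \<forall>z \<in> ?S. dirichlet_L \<psi> z * exp (Q z) = c"
    by (rule has_field_derivative_zero_constant[OF convex_halfspace_Re_gt])
  then obtain c where c: "\<forall>z \<in> ?S. dirichlet_L \<psi> z * exp (Q z) = c"
    by (rule exE)
  have "c \<noteq> 0"
    using c[rule_format, of 3] norm_dirichlet_L_ge[of 3] by auto
  then show ?thesis
    using c[rule_format, of s] s by auto
qed

end

section \<open>L-functions have no zeros on the line Re s = 1\<close>

lemma subpolynomial_ln_power: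
  "subpolynomial a \<Longrightarrow> subpolynomial (\<lambda>n. a n * of_real (ln (real n) ^ j))"
proof (induction j)
  case (Suc j)
  then have "subpolynomial (\<lambda>n. (a n * of_real (ln (real n) ^ j)) * of_real (ln (real n)))"
    by (intro subpolynomial_ln_mult) auto
  then show ?case
    by (simp add: mult_ac)
qed simp

lemma higher_deriv_dseries:
  assumes a: "subpolynomial a" and s: "Re s > 1"
  shows "(deriv ^^ j) (dseries a) s = (- 1) ^ j * dseries (\<lambda>n. a n * of_real (ln (real n) ^ j)) s"
  using s
proof (induction j arbitrary: s)
  case (Suc j)
  let ?a = "\<lambda>n. a n * of_real (ln (real n) ^ j)"
  have "((\<lambda>s. (- 1) ^ j * dseries ?a s) has_field_derivative
      (- 1) ^ j * - dseries (\<lambda>n. ?a n * of_real (ln (real n))) s) (at s)"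
    by (intro DERIV_cmult has_field_derivative_dseries subpolynomial_ln_power a Suc.prems)
  then have "((deriv ^^ j) (dseries a) has_field_derivative
      (- 1) ^ j * - dseries (\<lambda>n. ?a n * of_real (ln (real n))) s) (at s)"
    by (rule has_field_derivative_transform_within_open[OF _ open_halfspace_Re_gt[of 1]])
       (use Suc in auto)
  then have "deriv ((deriv ^^ j) (dseries a)) s = (- 1) ^ j * - dseries (\<lambda>n. ?a n * of_real (ln (real n))) s"
    by (rule DERIV_imp_deriv)
  then show ?case
    by (simp add: mult_ac)
qed simp

text \<open>
  A form of Landau's theorem. The derivatives of \<open>F\<close> at 2 alternate in sign (relative to \<open>F 2\<close>)
  because those of \<open>- F'/F\<close> do. As \<open>F\<close> is entire, the Taylor series of \<open>F'\<close> at 2 converges at -1,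
  where all its terms have the same sign, and it dominates the exponential series of \<open>b n * n\<close>.
\<close>

lemma Landau_log_deriv:
  fixes b :: "nat \<Rightarrow> real"
  assumes F: "F holomorphic_on UNIV" "F 2 \<noteq> 0"
    and b: "\<And>n. b n \<ge> 0" "subpolynomial (\<lambda>n. of_real (b n))"
    and F': "\<And>s. Re s > 1 \<Longrightarrow> deriv F s = F s * dseries (\<lambda>n. - of_real (b n)) s"
  obtains B where "\<And>n. n > 0 \<Longrightarrow> b n * real n \<le> B"
proof -
  let ?S = "{s. Re s > 1}"
  define c where "c j n = b n * ln (real n) ^ j * real n powr (- 2)" for j n
  define g where "g j = (\<Sum>n. c j n)" for j
  have bm: "subpolynomial (\<lambda>n. - of_real (b n))"
    by (rule subpolynomial_comparison[OF b(2)]) simp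
  have powr2: "(of_nat n :: complex) powr (- 2) = of_real (real n powr (- 2))" for n
    using powr_of_real[of "real n" "- 2"] by simp
  have c_sum: "summable (c j)" and G: "dseries (\<lambda>n. - of_real (b n) * of_real (ln (real n) ^ j)) 2 = - of_real (g j)" for j
  proof -
    have "(\<lambda>n. - of_real (b n) * of_real (ln (real n) ^ j) * of_nat n powr (- 2)) sums
        dseries (\<lambda>n. - of_real (b n) * of_real (ln (real n) ^ j)) 2"
      by (rule dseries_summable(2)[OF subpolynomial_ln_power[OF bm]]) simp
    then have *: "(\<lambda>n. complex_of_real (- c j n)) sums dseries (\<lambda>n. - of_real (b n) * of_real (ln (real n) ^ j)) 2"
      by (simp add: c_def powr2)
    then have "summable (\<lambda>n. - c j n)"
      using sums_summable[OF *] by (simp only: summable_of_real_iff)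
    then show sm: "summable (c j)"
      by (simp add: summable_minus_iff)
    have "(\<lambda>n. complex_of_real (- c j n)) sums of_real (- g j)"
      unfolding g_def by (intro sums_of_real sums_minus summable_sums sm)
    then show "dseries (\<lambda>n. - of_real (b n) * of_real (ln (real n) ^ j)) 2 = - of_real (g j)"
      using sums_unique2[OF *] by simp
  qed
  have c_nonneg: "c j n \<ge> 0" for j n
    using b(1)[of n] by (cases "n = 0") (auto simp: c_def)
  have g_ge: "c j n \<le> g j" for j n
    using sum_le_suminf[OF c_sum, of "{n}" j] c_nonneg by (simp add: g_def)
  have holF': "deriv F holomorphic_on UNIV"
    by (intro holomorphic_deriv F) auto
  have holG: "dseries (\<lambda>n. - of_real (b n)) holomorphic_on ?S"
    using has_field_derivative_dseries[OF bm] open_halfspace_Re_gt[of 1] by (auto simp: holomorphic_on_open)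
  have dG: "(deriv ^^ i) (dseries (\<lambda>n. - of_real (b n))) 2 = (- 1) ^ i * - of_real (g i)" for i
    using higher_deriv_dseries[OF bm, of 2 i] G[of i] by simp
  have rec: "(deriv ^^ Suc j) F 2 = (\<Sum>i=0..j. of_nat (j choose i) * (deriv ^^ i) F 2 * ((- 1) ^ (j - i) * - of_real (g (j - i))))" for j
  proof -
    have "(deriv ^^ Suc j) F 2 = (deriv ^^ j) (deriv F) 2"
      by (simp add: funpow_swap1)
    also have "\<dots> = (deriv ^^ j) (\<lambda>s. F s * dseries (\<lambda>n. - of_real (b n)) s) 2"
      by (rule higher_deriv_transform_within_open[where S = ?S])
         (use F' holF' F holG in \<open>auto simp: open_halfspace_Re_gt intro!: holomorphic_intros intro: holomorphic_on_subset\<close>)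
    also have "\<dots> = (\<Sum>i=0..j. of_nat (j choose i) * (deriv ^^ i) F 2 * (deriv ^^ (j - i)) (dseries (\<lambda>n. - of_real (b n))) 2)"
      by (rule higher_deriv_mult[where S = ?S])
         (use F holG in \<open>auto simp: open_halfspace_Re_gt intro: holomorphic_on_subset\<close>)
    finally show ?thesis
      by (simp only: dG)
  qed
  \<comment> \<open>By the recursion, the derivatives of \<open>F\<close>, freed from sign and scale, dominate those of \<open>- F'/F\<close>.\<close>
  have "\<exists>r. (\<forall>i\<le>j. (deriv ^^ i) F 2 = (- 1) ^ i * of_real (r i) * F 2 \<and> r i \<ge> 0 \<and> (i > 0 \<longrightarrow> g (i - 1) \<le> r i)) \<and> r 0 = (1::real)" for j
  proof (induction j)
    case 0
    show ?case
      by (rule exI[of _ "\<lambda>_. 1"]) simp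
  next
    case (Suc j)
    then obtain r where r: "\<And>i. i \<le> j \<Longrightarrow> (deriv ^^ i) F 2 = (- 1) ^ i * of_real (r i) * F 2"
      "\<And>i. i \<le> j \<Longrightarrow> r i \<ge> 0" "\<And>i. i \<le> j \<Longrightarrow> i > 0 \<Longrightarrow> g (i - 1) \<le> r i" "r 0 = 1"
      by blast
    define x where "x = (\<Sum>i=0..j. real (j choose i) * r i * g (j - i))"
    have g0: "g i \<ge> 0" for i
      using g_ge[of i 0] c_nonneg[of i 0] by linarith
    have terms: "real (j choose i) * r i * g (j - i) \<ge> 0" if "i \<in> {0..j}" for i
      using that r(2) g0 by simp
    have "(deriv ^^ Suc j) F 2 = (\<Sum>i=0..j. (- 1) ^ Suc j * of_real (real (j choose i) * r i * g (j - i)) * F 2)"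
      unfolding rec
    proof (intro sum.cong refl)
      fix i assume i: "i \<in> {0..j}"
      then have "(- 1 :: complex) ^ i * (- 1) ^ (j - i) = (- 1) ^ j"
        by (simp flip: power_add)
      then have "(- 1 :: complex) ^ j = (- 1) ^ i * (- 1) ^ (j - i)"
        by simp
      then show "of_nat (j choose i) * (deriv ^^ i) F 2 * ((- 1) ^ (j - i) * - of_real (g (j - i))) =
          (- 1) ^ Suc j * of_real (real (j choose i) * r i * g (j - i)) * F 2"
        using r(1)[of i] i by simp
    qed
    also have "\<dots> = (- 1) ^ Suc j * of_real x * F 2"
      by (simp add: x_def sum_distrib_left sum_distrib_right mult_ac)
    finally have dx: "(deriv ^^ Suc j) F 2 = (- 1) ^ Suc j * of_real x * F 2" .
    have x0: "x \<ge> 0"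
      unfolding x_def using terms by (intro sum_nonneg) auto
    have "real (j choose 0) * r 0 * g (j - 0) \<le> x"
      unfolding x_def using terms by (intro member_le_sum) auto
    then have gx: "g j \<le> x"
      using r(4) by simp
    show ?case
      by (rule exI[of _ "r(Suc j := x)"]) (use r dx x0 gx in \<open>auto simp: le_Suc_eq\<close>)
  qed
  then have "\<exists>x. (deriv ^^ Suc j) F 2 = (- 1) ^ Suc j * of_real x * F 2 \<and> x \<ge> g j" for j
    by (metis diff_Suc_1 order_refl zero_less_Suc)
  then obtain x where x: "\<And>j. (deriv ^^ Suc j) F 2 = (- 1) ^ Suc j * of_real (x j) * F 2" "\<And>j. x j \<ge> g j"
    by metis
  have "(\<lambda>j. (deriv ^^ j) (deriv F) 2 / fact j * (-1 - 2) ^ j) sums deriv F (-1)"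
    by (rule holomorphic_power_series[where r = 4]) (auto intro: holomorphic_on_subset[OF holF'] simp: dist_norm)
  also have "(\<lambda>j. (deriv ^^ j) (deriv F) 2 / fact j * (-1 - 2) ^ j) = (\<lambda>j. of_real (x j * 3 ^ j / fact j) * (- F 2))"
  proof
    fix j
    have "(deriv ^^ j) (deriv F) 2 = (- 1) ^ Suc j * of_real (x j) * F 2"
      using x(1)[of j] by (simp add: funpow_swap1)
    moreover have "(-1 - 2 :: complex) ^ j = (- 1) ^ j * 3 ^ j"
      by (simp flip: power_mult_distrib)
    ultimately show "(deriv ^^ j) (deriv F) 2 / fact j * (-1 - 2) ^ j = of_real (x j * 3 ^ j / fact j) * (- F 2)"
      by (simp flip: power_mult_distrib)
  qed
  finally have **: "(\<lambda>j. of_real (x j * 3 ^ j / fact j) * (- F 2)) sums deriv F (-1)" .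
  have inv: "(- F 2) * inverse (- F 2) = 1"
    using F(2) by (intro right_inverse) simp
  have *: "(\<lambda>j. complex_of_real (x j * 3 ^ j / fact j)) sums (deriv F (-1) * inverse (- F 2))"
    using sums_mult2[OF **, of "inverse (- F 2)"] by (simp only: mult.assoc inv mult_1_right)
  have sm: "summable (\<lambda>j. x j * 3 ^ j / fact j)"
    using sums_summable[OF *] by (simp only: summable_of_real_iff)
  have "b n * real n \<le> (\<Sum>j. x j * 3 ^ j / fact j)" if n: "n > 0" for n
  proof -
    have "(\<lambda>j. b n * real n powr (- 2) * ((3 * ln (real n)) ^ j / fact j)) sums (b n * real n powr (- 2) * exp (3 * ln (real n)))"
      using exp_converges[of "3 * ln (real n)"] by (intro sums_mult) (simp add: divide_inverse mult.commute)
    also have "b n * real n powr (- 2) * exp (3 * ln (real n)) = b n * real n"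
      using n by (simp add: powr_def flip: exp_add)
    also have "(\<lambda>j. b n * real n powr (- 2) * ((3 * ln (real n)) ^ j / fact j)) = (\<lambda>j. c j n * 3 ^ j / fact j)"
      by (simp add: c_def power_mult_distrib mult_ac)
    finally have *: "(\<lambda>j. c j n * 3 ^ j / fact j) sums (b n * real n)" .
    have "c j n * 3 ^ j / fact j \<le> x j * 3 ^ j / fact j" for j
      using g_ge[of j n] x(2)[of j] by (intro divide_right_mono mult_right_mono) auto
    then show ?thesis
      using sums_le[OF _ * summable_sums[OF sm]] by blast
  qed
  then show thesis
    using that by blast
qed

lemma remove_zero_entire:
  assumes "g holomorphic_on UNIV" "g a = 0"
  obtains h where "h holomorphic_on UNIV" "\<And>s. g s = (s - a) * h s"
proof
  show "(\<lambda>s. if s = a then deriv g a else (g s - g a) / (s - a)) holomorphic_on UNIV"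
    by (intro pole_lemma_open assms) auto
qed (use assms in auto)

lemma principal_character_cnj: "principal_character (\<lambda>n. cnj (\<psi> n)) \<longleftrightarrow> principal_character \<psi>"
  unfolding principal_character_def by (metis complex_cnj_cnj complex_cnj_one complex_cnj_zero)

text \<open>
  Both sides are holomorphic in \<open>s\<close>, and they have the same Dirichlet series for \<open>Re s > 1\<close>.
\<close>

lemma dirichlet_L_cnj:
  assumes ch: "dirichlet_character N \<psi>" and s: "\<not> principal_character \<psi> \<or> s \<noteq> 1"
  shows "dirichlet_L (\<lambda>n. cnj (\<psi> n)) (cnj s) = cnj (dirichlet_L \<psi> s)"
proof -
  let ?A = "if principal_character \<psi> then - {1} else UNIV :: complex set"
  let ?c = "\<lambda>n. cnj (\<psi> n)"
  have ch': "dirichlet_character N ?c"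
    by (rule dirichlet_character_cnj[OF ch])
  have A: "open ?A" "connected ?A" "cnj ` ?A = ?A"
    using connected_punctured_universe[of "1::complex"] by (auto simp: image_cnj_conv_vimage_cnj)
  have "dirichlet_L \<psi> s = (cnj \<circ> dirichlet_L ?c \<circ> cnj) s"
  proof (rule analytic_continuation_open[where f = "dirichlet_L \<psi>" and g = "cnj \<circ> dirichlet_L ?c \<circ> cnj" and
        s = "{s. Re s > 1}" and s' = ?A])
    show "open {s. Re s > 1}"
      by (rule open_halfspace_Re_gt)
    show "{s. Re s > 1} \<noteq> {}"
      by (auto intro!: exI[of _ 2])
    show "dirichlet_L \<psi> holomorphic_on ?A"
      by (rule dirichlet_L_continuation(1)[OF ch])
    have "dirichlet_L ?c holomorphic_on ?A"
      using dirichlet_L_continuation(1)[OF ch'] by (simp only: principal_character_cnj)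
    then show "cnj \<circ> dirichlet_L ?c \<circ> cnj holomorphic_on ?A"
      using A by (intro holomorphic_on_compose_cnj_cnj) auto
    fix z assume "z \<in> {s. Re s > 1}"
    then have z: "Re z > 1" "Re (cnj z) > 1"
      by auto
    have "(\<lambda>n. ?c (Suc n) / of_nat (Suc n) powr cnj z) sums dirichlet_L ?c (cnj z)"
      by (rule dirichlet_L_continuation(2)[OF ch' z(2)])
    then have "(\<lambda>n. cnj (?c (Suc n) / of_nat (Suc n) powr cnj z)) sums cnj (dirichlet_L ?c (cnj z))"
      by (subst sums_cnj)
    moreover have "cnj (of_nat (Suc n) powr cnj z) = of_nat (Suc n) powr z" for n
      by (simp add: cnj_powr del: of_nat_Suc)
    ultimately have "(\<lambda>n. \<psi> (Suc n) / of_nat (Suc n) powr z) sums cnj (dirichlet_L ?c (cnj z))"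
      by (simp del: of_nat_Suc)
    then show "dirichlet_L \<psi> z = (cnj \<circ> dirichlet_L ?c \<circ> cnj) z"
      using sums_unique2[OF dirichlet_L_continuation(2)[OF ch z(1)]] by simp
  qed (use A s in auto)
  then show ?thesis
    by simp
qed

definition principal_char :: "nat \<Rightarrow> nat \<Rightarrow> complex" where
  "principal_char N n = of_bool (coprime n N)"

lemma principal_char:
  assumes "N > 0"
  shows "dirichlet_character N (principal_char N)" "principal_character (principal_char N)"
proof -
  have "coprime (a + N) N \<longleftrightarrow> coprime a N" for a
    by (simp only: coprime_iff_gcd_eq_1 gcd_add1)
  then show "dirichlet_character N (principal_char N)"
    using assms by (simp add: dirichlet_character_def principal_char_def)
  show "principal_character (principal_char N)"
    by (simp add: principal_character_def principal_char_def)
qed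

lemma principal_character_eq:
  assumes "dirichlet_character N \<psi>" "principal_character \<psi>"
  shows "\<psi> = principal_char N"
proof
  fix n
  show "\<psi> n = principal_char N n"
    using assms dirichlet_characterD(4)[OF assms(1), of n]
    by (cases "\<psi> n = 0") (auto simp: principal_character_def principal_char_def)
qed

text \<open>
  The coefficients of \<open>- F'/F\<close> are \<open>\<Lambda> n * (2 + 2 * Re (\<psi> n * n powr (- \<i> t))) \<ge> 0\<close> for \<open>n\<close> coprime
  to \<open>N\<close>, and 0 otherwise. If \<open>F\<close> were entire, then at a large power \<open>p^j\<close> of a prime not dividing \<open>N\<close>
  both \<open>Re (z^j)\<close> and \<open>Re (z^(2 j))\<close> would have to be close to -1, where \<open>z = \<psi> p * p powr (- \<i> t)\<close> has absolute value 1. But \<open>Re (z^(2 j))\<close> is close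
  to 1 if \<open>Re (z^j)\<close> is close to -1.
\<close>

lemma no_entire_L_product:
  assumes ch: "dirichlet_character N \<psi>"
    and F: "F holomorphic_on UNIV"
      "\<And>s. Re s > 1 \<Longrightarrow> F s = (dirichlet_L (principal_char N) s)\<^sup>2 * dirichlet_L \<psi> (s + \<i> * of_real t)
         * dirichlet_L (\<lambda>n. cnj (\<psi> n)) (s - \<i> * of_real t)"
  shows False
proof -
  let ?c = "\<lambda>n. cnj (\<psi> n)" and ?p = "principal_char N" and ?it = "\<i> * of_real t"
  have N: "N > 0"
    by (rule dirichlet_characterD(1)[OF ch])
  note ch0 = principal_char(1)[OF N] and chc = dirichlet_character_cnj[OF ch]
  define z where "z n = \<psi> n * of_nat n powr (- ?it)" for n
  define b :: "nat \<Rightarrow> real" where "b n = mangoldt n * (2 * of_bool (coprime n N) + 2 * Re (z n))" for n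
  have norm_z: "norm (z n) = 1" if "coprime n N" "n > 0" for n
    using dirichlet_character_norm(1)[OF ch that(1)] that by (simp add: z_def norm_mult norm_of_nat_powr)
  have z0: "z n = 0" if "\<not> coprime n N" for n
    using that dirichlet_characterD(4)[OF ch, of n] by (auto simp: z_def)
  have b_bounds: "0 \<le> b n \<and> b n \<le> 4 * mangoldt n" for n
  proof (cases "coprime n N \<and> n > 0")
    case True
    then have "\<bar>Re (z n)\<bar> \<le> 1"
      using abs_Re_le_cmod[of "z n"] norm_z by simp
    then have "0 \<le> 2 + 2 * Re (z n)" "2 + 2 * Re (z n) \<le> 4"
      by linarith+
    then show ?thesis
      using True mangoldt_nonneg[of n] mult_left_mono[of "2 + 2 * Re (z n)" 4 "mangoldt n"] by (simp add: b_def)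
  next
    case False
    then show ?thesis
      using z0[of n] mangoldt_nonneg[of n] by (auto simp: b_def)
  qed
  have subp: "subpolynomial (\<lambda>n. of_real (b n))"
  proof (rule subpolynomial_comparison)
    show "subpolynomial (\<lambda>n. 4 * of_real (ln (real n)))"
      by (intro subpolynomial_ln_mult subpolynomialI_bounded[of _ 4]) auto
    show "norm (of_real (b n) :: complex) \<le> norm (4 * of_real (ln (real n)) :: complex)" if "n > 0" for n
      using b_bounds[of n] mangoldt_le_ln[of n] by (simp add: norm_mult)
  qed
  let ?P = "\<lambda>\<psi>. dseries (log_deriv_coeff \<psi>)"
  have G: "dseries (\<lambda>n. - of_real (b n)) s = - (2 * ?P ?p s + ?P \<psi> (s + ?it) + ?P ?c (s - ?it))" if s: "Re s > 1" for s
  proof -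
    have shift: "Re (s + ?it) > 1" "Re (s - ?it) > 1"
      using s by auto
    have "(\<lambda>n. - (2 * (log_deriv_coeff ?p n * of_nat n powr (- s)) + log_deriv_coeff \<psi> n * of_nat n powr (- (s + ?it))
        + log_deriv_coeff ?c n * of_nat n powr (- (s - ?it)))) sums - (2 * ?P ?p s + ?P \<psi> (s + ?it) + ?P ?c (s - ?it))"
      by (intro sums_minus sums_add sums_mult dseries_summable(2) subpolynomial_log_deriv_coeff[OF ch0]
          subpolynomial_log_deriv_coeff[OF ch] subpolynomial_log_deriv_coeff[OF chc] s shift)
    moreover have "- (2 * (log_deriv_coeff ?p n * of_nat n powr (- s)) + log_deriv_coeff \<psi> n * of_nat n powr (- (s + ?it))
        + log_deriv_coeff ?c n * of_nat n powr (- (s - ?it))) = - of_real (b n) * of_nat n powr (- s)" for n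
    proof -
      have "of_nat n powr (- (s + ?it)) = of_nat n powr (- s) * of_nat n powr (- ?it)"
        "of_nat n powr (- (s - ?it)) = of_nat n powr (- s) * of_nat n powr ?it"
        by (simp_all flip: powr_add)
      moreover have "cnj (of_nat n powr (- ?it)) = of_nat n powr ?it"
        by (cases "n = 0") (simp_all add: cnj_powr)
      moreover have "complex_of_real (b n) = mangoldt n * (2 * ?p n + (z n + cnj (z n)))"
        by (simp add: b_def principal_char_def complex_add_cnj)
      ultimately show ?thesis
        by (simp add: z_def log_deriv_coeff_def algebra_simps)
    qed
    moreover have "(\<lambda>n. - of_real (b n) * of_nat n powr (- s)) sums dseries (\<lambda>n. - of_real (b n)) s"
      by (rule dseries_summable(2)[OF subpolynomial_comparison[OF subp] s]) simp
    ultimately show ?thesis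
      using sums_unique2 by simp
  qed
  have derivF: "deriv F s = F s * dseries (\<lambda>n. - of_real (b n)) s" if s: "Re s > 1" for s
  proof -
    have shift: "Re (s + ?it) > 1" "Re (s - ?it) > 1"
      using s by auto
    have L1: "((\<lambda>s. dirichlet_L \<psi> (s + ?it)) has_field_derivative - (dirichlet_L \<psi> (s + ?it) * ?P \<psi> (s + ?it))) (at s)"
      using dirichlet_L_log_deriv[OF ch shift(1)] by (subst DERIV_shift[symmetric])
    have L2: "((\<lambda>s. dirichlet_L ?c (s - ?it)) has_field_derivative - (dirichlet_L ?c (s - ?it) * ?P ?c (s - ?it))) (at s)"
      using dirichlet_L_log_deriv[OF chc shift(2)] DERIV_shift[of "dirichlet_L ?c" _ s "- ?it"] by simp
    note L0 = dirichlet_L_log_deriv[OF ch0 s]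
    have "((\<lambda>s. (dirichlet_L ?p s)\<^sup>2 * dirichlet_L \<psi> (s + ?it) * dirichlet_L ?c (s - ?it)) has_field_derivative
      (dirichlet_L ?p s)\<^sup>2 * dirichlet_L \<psi> (s + ?it) * dirichlet_L ?c (s - ?it) * dseries (\<lambda>n. - of_real (b n)) s) (at s)"
      unfolding G[OF s] power2_eq_square
      by (rule derivative_eq_intros L0 L1 L2 refl)+ (simp add: algebra_simps)
    then have "(F has_field_derivative
      (dirichlet_L ?p s)\<^sup>2 * dirichlet_L \<psi> (s + ?it) * dirichlet_L ?c (s - ?it) * dseries (\<lambda>n. - of_real (b n)) s) (at s)"
      by (rule has_field_derivative_transform_within_open[OF _ open_halfspace_Re_gt[of 1]]) (use s F(2) in auto)
    then show ?thesis
      using F(2)[OF s] DERIV_imp_deriv by simp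
  qed
  have "F 2 \<noteq> 0"
    using F(2)[of 2] dirichlet_L_nonzero[OF ch0, of 2] dirichlet_L_nonzero[OF ch, of "2 + ?it"]
      dirichlet_L_nonzero[OF chc, of "2 - ?it"] by simp
  obtain B where B: "\<And>n. n > 0 \<Longrightarrow> b n * real n \<le> B"
    by (rule Landau_log_deriv[OF F(1) \<open>F 2 \<noteq> 0\<close> conjunct1[OF b_bounds] subp derivF]) (assumption, blast intro: that)
  obtain p where p: "prime p" "N < p"
    using bigger_prime by blast
  have cop: "coprime p N"
    using p N by (metis dvd_imp_le not_le prime_imp_coprime)
  have p2: "p \<ge> 2"
    using p(1) by (rule prime_ge_2_nat)
  have zpow: "z (p ^ j) = z p ^ j" for j
  proof -
    have "ln (real (p ^ j)) = real j * ln (real p)"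
      by (simp add: ln_realpow)
    then have "of_nat (p ^ j) powr (- ?it) = (of_nat p powr (- ?it)) ^ j"
      using p2 by (simp add: powr_def Ln_of_nat mult_ac del: of_nat_power flip: exp_of_nat_mult)
    then show ?thesis
      using dirichlet_characterD(6)[OF ch, of p j] by (simp add: z_def power_mult_distrib)
  qed
  have bp: "b (p ^ j) = ln (real p) * (2 + 2 * Re (z p ^ j))" if "j > 0" for j
    using p(1) cop that by (simp add: b_def zpow)
  have bound: "ln (real p) * real p ^ j * (7 / 4) \<le> 2 * B" if j: "j > 0" for j
  proof -
    define w where "w = z p ^ j"
    have "norm w = 1"
      using norm_z[OF cop] p2 by (simp add: w_def norm_power)
    then have "(Re w)\<^sup>2 + (Im w)\<^sup>2 = 1"
      using cmod_power2[of w] by simp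
    moreover have "z p ^ (2 * j) = w\<^sup>2"
      by (simp add: w_def mult.commute flip: power_mult)
    ultimately have Re2: "Re (z p ^ (2 * j)) = 2 * (Re w)\<^sup>2 - 1"
      by (simp add: power2_eq_square)
    have lnp: "ln (real p) > 0"
      using p2 by simp
    have "real p ^ j * (2 + 2 * Re (z p ^ (2 * j))) \<le> real p ^ (2 * j) * (2 + 2 * Re (z p ^ (2 * j)))"
      using p2 Re2 by (intro mult_right_mono power_increasing) auto
    then have "ln (real p) * (real p ^ j * (2 + 2 * Re (z p ^ (2 * j)))) \<le> ln (real p) * (real p ^ (2 * j) * (2 + 2 * Re (z p ^ (2 * j))))"
      using lnp by (intro mult_left_mono) auto
    also have "\<dots> \<le> B"
      using B[of "p ^ (2 * j)"] bp[of "2 * j"] j p2 by (simp add: mult_ac)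
    finally have 2: "ln (real p) * real p ^ j * (2 + 2 * (2 * (Re w)\<^sup>2 - 1)) \<le> B"
      unfolding Re2 by (simp add: mult_ac)
    have 1: "ln (real p) * real p ^ j * (2 + 2 * Re w) \<le> B"
      using B[of "p ^ j"] bp[OF j] p2 by (simp add: mult_ac w_def)
    \<comment> \<open>The right-hand side is \<open>(2 Re w + 1/2)\<^sup>2 + 7/4\<close>.\<close>
    have "7 / 4 \<le> (2 + 2 * Re w) + (2 + 2 * (2 * (Re w)\<^sup>2 - 1))"
      using zero_le_power2[of "2 * Re w + 1 / 2"] by (simp add: power2_eq_square algebra_simps)
    then have "ln (real p) * real p ^ j * (7 / 4) \<le> ln (real p) * real p ^ j * ((2 + 2 * Re w) + (2 + 2 * (2 * (Re w)\<^sup>2 - 1)))"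
      using lnp by (intro mult_left_mono) auto
    then show ?thesis
      using 1 2 by (simp only: distrib_left)
  qed
  obtain j where "2 * B / (ln (real p) * (7 / 4)) < real p ^ j"
    using real_arch_pow[of "real p"] p2 by auto
  also have "\<dots> \<le> real p ^ Suc j"
    using p2 by (intro power_increasing) auto
  finally have "2 * B < ln (real p) * real p ^ Suc j * (7 / 4)"
    using p2 by (simp add: divide_less_eq mult_ac)
  then show False
    using bound[of "Suc j"] by simp
qed

text \<open>
  If there were a zero at \<open>1 + \<i> t\<close>, the product in \<open>no_entire_L_product\<close> would be entire: the zeros at 1
  of its last two factors cancel the double pole of its first factor, the square of the L-function of the
  principal character. If \<open>\<psi>\<close> is principal, the last two factors
  have poles at \<open>1 - \<i> t\<close> and \<open>1 + \<i> t\<close>, where the first factor has double zeros.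
\<close>

theorem dirichlet_L_nonzero_line_1:
  assumes ch: "dirichlet_character N \<psi>" and nt: "\<not> principal_character \<psi> \<or> t \<noteq> 0"
  shows "dirichlet_L \<psi> (1 + \<i> * of_real t) \<noteq> 0"
proof
  assume zero: "dirichlet_L \<psi> (1 + \<i> * of_real t) = 0"
  let ?c = "\<lambda>n. cnj (\<psi> n)" and ?p = "principal_char N" and ?it = "\<i> * of_real t :: complex"
  have N: "N > 0"
    by (rule dirichlet_characterD(1)[OF ch])
  have ne: "\<not> principal_character \<psi> \<or> 1 + ?it \<noteq> 1"
    using nt by simp
  have zeroc: "dirichlet_L ?c (1 - ?it) = 0"
    using dirichlet_L_cnj[OF ch ne] zero by simp
  obtain E C where E: "E holomorphic_on UNIV" "\<And>s. s \<noteq> 1 \<Longrightarrow> E s = (s - 1) * dirichlet_L ?p s"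
    by (rule entire_multiple_of_L[OF principal_char(1)[OF N]]) (rule that)
  have shift: "(\<lambda>s. f (s + ?it)) holomorphic_on UNIV" "(\<lambda>s. f (s - ?it)) holomorphic_on UNIV"
    if "f holomorphic_on UNIV" for f
    by (intro holomorphic_on_compose_gen[OF _ that, unfolded o_def] holomorphic_intros; simp)+
  show False
  proof (cases "principal_character \<psi>")
    case False
    have L: "dirichlet_L \<psi> holomorphic_on UNIV" "dirichlet_L ?c holomorphic_on UNIV"
      using dirichlet_L_continuation(1)[OF ch] dirichlet_L_continuation(1)[OF dirichlet_character_cnj[OF ch]] False
      by (simp_all add: principal_character_cnj)
    obtain h1 where h1: "h1 holomorphic_on UNIV" "\<And>s. dirichlet_L \<psi> (s + ?it) = (s - 1) * h1 s"
      by (rule remove_zero_entire[OF shift(1)[OF L(1)], of 1]) (use zero in simp, rule that)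
    obtain h2 where h2: "h2 holomorphic_on UNIV" "\<And>s. dirichlet_L ?c (s - ?it) = (s - 1) * h2 s"
      by (rule remove_zero_entire[OF shift(2)[OF L(2)], of 1]) (use zeroc in simp, rule that)
    show False
    proof (rule no_entire_L_product[OF ch, of "\<lambda>s. (E s)\<^sup>2 * h1 s * h2 s" t])
      show "(\<lambda>s. (E s)\<^sup>2 * h1 s * h2 s) holomorphic_on UNIV"
        by (intro holomorphic_intros E h1 h2)
      fix s :: complex assume "Re s > 1"
      then have "s \<noteq> 1"
        by auto
      from E(2)[OF this] show "(E s)\<^sup>2 * h1 s * h2 s = (dirichlet_L ?p s)\<^sup>2 * dirichlet_L \<psi> (s + ?it) * dirichlet_L ?c (s - ?it)"
        unfolding h1 h2 by (simp add: power2_eq_square mult_ac)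
    qed
  next
    case True
    then have \<psi>: "\<psi> = ?p" "?c = ?p"
      using principal_character_eq[OF ch] principal_character_eq[OF dirichlet_character_cnj[OF ch]]
      by (simp_all add: principal_character_cnj)
    have pc: "(\<lambda>n. cnj (?p n)) = ?p"
      by (auto simp: principal_char_def of_bool_def)
    have t: "?it \<noteq> 0"
      using nt True by simp
    have E0: "E (1 + ?it) = 0" "E (1 - ?it) = 0"
      using E(2)[of "1 + ?it"] E(2)[of "1 - ?it"] t zero zeroc \<psi> by auto
    obtain A1 where A1: "A1 holomorphic_on UNIV" "\<And>s. E s = (s - (1 + ?it)) * A1 s"
      by (rule remove_zero_entire[OF E(1) E0(1)]) (rule that)
    obtain A2 where A2: "A2 holomorphic_on UNIV" "\<And>s. E s = (s - (1 - ?it)) * A2 s"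
      by (rule remove_zero_entire[OF E(1) E0(2)]) (rule that)
    note A = A1 A2
    show False
    proof (rule no_entire_L_product[OF ch, of "\<lambda>s. A1 s * A2 s * A1 (s + ?it) * A2 (s - ?it)" t])
      show "(\<lambda>s. A1 s * A2 s * A1 (s + ?it) * A2 (s - ?it)) holomorphic_on UNIV"
        by (intro holomorphic_intros A shift)
      fix s :: complex assume s: "Re s > 1"
      have *: "(z - 1) * dirichlet_L ?p z = (z - (1 + ?it)) * A1 z" "(z - 1) * dirichlet_L ?p z = (z - (1 - ?it)) * A2 z"
        if "z \<noteq> 1" for z
        using E(2)[OF that] A(2)[of z] A(4)[of z] by simp_all
      have ne: "s \<noteq> 1" "s + ?it \<noteq> 1" "s - ?it \<noteq> 1"
        using s by (auto simp: complex_eq_iff)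
      define u v where "u = s + ?it - 1" and "v = s - ?it - 1"
      have uv: "u \<noteq> 0" "v \<noteq> 0" "s - 1 \<noteq> 0"
        using ne by (auto simp: u_def v_def)
      have 1: "(s - 1) * dirichlet_L ?p s = v * A1 s" "(s - 1) * dirichlet_L ?p s = u * A2 s"
        using *[OF ne(1)] by (simp_all add: u_def v_def algebra_simps)
      have 2: "u * dirichlet_L ?p (s + ?it) = (s - 1) * A1 (s + ?it)" "v * dirichlet_L ?p (s - ?it) = (s - 1) * A2 (s - ?it)"
        using *(1)[OF ne(2)] *(2)[OF ne(3)] by (simp_all add: u_def v_def algebra_simps)
      have "(u * v * (s - 1)\<^sup>2) * (A1 s * A2 s * A1 (s + ?it) * A2 (s - ?it)) =
          (v * A1 s) * (u * A2 s) * ((s - 1) * A1 (s + ?it)) * ((s - 1) * A2 (s - ?it))"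
        by (simp add: power2_eq_square mult_ac)
      also have "\<dots> = ((s - 1) * dirichlet_L ?p s) * ((s - 1) * dirichlet_L ?p s) * (u * dirichlet_L ?p (s + ?it)) * (v * dirichlet_L ?p (s - ?it))"
        by (simp only: 1[symmetric] 2[symmetric])
      also have "\<dots> = (u * v * (s - 1)\<^sup>2) * ((dirichlet_L ?p s)\<^sup>2 * dirichlet_L ?p (s + ?it) * dirichlet_L ?p (s - ?it))"
        by (simp add: power2_eq_square mult_ac)
      finally show "A1 s * A2 s * A1 (s + ?it) * A2 (s - ?it) = (dirichlet_L ?p s)\<^sup>2 * dirichlet_L \<psi> (s + ?it) * dirichlet_L ?c (s - ?it)"
        using uv unfolding \<psi>(1) pc by simp
    qed
  qed
qed

section \<open>The logarithmic derivative away from zeros\<close>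

text \<open>
  The Moebius transformation \<open>c \<mapsto> c / (2 M - c)\<close> maps the half-plane \<open>Re c < M\<close> to the unit disc, so
  Schwarz's lemma bounds \<open>k\<close>, and Cauchy's estimate on a smaller disc bounds its derivative.
\<close>

lemma Borel_Caratheodory_deriv:
  assumes hol: "k holomorphic_on ball 0 R" and k0: "k 0 = 0"
    and Re: "\<And>w. norm w < R \<Longrightarrow> Re (k w) < M"
    and r: "0 \<le> r" "r < R" and z: "norm z \<le> r"
  shows "norm (deriv k z) \<le> 8 * M * R / (R - r)\<^sup>2"
proof -
  have R: "R > 0"
    using r by simp
  then have M: "M > 0"
    using Re[of 0] k0 by simp
  have bound: "norm (k w) \<le> 2 * M * norm w / (R - norm w)" if w: "norm w < R" for w
  proof -
    define \<phi> where "\<phi> u = k (of_real R * u) / (of_real (2 * M) - k (of_real R * u))" for u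
    have RN: "norm (of_real R * u) < R" if "norm u < 1" for u :: complex
      using that R by (simp add: norm_mult)
    have nz: "of_real (2 * M) - k (of_real R * u) \<noteq> 0" if "norm u < 1" for u
    proof
      assume "of_real (2 * M) - k (of_real R * u) = 0"
      then have "Re (k (of_real R * u)) = 2 * M"
        by (metis Re_complex_of_real eq_iff_diff_eq_0)
      then show False
        using Re[OF RN[OF that]] M by simp
    qed
    have less: "norm (\<phi> u) < 1" if u: "norm u < 1" for u
    proof -
      define c where "c = k (of_real R * u)"
      have "(norm c)\<^sup>2 < (norm (of_real (2 * M) - c))\<^sup>2"
        using mult_strict_left_mono[OF Re[OF RN[OF u]] M]
        unfolding cmod_power2 by (simp add: c_def algebra_simps power2_eq_square)
      then have "norm c < norm (of_real (2 * M) - c)"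
        by (rule power2_less_imp_less) simp
      then show ?thesis
        using nz[OF u] by (simp add: \<phi>_def c_def norm_divide divide_simps)
    qed
    have "(\<lambda>u. k (of_real R * u)) holomorphic_on ball 0 1"
      by (intro holomorphic_on_compose_gen[OF _ hol, unfolded o_def] holomorphic_intros)
         (use RN in auto)
    then have "\<phi> holomorphic_on ball 0 1"
      unfolding \<phi>_def by (intro holomorphic_intros) (use nz in auto)
    moreover have "\<phi> 0 = 0"
      by (simp add: \<phi>_def k0)
    moreover define u where "u = w / of_real R"
    have u: "norm u < 1" and uR: "of_real R * u = w"
      using w R by (auto simp: u_def norm_divide)
    ultimately have "norm (\<phi> u) \<le> norm u"
      using less by (intro Schwarz_Lemma(1)) auto
    then have "norm (k w) \<le> norm u * norm (of_real (2 * M) - k w)"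
      using nz[OF u] by (simp add: \<phi>_def uR norm_divide divide_simps)
    also have "\<dots> \<le> norm u * (2 * M + norm (k w))"
      using norm_triangle_ineq4[of "of_real (2 * M)" "k w"] M by (intro mult_left_mono) auto
    finally have "norm (k w) * (1 - norm u) \<le> 2 * M * norm u"
      by (simp add: algebra_simps)
    then have "norm (k w) * (1 - norm u) * R \<le> 2 * M * norm u * R"
      using R by (intro mult_right_mono) auto
    then have "norm (k w) * (R - norm u * R) \<le> 2 * M * (norm u * R)"
      by (simp add: algebra_simps)
    moreover have "norm u * R = norm w"
      using R by (simp add: u_def norm_divide)
    ultimately have "norm (k w) * (R - norm w) \<le> 2 * M * norm w"
      by simp
    then show ?thesis
      using w by (simp add: field_simps)
  qed
  define d where "d = (R - r) / 2"
  have d: "d > 0" "r + d < R" "R - (r + d) = d"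
    using r by (auto simp: d_def field_simps)
  have in_ball: "norm w \<le> r + d" if "w \<in> cball z d" for w
    using that z norm_triangle_ineq2[of w z] by (auto simp: dist_norm norm_minus_commute)
  have "norm ((deriv ^^ 1) k z) \<le> fact 1 * (2 * M * R / d) / d ^ 1"
  proof (rule Cauchy_inequality)
    have sub: "cball z d \<subseteq> ball 0 R"
      using in_ball d by fastforce
    then show "k holomorphic_on ball z d" "continuous_on (cball z d) k"
      using hol by (meson ball_subset_cball holomorphic_on_subset holomorphic_on_imp_continuous_on subset_trans)+
    fix x assume "norm (z - x) = d"
    then have x: "norm x \<le> r + d"
      using in_ball[of x] by (simp add: dist_norm)
    have "2 * M * norm x / (R - norm x) \<le> 2 * M * R / d"
      using x d M r by (intro frac_le mult_mono mult_nonneg_nonneg) auto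
    then show "norm (k x) \<le> 2 * M * R / d"
      using bound[of x] x d by linarith
  qed (use d in auto)
  also have "\<dots> = 8 * M * R / (R - r)\<^sup>2"
    using d by (simp add: d_def field_simps power2_eq_square)
  finally show ?thesis
    by simp
qed

lemma norm_le_on_cball_if_on_sphere:
  assumes "g holomorphic_on ball 0 R'" "0 < R" "R < R'" "\<And>w. norm w = R \<Longrightarrow> norm (g w) \<le> B" "norm (w::complex) \<le> R"
  shows "norm (g w) \<le> B"
proof (rule maximum_modulus_frontier[of g "cball 0 R"])
  have "cball 0 R \<subseteq> ball 0 R'"
    using assms by auto
  then show "continuous_on (closure (cball 0 R)) g"
    using assms(1) by (auto intro: holomorphic_on_imp_continuous_on holomorphic_on_subset)
  show "g holomorphic_on interior (cball 0 R)"
    using assms by (auto intro: holomorphic_on_subset)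
qed (use assms in auto)

text \<open>
  Dividing \<open>g\<close> by a Blaschke factor \<open>R (w - \<rho>) / (R\<^sup>2 - cnj \<rho> w)\<close> removes the zero \<open>\<rho>\<close> and keeps
  the absolute value on the circle of radius \<open>R\<close>.
\<close>

lemma remove_zero_Blaschke:
  assumes hol: "g holomorphic_on ball 0 R'" and R: "0 < r" "r < R" "R < R'"
    and \<rho>: "g \<rho> = 0" "norm \<rho> \<le> r" "\<rho> \<noteq> 0"
  obtains h where "h holomorphic_on ball 0 R'" "\<And>w. norm w = R \<Longrightarrow> norm (h w) = norm (g w)"
    "norm (h 0) \<ge> R / r * norm (g 0)"
    "\<And>w. norm w \<le> r \<Longrightarrow> h w = 0 \<Longrightarrow> g w = 0"
    "\<And>z. norm z \<le> r \<Longrightarrow> g z \<noteq> 0 \<Longrightarrow>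
       deriv g z / g z - deriv h z / h z = 1 / (z - \<rho>) + cnj \<rho> / (of_real R ^ 2 - cnj \<rho> * z)"
proof -
  define g1 where "g1 w = (if w = \<rho> then deriv g \<rho> else (g w - g \<rho>) / (w - \<rho>))" for w
  have g1: "g1 holomorphic_on ball 0 R'"
    unfolding g1_def by (intro pole_lemma_open hol) auto
  have gg1: "g w = (w - \<rho>) * g1 w" for w
    using \<rho> by (auto simp: g1_def)
  define h where "h w = g1 w * ((of_real R ^ 2 - cnj \<rho> * w) / of_real R)" for w
  have nz: "of_real R ^ 2 - cnj \<rho> * w \<noteq> 0" if "norm w \<le> r" for w
  proof
    assume "of_real R ^ 2 - cnj \<rho> * w = 0"
    then have "norm (cnj \<rho> * w) = norm (complex_of_real R ^ 2)"
      by simp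
    then have "norm \<rho> * norm w = R * R"
      using R by (simp add: norm_mult power2_eq_square)
    moreover have "norm \<rho> * norm w \<le> r * r"
      using that \<rho> R by (intro mult_mono) auto
    moreover have "r * r < R * R"
      using R by (intro mult_strict_mono) auto
    ultimately show False
      by linarith
  qed
  show thesis
  proof
    show "h holomorphic_on ball 0 R'"
      unfolding h_def using R by (intro holomorphic_intros g1) auto
    show "norm (h w) = norm (g w)" if w: "norm w = R" for w
    proof -
      have "of_real R ^ 2 - cnj \<rho> * w = w * cnj (w - \<rho>)"
        using complex_norm_square[of w] w by (simp add: algebra_simps)
      then have "norm (of_real R ^ 2 - cnj \<rho> * w) = R * norm (w - \<rho>)"
        using w by (metis complex_mod_cnj norm_mult)
      then show ?thesis
        using R by (simp add: h_def gg1 norm_mult norm_divide)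
    qed
    have "R / r * norm (g 0) \<le> R / norm \<rho> * norm (g 0)"
      using \<rho> R by (intro mult_right_mono divide_left_mono) auto
    also have "\<dots> = norm (h 0)"
      using \<rho> R by (simp add: h_def gg1 norm_mult norm_divide norm_power power2_eq_square)
    finally show "norm (h 0) \<ge> R / r * norm (g 0)" .
    show "g w = 0" if "norm w \<le> r" "h w = 0" for w
      using that nz[of w] R by (auto simp: h_def gg1)
    fix z assume z: "norm z \<le> r" "g z \<noteq> 0"
    have z\<rho>: "z \<noteq> \<rho>" and g1z: "g1 z \<noteq> 0"
      using z by (auto simp: gg1)
    have g1': "(g1 has_field_derivative deriv g1 z) (at z)"
      using z R by (intro holomorphic_derivI[OF g1]) auto
    have "((\<lambda>w. (w - \<rho>) * g1 w) has_field_derivative (g1 z + (z - \<rho>) * deriv g1 z)) (at z)"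
      by (rule derivative_eq_intros g1' refl | simp)+
    then have gd: "deriv g z = g1 z + (z - \<rho>) * deriv g1 z"
      using gg1 by (metis (no_types, lifting) DERIV_imp_deriv ext)
    have "(h has_field_derivative (deriv g1 z * ((of_real R ^ 2 - cnj \<rho> * z) / of_real R)
        - g1 z * cnj \<rho> / of_real R)) (at z)"
      unfolding h_def using R by (auto intro!: derivative_eq_intros g1' simp: diff_divide_distrib mult.commute)
    then have hd: "deriv h z = deriv g1 z * ((of_real R ^ 2 - cnj \<rho> * z) / of_real R)
        - g1 z * cnj \<rho> / of_real R"
      by (rule DERIV_imp_deriv)
    have "deriv g z / g z = 1 / (z - \<rho>) + deriv g1 z / g1 z"
      using z\<rho> g1z by (simp add: gd gg1 field_simps)
    moreover have "deriv h z / h z = deriv g1 z / g1 z - cnj \<rho> / (of_real R ^ 2 - cnj \<rho> * z)"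
      using nz[OF z(1)] g1z R by (simp add: hd h_def divide_simps)
    ultimately show "deriv g z / g z - deriv h z / h z = 1 / (z - \<rho>) + cnj \<rho> / (of_real R ^ 2 - cnj \<rho> * z)"
      by simp
  qed
qed

text \<open>
  The zeros of \<open>f\<close> are divided out one at a time. Each division increases \<open>norm (g 0)\<close> by a
  fixed factor, whereas the maximum principle bounds it by \<open>exp M * norm (f 0)\<close>, so that only
  \<open>O(M)\<close> divisions are possible. Each of them changes the logarithmic derivative by \<open>O(1/\<delta>)\<close>,
  and the Borel--Caratheodory theorem applies to the logarithm of the zero-free quotient.
\<close>

proposition log_deriv_bound_away_from_zeros:
  fixes r1 r2 R :: real
  assumes r: "0 < r1" "r1 < r2" "r2 < R"
  obtains K where "K > 0"
    "\<And>f M \<delta> z R'. f holomorphic_on ball 0 R' \<Longrightarrow> R < R' \<Longrightarrow> f 0 \<noteq> 0 \<Longrightarrow> M > 0 \<Longrightarrow>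
       (\<And>w. norm w = R \<Longrightarrow> norm (f w) \<le> exp M * norm (f 0)) \<Longrightarrow>
       0 < \<delta> \<Longrightarrow> \<delta> \<le> 1 \<Longrightarrow> norm z \<le> r1 \<Longrightarrow>
       (\<And>\<rho>. norm \<rho> \<le> r2 \<Longrightarrow> f \<rho> = 0 \<Longrightarrow> \<delta> \<le> norm (z - \<rho>)) \<Longrightarrow>
       norm (deriv f z / f z) \<le> K * M / \<delta>"
proof -
  define K where "K = (1 + 1 / (R - r1)) / ln (R / r2) + 16 * r2 / (r2 - r1)\<^sup>2"
  have L: "ln (R / r2) > 0"
    using r by simp
  have K: "K > 0"
    using r L unfolding K_def by (intro add_pos_pos divide_pos_pos) (auto intro!: add_pos_pos)
  show thesis
  proof (rule that[OF K])
    fix f M \<delta> z R'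
    assume hol: "f holomorphic_on ball 0 R'" and R': "R < R'" and f0: "f 0 \<noteq> 0" and M: "M > 0"
      and bd: "\<And>w. norm w = R \<Longrightarrow> norm (f w) \<le> exp M * norm (f 0)"
      and \<delta>: "0 < \<delta>" "\<delta> \<le> 1" and z: "norm z \<le> r1"
      and zeros: "\<And>\<rho>. norm \<rho> \<le> r2 \<Longrightarrow> f \<rho> = 0 \<Longrightarrow> \<delta> \<le> norm (z - \<rho>)"
    define E where "E = 1 / \<delta> + 1 / (R - r1)"
    define Q where "Q n g \<longleftrightarrow> g holomorphic_on ball 0 R' \<and>
        (\<forall>w. norm w = R \<longrightarrow> norm (g w) \<le> exp M * norm (f 0)) \<and>
        norm (g 0) \<ge> (R / r2) ^ n * norm (f 0) \<and>
        (\<forall>w. norm w \<le> r2 \<longrightarrow> g w = 0 \<longrightarrow> f w = 0) \<and>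
        norm (deriv f z / f z - deriv g z / g z) \<le> of_nat n * E" for n :: nat and g
    have fz: "f z \<noteq> 0"
      using zeros[of z] z r \<delta> by auto
    have step: "\<exists>h. Q (Suc n) h" if g: "Q n g" and \<rho>: "norm \<rho> \<le> r2" "g \<rho> = 0" for n g \<rho>
    proof -
      have f\<rho>: "f \<rho> = 0"
        using that by (auto simp: Q_def)
      then have \<rho>0: "\<rho> \<noteq> 0"
        using f0 by auto
      obtain h where h: "h holomorphic_on ball 0 R'" "\<And>w. norm w = R \<Longrightarrow> norm (h w) = norm (g w)"
        "norm (h 0) \<ge> R / r2 * norm (g 0)"
        "\<And>w. norm w \<le> r2 \<Longrightarrow> h w = 0 \<Longrightarrow> g w = 0"
        "\<And>z. norm z \<le> r2 \<Longrightarrow> g z \<noteq> 0 \<Longrightarrow>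
           deriv g z / g z - deriv h z / h z = 1 / (z - \<rho>) + cnj \<rho> / (of_real R ^ 2 - cnj \<rho> * z)"
        using remove_zero_Blaschke[of g R' r2 R \<rho>] g \<rho> \<rho>0 r R' unfolding Q_def by auto
      have gz: "g z \<noteq> 0"
        using fz g z r by (auto simp: Q_def)
      have "R / r2 * ((R / r2) ^ n * norm (f 0)) \<le> R / r2 * norm (g 0)"
        using g r by (intro mult_left_mono) (auto simp: Q_def)
      then have h0: "norm (h 0) \<ge> (R / r2) ^ Suc n * norm (f 0)"
        using h(3) by simp
      have "norm (1 / (z - \<rho>)) \<le> 1 / \<delta>"
        using zeros[OF \<rho>(1) f\<rho>] \<delta> by (auto simp: norm_divide intro!: divide_left_mono mult_pos_pos)
      moreover have "norm (cnj \<rho> / (of_real R ^ 2 - cnj \<rho> * z)) \<le> 1 / (R - r1)"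
      proof -
        have "norm (cnj \<rho> * z) \<le> R * r1"
          unfolding norm_mult using \<rho> r z by (intro mult_mono) auto
        moreover have "norm (complex_of_real R ^ 2) = R * R"
          using r unfolding norm_power by (simp add: power2_eq_square)
        ultimately have "R * (R - r1) \<le> norm (of_real R ^ 2 - cnj \<rho> * z)"
          using norm_triangle_ineq2[of "of_real R ^ 2" "cnj \<rho> * z"] by (simp add: algebra_simps)
        then have "norm (cnj \<rho> / (of_real R ^ 2 - cnj \<rho> * z)) \<le> R / (R * (R - r1))"
          unfolding norm_divide using r \<rho> by (intro frac_le) auto
        then show ?thesis
          using r by simp
      qed
      ultimately have "norm (deriv g z / g z - deriv h z / h z) \<le> E"
        using h(5)[OF _ gz] z r norm_triangle_ineq unfolding E_def
        by (smt (verit, best))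
      then have "norm (deriv f z / f z - deriv h z / h z) \<le> of_nat (Suc n) * E"
        using g norm_triangle_ineq[of "deriv f z / f z - deriv g z / g z" "deriv g z / g z - deriv h z / h z"]
        unfolding Q_def by (simp add: algebra_simps)
      then show ?thesis
        using h h0 g unfolding Q_def by (intro exI[of _ h]) auto
    qed
    have Qn: "real n \<le> M / ln (R / r2)" and Qg: "\<And>w. norm w \<le> R \<Longrightarrow> norm (g w) \<le> exp M * norm (f 0)"
      if "Q n g" for n g
    proof -
      have holg: "g holomorphic_on ball 0 R'" and
        sphere: "\<And>w. norm w = R \<Longrightarrow> norm (g w) \<le> exp M * norm (f 0)"
        using \<open>Q n g\<close> unfolding Q_def by blast+
      show *: "norm (g w) \<le> exp M * norm (f 0)" if "norm w \<le> R" for w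
        by (rule norm_le_on_cball_if_on_sphere[OF holg _ R' sphere that]) (use r in auto)
      have "(R / r2) ^ n * norm (f 0) \<le> norm (g 0)"
        using \<open>Q n g\<close> unfolding Q_def by blast
      also have "\<dots> \<le> exp M * norm (f 0)"
        using *[of 0] r by simp
      finally have "(R / r2) ^ n * norm (f 0) \<le> exp M * norm (f 0)" .
      then have "(R / r2) ^ n \<le> exp M"
        using f0 by simp
      then have "ln ((R / r2) ^ n) \<le> M"
        using r by (metis ln_exp ln_le_cancel_iff exp_gt_zero divide_pos_pos order.strict_trans zero_less_power)
      moreover have "ln ((R / r2) ^ n) = real n * ln (R / r2)"
        by (rule ln_realpow)
      ultimately show "real n \<le> M / ln (R / r2)"
        using L by (simp only: pos_le_divide_eq)
    qed
    have Q0: "Q 0 f"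
      using hol bd by (auto simp: Q_def)
    have "\<exists>n g. Q n g \<and> (\<forall>\<rho>. norm \<rho> \<le> r2 \<longrightarrow> g \<rho> \<noteq> 0)"
    proof (rule ccontr)
      assume *: "\<not> ?thesis"
      have "\<exists>g. Q n g" for n
      proof (induction n)
        case (Suc n)
        then show ?case
          using * step by blast
      qed (use Q0 in blast)
      then have "real n \<le> M / ln (R / r2)" for n
        using Qn by blast
      then show False
        using reals_Archimedean2[of "M / ln (R / r2)"] by (meson not_less)
    qed
    then obtain n g where g: "Q n g" and gnz: "\<And>\<rho>. norm \<rho> \<le> r2 \<Longrightarrow> g \<rho> \<noteq> 0"
      by blast
    have holg: "g holomorphic_on ball 0 r2"
      using g r R' by (auto simp: Q_def intro: holomorphic_on_subset)
    obtain k where k: "k holomorphic_on ball 0 r2" "\<And>w. w \<in> ball 0 r2 \<Longrightarrow> exp (k w) = g w"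
      using holomorphic_logarithm_exists[OF _ _ holg, of 0] gnz r by (auto simp: dist_norm)
    have "norm (deriv (\<lambda>w. k w - k 0) z) \<le> 8 * (2 * M) * r2 / (r2 - r1)\<^sup>2"
    proof (rule Borel_Caratheodory_deriv)
      show "(\<lambda>w. k w - k 0) holomorphic_on ball 0 r2"
        by (intro holomorphic_intros k)
      fix w :: complex assume w: "norm w < r2"
      have "(R / r2) ^ n \<ge> 1"
        using r by (intro one_le_power) auto
      then have "norm (f 0) \<le> norm (g 0)"
        using g mult_right_mono[of 1 "(R / r2) ^ n" "norm (f 0)"] unfolding Q_def by force
      then have "norm (g w) \<le> exp M * norm (g 0)"
        using Qg[OF g, of w] w r by (smt (verit) exp_gt_zero mult_left_mono)
      moreover have "norm (g w) = exp (Re (k w))" "norm (g 0) = exp (Re (k 0))"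
        using k(2)[of w] k(2)[of 0] w r norm_exp_eq_Re by (metis mem_ball_0 norm_zero order.strict_trans1 norm_ge_zero)+
      ultimately have "Re (k w) \<le> M + Re (k 0)"
        by (simp flip: exp_add)
      then show "Re (k w - k 0) < 2 * M"
        using M by simp
    qed (use r z in auto)
    moreover have "deriv (\<lambda>w. k w - k 0) z = deriv g z / g z"
    proof -
      have zb: "z \<in> ball 0 r2"
        using z r by auto
      have kd: "(k has_field_derivative deriv k z) (at z)"
        by (rule holomorphic_derivI[OF k(1) _ zb]) auto
      have "((\<lambda>w. exp (k w)) has_field_derivative exp (k z) * deriv k z) (at z)"
        by (auto intro!: derivative_eq_intros kd)
      then have "(g has_field_derivative g z * deriv k z) (at z)"
        by (subst k(2)[OF zb, symmetric],
            rule has_field_derivative_transform_within_open[of _ _ _ "ball 0 r2"]) (use k(2) zb in auto)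
      then have "deriv g z = g z * deriv k z"
        by (rule DERIV_imp_deriv)
      moreover have "deriv (\<lambda>w. k w - k 0) z = deriv k z"
        using DERIV_imp_deriv[OF DERIV_diff[OF kd DERIV_const]] by simp
      ultimately show ?thesis
        using gnz[of z] z r by simp
    qed
    ultimately have "norm (deriv g z / g z) \<le> 16 * r2 / (r2 - r1)\<^sup>2 * M"
      by (simp add: mult_ac)
    moreover have "norm (deriv f z / f z - deriv g z / g z) \<le> (M / ln (R / r2)) * ((1 + 1 / (R - r1)) / \<delta>)"
    proof -
      have "1 / (R - r1) \<le> 1 / (R - r1) / \<delta>"
        using \<delta> r by (simp add: divide_simps mult_left_le)
      then have "E \<le> (1 + 1 / (R - r1)) / \<delta>"
        by (simp add: E_def add_divide_distrib)
      moreover have "0 \<le> E"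
        using \<delta> r by (simp add: E_def)
      ultimately have "of_nat n * E \<le> (M / ln (R / r2)) * ((1 + 1 / (R - r1)) / \<delta>)"
        using Qn[OF g] M L by (intro mult_mono) auto
      moreover have "norm (deriv f z / f z - deriv g z / g z) \<le> of_nat n * E"
        using g unfolding Q_def by blast
      ultimately show ?thesis
        by linarith
    qed
    moreover have "16 * r2 / (r2 - r1)\<^sup>2 * M \<le> 16 * r2 / (r2 - r1)\<^sup>2 * M / \<delta>"
    proof -
      have "16 * r2 / (r2 - r1)\<^sup>2 * M \<ge> 0"
        using r M by simp
      then have "16 * r2 / (r2 - r1)\<^sup>2 * M / 1 \<le> 16 * r2 / (r2 - r1)\<^sup>2 * M / \<delta>"
        using \<delta> by (intro divide_left_mono) auto
      then show ?thesis
        by simp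
    qed
    ultimately have "norm (deriv f z / f z) \<le> (M / ln (R / r2)) * ((1 + 1 / (R - r1)) / \<delta>) + 16 * r2 / (r2 - r1)\<^sup>2 * M / \<delta>"
      using norm_triangle_ineq[of "deriv f z / f z - deriv g z / g z" "deriv g z / g z"] by simp
    also have "\<dots> = K * M / \<delta>"
    proof -
      have "M / l * (a / \<delta>) + b * M / \<delta> = (a / l + b) * M / \<delta>" for l a b
        by (simp add: distrib_right add_divide_distrib)
      then show ?thesis
        unfolding K_def .
    qed
    finally show "norm (deriv f z / f z) \<le> K * M / \<delta>" .
  qed
qed

section \<open>Rectangular contours and the Cesaro kernel\<close>

abbreviation vline :: "real \<Rightarrow> real \<Rightarrow> real \<Rightarrow> complex" where
  "vline \<sigma> T \<equiv> linepath (Complex \<sigma> (- T)) (Complex \<sigma> T)"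

lemma closed_segment_vline:
  assumes "T \<ge> 0"
  shows "closed_segment (Complex \<sigma> (- T)) (Complex \<sigma> T) = {z. Re z = \<sigma> \<and> \<bar>Im z\<bar> \<le> T}"
  using assms by (auto simp: closed_segment_same_Re closed_segment_eq_real_ivl)

lemma norm_vline [simp]: "norm (Complex \<sigma> T - Complex \<sigma> (- T)) = 2 * \<bar>T\<bar>"
  by (simp add: cmod_def real_sqrt_mult)

lemma rectangle_difference:
  assumes ab: "a \<le> b" and T: "T \<ge> 0"
    and cont: "continuous_on (path_image (rectpath (Complex a (- T)) (Complex b T))) g"
    and I: "(g has_contour_integral I) (rectpath (Complex a (- T)) (Complex b T))"
    and H: "\<And>s. a \<le> Re s \<Longrightarrow> Re s \<le> b \<Longrightarrow> \<bar>Im s\<bar> = T \<Longrightarrow> norm (g s) \<le> H" and H0: "H \<ge> 0"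
  shows "norm (contour_integral (vline b T) g - contour_integral (vline a T) g - I) \<le> 2 * (b - a) * H"
proof -
  define a1 a2 a3 a4 where "a1 = Complex a (- T)" "a2 = Complex b (- T)" "a3 = Complex b T" "a4 = Complex a T"
  note a_defs = this
  have img: "path_image (rectpath (Complex a (- T)) (Complex b T)) =
      {z. Re z \<in> {a, b} \<and> Im z \<in> {-T..T}} \<union> {z. Im z \<in> {-T, T} \<and> Re z \<in> {a..b}}"
    using ab T by (subst path_image_rectpath) auto
  have seg: "closed_segment a1 a2 = {z. Im z = -T \<and> Re z \<in> {a..b}}"
    "closed_segment a2 a3 = {z. Re z = b \<and> Im z \<in> {-T..T}}"
    "closed_segment a3 a4 = {z. Im z = T \<and> Re z \<in> {a..b}}"
    "closed_segment a1 a4 = {z. Re z = a \<and> Im z \<in> {-T..T}}"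
    using ab T by (auto simp: a_defs closed_segment_same_Re closed_segment_same_Im closed_segment_eq_real_ivl)
  have c: "continuous_on (closed_segment a1 a2) g" "continuous_on (closed_segment a2 a3) g"
    "continuous_on (closed_segment a3 a4) g" "continuous_on (closed_segment a1 a4) g"
    unfolding seg by (rule continuous_on_subset[OF cont], auto simp: img)+
  have c': "continuous_on (closed_segment a4 a1) g"
    using c(4) by (simp add: closed_segment_commute)
  note ci = c[THEN contour_integrable_continuous_linepath] c'[THEN contour_integrable_continuous_linepath]
  have "rectpath (Complex a (- T)) (Complex b T) =
      linepath a1 a2 +++ linepath a2 a3 +++ linepath a3 a4 +++ linepath a4 a1"
    by (simp add: rectpath_def a_defs Let_def)
  then have "I = contour_integral (linepath a1 a2 +++ linepath a2 a3 +++ linepath a3 a4 +++ linepath a4 a1) g"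
    using contour_integral_unique[OF I] by simp
  also have "\<dots> = contour_integral (linepath a1 a2) g + contour_integral (linepath a2 a3) g
      + contour_integral (linepath a3 a4) g - contour_integral (linepath a1 a4) g"
    using ci contour_integral_reverse_linepath[OF c(4)] by (simp add: contour_integrable_joinI)
  finally have "contour_integral (linepath a2 a3) g - contour_integral (linepath a1 a4) g - I
      = - (contour_integral (linepath a1 a2) g + contour_integral (linepath a3 a4) g)"
    by simp
  then have "norm (contour_integral (linepath a2 a3) g - contour_integral (linepath a1 a4) g - I)
      \<le> norm (contour_integral (linepath a1 a2) g) + norm (contour_integral (linepath a3 a4) g)"
    by (metis norm_minus_cancel norm_triangle_ineq)
  also have "\<dots> \<le> H * norm (a2 - a1) + H * norm (a4 - a3)"
    using ci H0 H T by (intro add_mono contour_integral_bound_linepath) (auto simp: seg)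
  also have "\<dots> = 2 * (b - a) * H"
    using ab by (simp add: a_defs cmod_def algebra_simps)
  finally show ?thesis
    by (simp add: a_defs)
qed

lemma has_contour_integral_rectpath_residue:
  assumes S: "convex S" "open S" "h holomorphic_on S" "cbox (Complex a (- T)) (Complex b T) \<subseteq> S"
    and p: "a < Re p" "Re p < b" "\<bar>Im p\<bar> < T"
  shows "((\<lambda>s. h s / (s - p)) has_contour_integral (2 * of_real pi * \<i> * h p)) (rectpath (Complex a (- T)) (Complex b T))"
proof -
  have box: "p \<in> box (Complex a (- T)) (Complex b T)"
    using p by (auto simp: in_box_complex_iff)
  have "p \<in> S"
    using box box_subset_cbox S by blast
  moreover have "path_image (rectpath (Complex a (- T)) (Complex b T)) \<subseteq> S - {p}"
    using p S(4) path_image_rectpath_subset_cbox[of "Complex a (- T)" "Complex b T"]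
      path_image_rectpath_inter_box[of "Complex a (- T)" "Complex b T"] box by force
  ultimately show ?thesis
    using Cauchy_integral_formula_convex_simple[of S h p "rectpath (Complex a (- T)) (Complex b T)"] S
    by (simp add: winding_number_rectpath[OF box] interior_open)
qed

lemma has_contour_integral_rectpath_0:
  assumes S: "convex S" "h holomorphic_on S" "cbox (Complex a (- T)) (Complex b T) \<subseteq> S" "a \<le> b" "T \<ge> 0"
  shows "(h has_contour_integral 0) (rectpath (Complex a (- T)) (Complex b T))"
  using S path_image_rectpath_subset_cbox[of "Complex a (- T)" "Complex b T"]
  by (intro Cauchy_theorem_convex_simple[of _ S]) auto

text \<open>
  The kernel of the Cesaro mean of order one: over vertical lines in the right half-plane it has the
  integral \<open>2 \<pi> \<i> * max 0 (y - 1)\<close>, and it is absolutely integrable there.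
\<close>

definition cesaro :: "real \<Rightarrow> complex \<Rightarrow> complex" where
  "cesaro y s = of_real y powr (s + 1) / (s * (s + 1))"

lemma norm_of_real_powr:
  assumes "y > 0"
  shows "norm (of_real y powr s :: complex) = y powr Re s"
  using assms by (simp add: norm_powr_real_powr)

lemma norm_cesaro:
  assumes "y > 0"
  shows "norm (cesaro y s) = y powr (Re s + 1) / (norm s * norm (s + 1))"
  using assms by (simp add: cesaro_def norm_divide norm_mult norm_of_real_powr)

lemma norm_cesaro_le:
  assumes y: "y > 0" and B: "y powr (Re s + 1) \<le> B" and d: "d1 > 0" "d2 > 0" "d1 \<le> norm s" "d2 \<le> norm (s + 1)"
  shows "norm (cesaro y s) \<le> B / (d1 * d2)"
proof -
  have "0 \<le> B"
    using B powr_ge_zero order_trans by blast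
  then show ?thesis
    unfolding norm_cesaro[OF y] using B d by (intro frac_le mult_mono) auto
qed

lemma cesaro_partial_fractions:
  assumes "s \<noteq> 0" "s \<noteq> -1"
  shows "cesaro y s = of_real y powr (s + 1) / (s - 0) - of_real y powr (s + 1) / (s - (- 1))"
proof -
  have "s + 1 \<noteq> 0"
    using assms by (simp add: add_eq_0_iff2)
  then have "1 / (s * (s + 1)) = 1 / s - 1 / (s + 1)"
    using assms by (simp add: field_simps)
  then show ?thesis
    unfolding cesaro_def by (metis (no_types, opaque_lifting) diff_zero diff_minus_eq_add mult.right_neutral right_diff_distrib times_divide_eq_right)
qed

lemma continuous_on_cesaro:
  assumes "y > 0" "0 \<notin> A" "-1 \<notin> A"
  shows "continuous_on A (cesaro y)"
proof -
  have "s + 1 \<noteq> 0" if "s \<in> A" for s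
    using that assms(3) by (metis add_eq_0_iff2)
  then show ?thesis
    unfolding cesaro_def using assms by (intro continuous_intros) auto
qed

lemma holomorphic_on_cesaro:
  assumes "y > 0" "0 \<notin> A" "-1 \<notin> A"
  shows "cesaro y holomorphic_on A"
proof -
  have "s + 1 \<noteq> 0" if "s \<in> A" for s
    using that assms(3) by (metis add_eq_0_iff2)
  then show ?thesis
    unfolding cesaro_def using assms by (intro holomorphic_intros) auto
qed

text \<open>
  The line of integration is moved to the left for \<open>y \<ge> 1\<close>, past the poles 0 and -1 whose residues
  add up to \<open>y - 1\<close>, and to the right for \<open>y < 1\<close>.
\<close>

lemma contour_integral_cesaro:
  assumes y: "y > 0" and T: "T \<ge> 3"
  shows "norm (contour_integral (vline 2 T) (cesaro y) - 2 * of_real pi * \<i> * of_real (max 0 (y - 1))) \<le> 8 * y powr 3 / T"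
proof (cases "y \<ge> 1")
  case True
  let ?R = "rectpath (Complex (-T) (- T)) (Complex 2 T)"
  have notin: "0 \<notin> path_image ?R" "-1 \<notin> path_image ?R"
    using T by (auto simp: path_image_rectpath)
  have hol: "(\<lambda>s. of_real y powr (s + 1)) holomorphic_on UNIV"
    using y by (intro holomorphic_intros) auto
  have "((\<lambda>s. of_real y powr (s + 1) / (s - 0)) has_contour_integral (2 * of_real pi * \<i> * (of_real y powr (0 + 1)))) ?R"
    by (rule has_contour_integral_rectpath_residue[OF _ _ hol]) (use T in auto)
  moreover have "((\<lambda>s. of_real y powr (s + 1) / (s - (-1))) has_contour_integral (2 * of_real pi * \<i> * (of_real y powr ((-1) + 1)))) ?R"
    by (rule has_contour_integral_rectpath_residue[OF _ _ hol]) (use T in auto)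
  ultimately have "((\<lambda>s. of_real y powr (s + 1) / (s - 0) - of_real y powr (s + 1) / (s - (-1))) has_contour_integral
      (2 * of_real pi * \<i> * (of_real y powr (0 + 1)) - 2 * of_real pi * \<i> * (of_real y powr ((-1) + 1)))) ?R"
    by (rule has_contour_integral_diff)
  then have I: "(cesaro y has_contour_integral (2 * of_real pi * \<i> * (of_real y powr (0 + 1)) - 2 * of_real pi * \<i> * (of_real y powr ((-1) + 1)))) ?R"
    by (rule has_contour_integral_eq) (use notin in \<open>metis cesaro_partial_fractions\<close>)
  have I_eq: "2 * of_real pi * \<i> * (of_real y powr (0 + 1)) - 2 * of_real pi * \<i> * (of_real y powr ((-1) + 1)) =
      2 * of_real pi * \<i> * of_real (max 0 (y - 1))"
    using True y by (simp add: algebra_simps max_def)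
  have "norm (contour_integral (vline 2 T) (cesaro y) - contour_integral (vline (-T) T) (cesaro y) - 2 * of_real pi * \<i> * of_real (max 0 (y - 1)))
      \<le> 2 * (2 - (-T)) * (y powr 3 / (T * T))"
  proof (rule rectangle_difference)
    show "continuous_on (path_image ?R) (cesaro y)"
      using y notin by (intro continuous_on_cesaro)
    show "(cesaro y has_contour_integral 2 * of_real pi * \<i> * of_real (max 0 (y - 1))) ?R"
      using I unfolding I_eq .
    fix s :: complex assume s: "-T \<le> Re s" "Re s \<le> 2" "\<bar>Im s\<bar> = T"
    show "norm (cesaro y s) \<le> y powr 3 / (T * T)"
      using s y T True abs_Im_le_cmod[of s] abs_Im_le_cmod[of "s + 1"]
      by (intro norm_cesaro_le powr_mono) auto
  qed (use T in auto)
  moreover have "norm (contour_integral (vline (-T) T) (cesaro y)) \<le> 1 / (T * (T - 1)) * norm (Complex (-T) T - Complex (-T) (-T))"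
  proof (rule contour_integral_bound_linepath)
    have seg: "closed_segment (Complex (- T) (- T)) (Complex (- T) T) = {z. Re z = -T \<and> \<bar>Im z\<bar> \<le> T}"
      using T by (intro closed_segment_vline) auto
    show "cesaro y contour_integrable_on vline (- T) T"
      by (intro contour_integrable_continuous_linepath continuous_on_cesaro y) (use T in \<open>auto simp: seg\<close>)
    fix s assume "s \<in> closed_segment (Complex (- T) (- T)) (Complex (- T) T)"
    then have s: "Re s = -T"
      by (simp add: seg)
    show "norm (cesaro y s) \<le> 1 / (T * (T - 1))"
    proof (rule norm_cesaro_le[OF y])
      have "y powr (Re s + 1) \<le> y powr 0"
        using True T s by (intro powr_mono) auto
      then show "y powr (Re s + 1) \<le> 1"
        using y by simp
    qed (use T s abs_Re_le_cmod[of s] abs_Re_le_cmod[of "s + 1"] in auto)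
  qed (use T in auto)
  moreover have "1 / (T * (T - 1)) * (2 * \<bar>T\<bar>) \<le> 4 * y powr 3 / T"
  proof -
    have "1 \<le> y powr 3"
      using True by (intro ge_one_powr_ge_zero) auto
    moreover have "1 / (T * (T - 1)) * (2 * \<bar>T\<bar>) \<le> 4 * 1 / T"
      using T by (simp add: field_simps)
    moreover have "4 * 1 / T \<le> 4 * y powr 3 / T"
      using T \<open>1 \<le> y powr 3\<close> by (intro divide_right_mono) auto
    ultimately show ?thesis
      by linarith
  qed
  moreover have "2 * (2 - (-T)) * (y powr 3 / (T * T)) \<le> 4 * y powr 3 / T"
  proof -
    have "2 * (2 - (-T)) / T \<le> 4"
      using T by (simp add: field_simps)
    then have "2 * (2 - (-T)) / T * (y powr 3 / T) \<le> 4 * (y powr 3 / T)"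
      using T by (intro mult_right_mono) auto
    then show ?thesis
      by simp
  qed
  ultimately show ?thesis
    using norm_triangle_sub[of "contour_integral (vline 2 T) (cesaro y) - 2 * of_real pi * \<i> * of_real (max 0 (y - 1))" "contour_integral (vline (-T) T) (cesaro y)"]
    by (simp add: algebra_simps)
next
  case False
  let ?R = "rectpath (Complex 2 (- T)) (Complex (2 + T) T)"
  have p3: "y powr (Re s + 1) \<le> y powr 3" if "Re s \<ge> 2" for s
    using False that y by (intro powr_mono') auto
  have sub: "cbox (Complex 2 (- T)) (Complex (2 + T) T) \<subseteq> {s. Re s > 0}"
    by (auto simp: in_cbox_complex_iff)
  have conv: "convex {s. Re s > 0}"
    by (rule convex_halfspace_Re_gt)
  have hol: "cesaro y holomorphic_on {s. Re s > 0}"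
    using y by (intro holomorphic_on_cesaro) auto
  have "norm (contour_integral (vline (2 + T) T) (cesaro y) - contour_integral (vline 2 T) (cesaro y) - 0)
      \<le> 2 * (2 + T - 2) * (y powr 3 / (T * T))"
  proof (rule rectangle_difference)
    show "continuous_on (path_image ?R) (cesaro y)"
      using sub path_image_rectpath_subset_cbox[of "Complex 2 (- T)" "Complex (2 + T) T"] T
      by (intro holomorphic_on_imp_continuous_on[OF holomorphic_on_subset[OF hol]]) auto
    show "(cesaro y has_contour_integral 0) ?R"
      using hol sub conv T by (intro has_contour_integral_rectpath_0) auto
    fix s :: complex assume s: "2 \<le> Re s" "Re s \<le> 2 + T" "\<bar>Im s\<bar> = T"
    show "norm (cesaro y s) \<le> y powr 3 / (T * T)"
      using s y T p3 abs_Im_le_cmod[of s] abs_Im_le_cmod[of "s + 1"]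
      by (intro norm_cesaro_le) auto
  qed (use T in auto)
  moreover have "norm (contour_integral (vline (2 + T) T) (cesaro y)) \<le> y powr 3 / (T * T) * norm (Complex (2 + T) T - Complex (2 + T) (-T))"
  proof (rule contour_integral_bound_linepath)
    have seg: "closed_segment (Complex (2 + T) (- T)) (Complex (2 + T) T) = {z. Re z = 2 + T \<and> \<bar>Im z\<bar> \<le> T}"
      using T by (intro closed_segment_vline) auto
    show "cesaro y contour_integrable_on vline (2 + T) T"
      by (intro contour_integrable_continuous_linepath continuous_on_cesaro y) (use T in \<open>auto simp: seg\<close>)
    fix s assume "s \<in> closed_segment (Complex (2 + T) (- T)) (Complex (2 + T) T)"
    then have s: "Re s = 2 + T"
      by (simp add: seg)
    show "norm (cesaro y s) \<le> y powr 3 / (T * T)"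
      by (rule norm_cesaro_le[OF y p3]) (use T s abs_Re_le_cmod[of s] abs_Re_le_cmod[of "s + 1"] in auto)
  qed (use T in auto)
  moreover have "y powr 3 / (T * T) * (2 * \<bar>T\<bar>) \<le> 2 * y powr 3 / T" "2 * (2 + T - 2) * (y powr 3 / (T * T)) \<le> 2 * y powr 3 / T"
    using T by (simp_all add: field_simps)
  moreover have "max 0 (y - 1) = 0"
    using False by simp
  moreover have "2 * y powr 3 / T + 2 * y powr 3 / T \<le> 8 * y powr 3 / T"
    using T by (simp add: field_simps)
  ultimately show ?thesis
    using norm_triangle_ineq4[of "contour_integral (vline (2 + T) T) (cesaro y)" "contour_integral (vline (2 + T) T) (cesaro y) - contour_integral (vline 2 T) (cesaro y)"]
    by simp
qed

section \<open>The logarithmic derivative near the critical line\<close>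

text \<open>To the left of, on, and to the right of the line \<open>Re s = 1\<close>, the reason is GRH,
  \<open>dirichlet_L_nonzero_line_1\<close>, and the Dirichlet series, respectively.\<close>

lemma GRH_nonzero:
  assumes GRH and ch: "dirichlet_character N \<psi>"
    and s: "Re s > 1 / 2" "\<not> principal_character \<psi> \<or> s \<noteq> 1"
  shows "dirichlet_L \<psi> s \<noteq> 0"
proof -
  consider "Re s < 1" | "Re s = 1" | "Re s > 1"
    by linarith
  then show ?thesis
  proof cases
    case 1
    show ?thesis
    proof
      assume "dirichlet_L \<psi> s = 0"
      then have "dirichlet_character N \<psi> \<and> 0 < Re s \<and> Re s < 1 \<and> dirichlet_L \<psi> s = 0"
        using 1 s(1) ch by simp
      then have "Re s = 1 / 2"
        using assms(1) unfolding GRH_def by blast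
      then show False
        using s(1) by simp
    qed
  next
    case 2
    then have eq: "s = 1 + \<i> * of_real (Im s)"
      by (simp add: complex_eq_iff)
    have "\<not> principal_character \<psi> \<or> Im s \<noteq> 0"
      using s(2) 2 by (auto simp: complex_eq_iff)
    then show ?thesis
      by (subst eq) (rule dirichlet_L_nonzero_line_1[OF ch])
  next
    case 3
    then show ?thesis
      by (rule dirichlet_L_nonzero[OF ch])
  qed
qed

lemma one_le_ln_plus_3: "1 \<le> ln (\<bar>t\<bar> + 3 :: real)"
proof -
  have "ln (exp 1) \<le> ln (\<bar>t\<bar> + 3)"
    using exp_le by (subst ln_le_cancel_iff) auto
  then show ?thesis
    by simp
qed

lemma log_deriv_L_eq:
  assumes ch: "dirichlet_character N \<psi>"
    and E: "\<And>s. s \<noteq> 1 \<Longrightarrow> E s = (s - 1) * dirichlet_L \<psi> s"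
    and s1: "s \<noteq> 1" and Ls: "dirichlet_L \<psi> s \<noteq> 0"
  shows "deriv (dirichlet_L \<psi>) s / dirichlet_L \<psi> s = deriv E s / E s - 1 / (s - 1)"
proof -
  have hol: "dirichlet_L \<psi> holomorphic_on - {1}"
    by (rule holomorphic_on_subset[OF dirichlet_L_continuation(1)[OF ch]]) auto
  have "(dirichlet_L \<psi> has_field_derivative deriv (dirichlet_L \<psi>) s) (at s)"
    by (rule holomorphic_derivI[OF hol]) (use s1 in auto)
  then have "((\<lambda>s. (s - 1) * dirichlet_L \<psi> s) has_field_derivative (dirichlet_L \<psi> s + (s - 1) * deriv (dirichlet_L \<psi>) s)) (at s)"
    by (auto intro!: derivative_eq_intros)
  then have "(E has_field_derivative (dirichlet_L \<psi> s + (s - 1) * deriv (dirichlet_L \<psi>) s)) (at s)"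
    by (rule has_field_derivative_transform_within_open[where S = "- {1}"]) (use s1 E in auto)
  then have "deriv E s = dirichlet_L \<psi> s + (s - 1) * deriv (dirichlet_L \<psi>) s"
    by (rule DERIV_imp_deriv)
  then show ?thesis
    using s1 Ls by (simp add: E[OF s1] add_divide_distrib)
qed

text \<open>
  The disc of radius 2.9 around \<open>3 + \<i> t\<close> lies in the half-plane of polynomial growth, and the disc
  of radius 2.5 reaches the critical line. The point 1, a zero of \<open>(s - 1) L s\<close> unless \<open>\<psi>\<close> is
  principal, is the only possible zero to the right of the critical line.
\<close>

lemma GRH_log_deriv_bound:
  assumes GRH and ch: "dirichlet_character N \<psi>"
  obtains B where "B > 0"
    "\<And>\<delta> s. 0 < \<delta> \<Longrightarrow> \<delta> \<le> 1 \<Longrightarrow> 1 / 2 + \<delta> \<le> Re s \<Longrightarrow> Re s \<le> 3 \<Longrightarrow> \<delta> \<le> norm (s - 1) \<Longrightarrow>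
       norm (deriv (dirichlet_L \<psi>) s / dirichlet_L \<psi> s) \<le> B / \<delta> * ln (\<bar>Im s\<bar> + 3)"
proof -
  obtain E C where E: "E holomorphic_on UNIV" "\<And>s. s \<noteq> 1 \<Longrightarrow> E s = (s - 1) * dirichlet_L \<psi> s"
    "E 1 = 0 \<longleftrightarrow> \<not> principal_character \<psi>"
    "\<And>s. Re s \<ge> 1 / 10 \<Longrightarrow> norm (E s) \<le> C * (1 + norm s)\<^sup>2"
    by (rule entire_multiple_of_L[OF ch]) (rule that)
  show thesis
  proof (rule log_deriv_bound_away_from_zeros[of "5 / 2" "11 / 4" "29 / 10"])
    fix K :: real
    assume K: "K > 0"
      "\<And>f M \<delta> z R'. f holomorphic_on ball 0 R' \<Longrightarrow> 29 / 10 < R' \<Longrightarrow> f 0 \<noteq> 0 \<Longrightarrow> M > 0 \<Longrightarrow>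
         (\<And>w. norm w = 29 / 10 \<Longrightarrow> norm (f w) \<le> exp M * norm (f 0)) \<Longrightarrow>
         0 < \<delta> \<Longrightarrow> \<delta> \<le> 1 \<Longrightarrow> norm z \<le> 5 / 2 \<Longrightarrow>
         (\<And>\<rho>. norm \<rho> \<le> 11 / 4 \<Longrightarrow> f \<rho> = 0 \<Longrightarrow> \<delta> \<le> norm (z - \<rho>)) \<Longrightarrow>
         norm (deriv f z / f z) \<le> K * M / \<delta>"
    define C' where "C' = max 1 C"
    have C': "C' \<ge> 1" "C' \<ge> C"
      by (auto simp: C'_def)
    define A where "A = ln C' + 4"
    have A: "A > 0"
      using C' by (simp add: A_def add_nonneg_pos)
    show thesis
    proof (rule that[of "K * A + 1"])
      show "K * A + 1 > 0"
        using K A by (simp add: add_pos_pos)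
      fix \<delta> :: real and s :: complex
      assume \<delta>: "0 < \<delta>" "\<delta> \<le> 1" and s: "1 / 2 + \<delta> \<le> Re s" "Re s \<le> 3" "\<delta> \<le> norm (s - 1)"
      define t where "t = Im s"
      define c where "c = Complex 3 t"
      define f where "f w = E (c + w)" for w
      define z where "z = s - c"
      have s1: "s \<noteq> 1"
        using s \<delta> by auto
      have Ls: "dirichlet_L \<psi> s \<noteq> 0"
        using s \<delta> s1 by (intro GRH_nonzero[OF assms]) auto
      have f: "f holomorphic_on ball 0 3"
        unfolding f_def by (intro holomorphic_on_compose_gen[OF _ E(1), unfolded o_def] holomorphic_intros) auto
      have f0: "norm (f 0) \<ge> 1"
      proof -
        have "c \<noteq> 1"
          by (simp add: c_def complex_eq_iff)
        then have "norm (f 0) = norm (c - 1) * norm (dirichlet_L \<psi> c)"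
          using E(2) by (simp add: f_def norm_mult)
        moreover have "norm (c - 1) \<ge> 2"
          using abs_Re_le_cmod[of "c - 1"] by (simp add: c_def)
        moreover have "norm (dirichlet_L \<psi> c) \<ge> 1 / 2"
          by (rule norm_dirichlet_L_ge[OF ch]) (simp add: c_def)
        ultimately have "2 * (1 / 2) \<le> norm (f 0)"
          by (metis mult_mono norm_ge_zero divide_nonneg_nonneg zero_le_one zero_le_numeral order_trans)
        then show ?thesis
          by simp
      qed
      define M where "M = ln C' + 2 * ln (\<bar>t\<bar> + 7)"
      have M_pos: "M > 0"
        using C' by (simp add: M_def add_nonneg_pos)
      have expM: "exp M = C' * (\<bar>t\<bar> + 7)\<^sup>2"
        using C' by (simp add: M_def exp_add power2_eq_square exp_double)
      have "norm (deriv f z / f z) \<le> K * M / \<delta>"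
      proof (rule K(2)[OF f])
        show "f 0 \<noteq> 0"
          using f0 by auto
        fix w :: complex assume w: "norm w = 29 / 10"
        have "Re (c + w) \<ge> 1 / 10"
          using abs_Re_le_cmod[of w] w by (simp add: c_def)
        then have "norm (f w) \<le> C * (1 + norm (c + w))\<^sup>2"
          unfolding f_def by (rule E(4))
        also have "\<dots> \<le> C' * (\<bar>t\<bar> + 7)\<^sup>2"
        proof -
          have "norm c \<le> 3 + \<bar>t\<bar>"
            using cmod_le[of c] by (simp add: c_def)
          then have "1 + norm (c + w) \<le> \<bar>t\<bar> + 7"
            using norm_triangle_ineq[of c w] w by simp
          then have "(1 + norm (c + w))\<^sup>2 \<le> (\<bar>t\<bar> + 7)\<^sup>2"
            by (intro power_mono) auto
          then show ?thesis
            using C' by (intro mult_mono) auto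
        qed
        also have "\<dots> = exp M * 1"
          by (simp add: expM)
        also have "\<dots> \<le> exp M * norm (f 0)"
          using f0 by (intro mult_left_mono) auto
        finally show "norm (f w) \<le> exp M * norm (f 0)" .
      next
        have "z = of_real (Re s - 3)"
          by (simp add: z_def c_def t_def complex_eq_iff)
        then show "norm z \<le> 5 / 2"
          using s \<delta> by (simp only: norm_of_real)
      next
        fix \<rho> :: complex assume \<rho>: "norm \<rho> \<le> 11 / 4" "f \<rho> = 0"
        show "\<delta> \<le> norm (z - \<rho>)"
        proof (cases "c + \<rho> = 1")
          case True
          then have "z - \<rho> = s - 1"
            by (simp add: z_def algebra_simps)
          then show ?thesis
            using s by simp
        next
          case False
          then have "dirichlet_L \<psi> (c + \<rho>) = 0"
            using \<rho> E(2)[OF False] by (simp add: f_def)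
          then have "Re (c + \<rho>) \<le> 1 / 2"
            using GRH_nonzero[OF assms, of "c + \<rho>"] False by force
          then have "\<delta> \<le> Re (z - \<rho>)"
            using s by (simp add: z_def)
          then show ?thesis
            using complex_Re_le_cmod[of "z - \<rho>"] by linarith
        qed
      qed (use M_pos \<delta> in auto)
      moreover have "f z = E s"
        by (simp add: f_def z_def)
      moreover have "deriv f z = deriv E s"
      proof -
        have "(E has_field_derivative deriv E s) (at (z + c))"
          using holomorphic_derivI[OF E(1) open_UNIV, of s] by (simp add: z_def)
        then have "((\<lambda>w. E (w + c)) has_field_derivative deriv E s) (at z)"
          by (simp only: DERIV_shift)
        then show ?thesis
          unfolding f_def by (intro DERIV_imp_deriv) (simp add: add.commute)
      qed
      ultimately have 1: "norm (deriv E s / E s) \<le> K * M / \<delta>"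
        by simp
      have "deriv (dirichlet_L \<psi>) s / dirichlet_L \<psi> s = deriv E s / E s - 1 / (s - 1)"
        by (rule log_deriv_L_eq[OF ch E(2) s1 Ls])
      moreover have "norm (1 / (s - 1)) \<le> 1 / \<delta>"
        using s \<delta> by (auto simp: norm_divide intro!: divide_left_mono mult_pos_pos)
      ultimately have 2: "norm (deriv (dirichlet_L \<psi>) s / dirichlet_L \<psi> s) \<le> K * M / \<delta> + 1 / \<delta>"
        using 1 norm_triangle_ineq4[of "deriv E s / E s" "1 / (s - 1)"] by simp
      define l where "l = ln (\<bar>t\<bar> + 3)"
      have l1: "l \<ge> 1"
        unfolding l_def by (rule one_le_ln_plus_3)
      have "(\<bar>t\<bar> + 3)\<^sup>2 = t\<^sup>2 + 6 * \<bar>t\<bar> + 9"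
        by (simp add: power2_eq_square algebra_simps)
      then have "\<bar>t\<bar> + 7 \<le> (\<bar>t\<bar> + 3)\<^sup>2"
        using zero_le_power2[of t] by linarith
      then have "ln (\<bar>t\<bar> + 7) \<le> ln ((\<bar>t\<bar> + 3)\<^sup>2)"
        by (intro ln_mono) auto
      then have "ln (\<bar>t\<bar> + 7) \<le> 2 * l"
        by (simp add: l_def ln_realpow)
      moreover have "ln C' * 1 \<le> ln C' * l"
        using l1 C' by (intro mult_left_mono) auto
      ultimately have "M \<le> A * l"
        by (simp add: M_def A_def algebra_simps)
      then have "K * M + 1 \<le> K * (A * l) + l"
        using K l1 by (intro add_mono mult_left_mono) auto
      then have "(K * M + 1) / \<delta> \<le> ((K * A + 1) * l) / \<delta>"
        using \<delta> by (intro divide_right_mono) (auto simp: algebra_simps)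
      then have 3: "K * M / \<delta> + 1 / \<delta> \<le> (K * A + 1) / \<delta> * l"
        by (simp only: add_divide_distrib[of "K * M"] times_divide_eq_left)
      show "norm (deriv (dirichlet_L \<psi>) s / dirichlet_L \<psi> s) \<le> (K * A + 1) / \<delta> * ln (\<bar>Im s\<bar> + 3)"
        using order_trans[OF 2 3] by (simp only: l_def t_def)
    qed
  qed simp_all
qed

section \<open>The kernel of a tent function\<close>

text \<open>The second difference of \<open>max 0\<close> with step \<open>h\<close>: it is supported on \<open>[X, X + 2 h]\<close> and has its maximum \<open>h\<close> at
  \<open>X + h\<close>.\<close>

definition tent :: "real \<Rightarrow> real \<Rightarrow> real \<Rightarrow> real" where
  "tent X h u = max 0 (X + 2 * h - u) - 2 * max 0 (X + h - u) + max 0 (X - u)"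

text \<open>\<open>cesaro Y s * n powr (- s) = n * cesaro (Y / n) s\<close> has the integral \<open>2 \<pi> \<i> * max 0 (Y - n)\<close>
  over vertical lines, so this is the Mellin transform of \<open>tent X h\<close>.\<close>

definition tent_kernel :: "real \<Rightarrow> real \<Rightarrow> complex \<Rightarrow> complex" where
  "tent_kernel X h s = cesaro (X + 2 * h) s - 2 * cesaro (X + h) s + cesaro X s"

lemma tent_bounds:
  assumes "h > 0"
  shows "0 \<le> tent X h u" "tent X h u \<le> h" "tent X h u \<noteq> 0 \<Longrightarrow> X < u \<and> u < X + 2 * h"
  using assms by (auto simp: tent_def max_def split: if_splits)

lemma tent_kernel_1:
  assumes "X > 0" "h > 0"
  shows "tent_kernel X h 1 = of_real (h\<^sup>2)"
proof -
  have *: "cesaro y 1 = of_real (y\<^sup>2 / 2)" if "y > 0" for y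
    using that by (simp add: cesaro_def)
  have "tent_kernel X h 1 = of_real ((X + 2 * h)\<^sup>2 / 2) - 2 * of_real ((X + h)\<^sup>2 / 2) + of_real (X\<^sup>2 / 2)"
    unfolding tent_kernel_def using assms by (subst (1 2 3) *) auto
  also have "\<dots> = of_real ((X + 2 * h)\<^sup>2 / 2 - 2 * ((X + h)\<^sup>2 / 2) + X\<^sup>2 / 2)"
    by simp
  also have "(X + 2 * h)\<^sup>2 / 2 - 2 * ((X + h)\<^sup>2 / 2) + X\<^sup>2 / 2 = h\<^sup>2"
    by (simp add: power2_eq_square field_simps)
  finally show ?thesis .
qed

lemma holomorphic_tent_kernel:
  assumes "X > 0" "h > 0" "0 \<notin> A" "-1 \<notin> A"
  shows "tent_kernel X h holomorphic_on A"
  unfolding tent_kernel_def using assms by (intro holomorphic_intros holomorphic_on_cesaro) auto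

text \<open>The kernel is a second difference of a function with second derivative \<open>u powr (s - 1)\<close>.\<close>

lemma norm_tent_kernel_le_small:
  assumes X: "X > 0" and h: "h > 0" and s: "0 < Re s" "Re s \<le> 1"
  shows "norm (tent_kernel X h s) \<le> h\<^sup>2 * X powr (Re s - 1)"
proof -
  define S where "S a = closed_segment (of_real a) (of_real (a + h) :: complex)" for a
  have SE: "\<exists>v. u = of_real v \<and> a \<le> v \<and> v \<le> a + h" if "u \<in> S a" for u a
    using that h unfolding S_def closed_segment_of_real by (auto simp: closed_segment_eq_real_ivl)
  have Sab: "of_real a \<in> S a" "of_real (a + h) \<in> S a" for a
    by (simp_all only: S_def ends_in_segment)
  define f where "f u = u powr (s + 1) / (s * (s + 1))" for u :: complex
  define f' where "f' u = u powr s / s" for u :: complex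
  have s0: "s \<noteq> 0" "s + 1 \<noteq> 0"
    using s by (auto simp: complex_eq_iff)
  have nonneg: "of_real v \<notin> \<real>\<^sub>\<le>\<^sub>0" if "v > 0" for v
    using that by simp
  have df: "(f has_field_derivative f' u) (at u within A)" if "u = of_real v" "v > 0" for u v A
  proof -
    have "((\<lambda>u. u powr (s + 1)) has_field_derivative (s + 1) * u powr (s + 1 - 1)) (at u)"
      by (rule has_field_derivative_powr) (use that nonneg in auto)
    from DERIV_cdivide[OF this, of "s * (s + 1)"]
    have "(f has_field_derivative f' u) (at u)"
      unfolding f_def f'_def using s0 by simp
    then show ?thesis
      by (rule has_field_derivative_at_within)
  qed
  have df': "(f' has_field_derivative u powr (s - 1)) (at u within A)" if "u = of_real v" "v > 0" for u v A
  proof -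
    have "((\<lambda>u. u powr s) has_field_derivative s * u powr (s - 1)) (at u)"
      by (rule has_field_derivative_powr) (use that nonneg in auto)
    from DERIV_cdivide[OF this, of s]
    have "(f' has_field_derivative u powr (s - 1)) (at u)"
      unfolding f'_def using s0 by simp
    then show ?thesis
      by (rule has_field_derivative_at_within)
  qed
  have 1: "norm (f' (of_real (v + h)) - f' (of_real v)) \<le> h * X powr (Re s - 1)" if v: "X \<le> v" for v
  proof -
    have "norm (f' (of_real (v + h)) - f' (of_real v)) \<le> X powr (Re s - 1) * norm (of_real (v + h) - of_real v :: complex)"
    proof (rule field_differentiable_bound[where S = "S v"])
      fix u assume "u \<in> S v"
      then obtain w where w: "u = of_real w" "v \<le> w"
        using SE by blast
      then show "(f' has_field_derivative u powr (s - 1)) (at u within S v)"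
        using v X by (intro df'[of _ w]) auto
      show "norm (u powr (s - 1)) \<le> X powr (Re s - 1)"
        using w v X s by (simp add: norm_powr_real_powr powr_mono2')
    qed (use Sab in \<open>simp_all only: S_def convex_closed_segment\<close>)
    then show ?thesis
      using h by (simp add: mult.commute)
  qed
  define \<phi> where "\<phi> u = f (u + of_real h) - f u" for u
  have "norm (\<phi> (of_real (X + h)) - \<phi> (of_real X)) \<le> (h * X powr (Re s - 1)) * norm (of_real (X + h) - of_real X :: complex)"
  proof (rule field_differentiable_bound[where S = "S X"])
    fix u assume "u \<in> S X"
    then obtain w where w: "u = of_real w" "X \<le> w"
      using SE by blast
    have "(f has_field_derivative f' (u + of_real h)) (at (u + of_real h))"
      using w X h by (intro df[of _ "w + h"]) auto
    then have "((\<lambda>u. f (u + of_real h)) has_field_derivative f' (u + of_real h)) (at u)"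
      by (simp only: DERIV_shift)
    then have "((\<lambda>u. f (u + of_real h)) has_field_derivative f' (u + of_real h)) (at u within S X)"
      by (rule has_field_derivative_at_within)
    moreover have "(f has_field_derivative f' u) (at u within S X)"
      using w X by (intro df[of _ w]) auto
    ultimately show "(\<phi> has_field_derivative f' (u + of_real h) - f' u) (at u within S X)"
      unfolding \<phi>_def by (rule DERIV_diff)
    show "norm (f' (u + of_real h) - f' u) \<le> h * X powr (Re s - 1)"
      using 1[OF w(2)] w(1) by simp
  qed (use Sab in \<open>simp_all only: S_def convex_closed_segment\<close>)
  moreover have "\<phi> (of_real (X + h)) - \<phi> (of_real X) = tent_kernel X h s"
    by (simp add: \<phi>_def f_def tent_kernel_def cesaro_def add_ac)
  ultimately show ?thesis
    using h by (simp add: power2_eq_square mult_ac)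
qed

lemma norm_tent_kernel_le_large:
  assumes X: "X > 0" and h: "h > 0" "h \<le> X" and s: "Re s > 0" "Im s \<noteq> 0"
  shows "norm (tent_kernel X h s) \<le> 4 * (3 * X) powr (Re s + 1) / (Im s)\<^sup>2"
proof -
  have *: "norm (cesaro Y s) \<le> (3 * X) powr (Re s + 1) / (\<bar>Im s\<bar> * \<bar>Im s\<bar>)" if "0 < Y" "Y \<le> 3 * X" for Y
    using that s abs_Im_le_cmod[of s] abs_Im_le_cmod[of "s + 1"] by (intro norm_cesaro_le powr_mono2) auto
  have "norm (tent_kernel X h s) \<le> norm (cesaro (X + 2 * h) s) + norm (2 * cesaro (X + h) s) + norm (cesaro X s)"
    unfolding tent_kernel_def
    using norm_triangle_ineq[of "cesaro (X + 2 * h) s - 2 * cesaro (X + h) s" "cesaro X s"]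
      norm_triangle_ineq4[of "cesaro (X + 2 * h) s" "2 * cesaro (X + h) s"] by linarith
  also have "norm (2 * cesaro (X + h) s) = 2 * norm (cesaro (X + h) s)"
    by (simp add: norm_mult)
  finally show ?thesis
    using *[of "X + 2 * h"] *[of "X + h"] *[of X] X h by (simp add: power2_eq_square)
qed

text \<open>
  The bound for small \<open>\<bar>Im s\<bar>\<close> and the trivial bound for large \<open>\<bar>Im s\<bar>\<close> cross at \<open>\<bar>Im s\<bar> = X / h\<close>.
\<close>

lemma norm_tent_kernel_le:
  assumes X: "X > 0" and h: "h > 0" "h \<le> X" and s: "0 < Re s" "Re s \<le> 1"
  shows "norm (tent_kernel X h s) \<le> 144 * X powr (Re s + 1) / (X / h + \<bar>Im s\<bar>)\<^sup>2"
proof (cases "\<bar>Im s\<bar> \<le> X / h")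
  case True
  have "(X / h + \<bar>Im s\<bar>)\<^sup>2 \<le> (2 * (X / h))\<^sup>2"
    using True X h by (intro power_mono) auto
  then have sq: "(X / h + \<bar>Im s\<bar>)\<^sup>2 \<le> 4 * (X\<^sup>2 / h\<^sup>2)"
    by (simp add: power_divide power_mult_distrib)
  have pos: "X / h + \<bar>Im s\<bar> > 0"
    using X h by (intro add_pos_nonneg) auto
  have "h\<^sup>2 * X powr (Re s - 1) = X powr (Re s + 1) * (h\<^sup>2 / X\<^sup>2)"
    using X by (simp add: powr_diff powr_add power2_eq_square field_simps)
  also have "\<dots> = X powr (Re s + 1) * 4 / (4 * (X\<^sup>2 / h\<^sup>2))"
    using X h by (simp add: field_simps)
  also have "\<dots> \<le> X powr (Re s + 1) * 144 / (X / h + \<bar>Im s\<bar>)\<^sup>2"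
    using sq pos by (intro frac_le) (auto intro!: mult_left_mono)
  finally show ?thesis
    using norm_tent_kernel_le_small[OF X h(1) s] by (simp add: mult.commute)
next
  case False
  have t: "\<bar>Im s\<bar> > 0"
    using False X h by (smt (verit) divide_nonneg_nonneg)
  have "(X / h + \<bar>Im s\<bar>)\<^sup>2 \<le> (2 * \<bar>Im s\<bar>)\<^sup>2"
    using False X h by (intro power_mono) auto
  then have sq: "(X / h + \<bar>Im s\<bar>)\<^sup>2 \<le> 4 * (Im s)\<^sup>2"
    by (simp add: power_mult_distrib)
  have pos: "X / h + \<bar>Im s\<bar> > 0"
    using t X h by (intro add_nonneg_pos) auto
  have "3 powr (Re s + 1) \<le> (3::real) powr 2"
    using s by (intro powr_mono) auto
  then have "(3 * X) powr (Re s + 1) \<le> 9 * X powr (Re s + 1)"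
    using X by (simp add: powr_mult mult_right_mono)
  then have "4 * (3 * X) powr (Re s + 1) / (Im s)\<^sup>2 \<le> 4 * (9 * X powr (Re s + 1)) / (Im s)\<^sup>2"
    by (intro divide_right_mono mult_left_mono) auto
  also have "\<dots> = 144 * X powr (Re s + 1) / (4 * (Im s)\<^sup>2)"
    by simp
  also have "\<dots> \<le> 144 * X powr (Re s + 1) / (X / h + \<bar>Im s\<bar>)\<^sup>2"
    using sq pos by (intro divide_left_mono) (auto intro!: mult_pos_pos)
  finally show ?thesis
    using norm_tent_kernel_le_large[OF X h s(1)] t by simp
qed

section \<open>Sums over prime powers, weighted by a tent function\<close>

lemma of_real_powr_eq_exp:
  assumes "x > 0"
  shows "(of_real x :: complex) powr z = exp (z * of_real (ln x))"
  using assms by (simp add: powr_def Ln_of_real)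

lemma powr_mult_cesaro:
  assumes "n > 0" "Y > 0"
  shows "of_nat n powr (- s) * cesaro Y s = of_nat n * cesaro (Y / real n) s"
proof -
  have "(of_nat n :: complex) = exp (of_real (ln (real n)))"
    using assms by (simp add: exp_of_real)
  then have "of_nat n * (of_real (Y / real n) :: complex) powr (s + 1) =
      exp (of_real (ln (real n))) * exp ((s + 1) * of_real (ln Y - ln (real n)))"
    using assms by (subst of_real_powr_eq_exp) (auto simp: ln_div)
  also have "\<dots> = exp (- s * of_real (ln (real n))) * exp ((s + 1) * of_real (ln Y))"
    by (simp add: algebra_simps flip: exp_add)
  also have "\<dots> = of_nat n powr (- s) * of_real Y powr (s + 1)"
    using assms of_real_powr_eq_exp[of "real n" "- s"] of_real_powr_eq_exp[of Y "s + 1"] by simp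
  finally show ?thesis
    by (simp add: cesaro_def)
qed

lemma subpolynomial_mangoldt: "subpolynomial mangoldt"
  by (rule subpolynomial_comparison[OF subpolynomial_log_deriv_coeff[OF principal_char(1)[of 1]]])
     (auto simp: log_deriv_coeff_def principal_char_def)

lemma summable_mangoldt: "summable (\<lambda>n. mangoldt n * real n powr (- 2))"
  using dseries_summable(1)[OF subpolynomial_mangoldt, of 2] by (simp add: norm_mult norm_of_nat_powr)

text \<open>Integration term by term and the formula for the integral of the Cesaro kernel.\<close>

lemma contour_integral_dseries_cesaro:
  assumes ch: "dirichlet_character N \<psi>" and Y: "Y > 0" and T: "T \<ge> 3" and M: "real M \<ge> Y"
  shows "norm (contour_integral (vline 2 T) (\<lambda>s. dseries (log_deriv_coeff \<psi>) s * cesaro Y s)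
      - 2 * of_real pi * \<i> * (\<Sum>n<M. log_deriv_coeff \<psi> n * of_real (max 0 (Y - real n))))
      \<le> 8 * (\<Sum>n. mangoldt n * real n powr (- 2)) * Y powr 3 / T"
proof -
  define t where "t n s = log_deriv_coeff \<psi> n * of_nat n powr (- s) * cesaro Y s" for n s
  define I where "I n = contour_integral (vline 2 T) (t n)" for n
  have seg: "closed_segment (Complex 2 (- T)) (Complex 2 T) = {z. Re z = 2 \<and> \<bar>Im z\<bar> \<le> T}"
    using T by (intro closed_segment_vline) auto
  have cont_ces: "continuous_on (path_image (vline 2 T)) (cesaro y)" if "y > 0" for y
    using that by (intro continuous_on_cesaro) (auto simp: seg)
  have cont_t: "continuous_on (path_image (vline 2 T)) (t n)" for n
  proof (cases "n = 0")
    case False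
    then show ?thesis
      unfolding t_def by (intro continuous_intros cont_ces Y) auto
  qed (simp add: t_def)
  have int_t: "t n contour_integrable_on (vline 2 T)" for n
    using cont_t[of n] by (intro contour_integrable_continuous_linepath) simp
  have ul: "uniform_limit (path_image (vline 2 T)) (\<lambda>k s. \<Sum>n<k. t n s) (\<lambda>s. \<Sum>n. t n s) sequentially"
  proof (rule Weierstrass_m_test)
    show "summable (\<lambda>n. mangoldt n * real n powr (- 2) * (Y powr 3 / (2 * 3)))"
      by (intro summable_mult2 summable_mangoldt)
    fix n s assume "s \<in> path_image (vline 2 T)"
    then have s: "Re s = 2"
      by (simp add: seg)
    have "norm (cesaro Y s) \<le> Y powr 3 / (2 * 3)"
      using s abs_Re_le_cmod[of s] abs_Re_le_cmod[of "s + 1"] by (intro norm_cesaro_le Y) auto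
    then show "norm (t n s) \<le> mangoldt n * real n powr (- 2) * (Y powr 3 / (2 * 3))"
      unfolding t_def norm_mult norm_of_nat_powr using s norm_log_deriv_coeff_le[OF ch, of n] mangoldt_nonneg[of n]
      by (intro mult_mono) auto
  qed
  have "(\<lambda>k. contour_integral (vline 2 T) (\<lambda>s. \<Sum>n<k. t n s)) \<longlonglongrightarrow> contour_integral (vline 2 T) (\<lambda>s. \<Sum>n. t n s)"
  proof (rule contour_integral_uniform_limit(2)[OF _ ul])
    show "\<forall>\<^sub>F k in sequentially. (\<lambda>s. \<Sum>n<k. t n s) contour_integrable_on vline 2 T"
      by (intro always_eventually allI contour_integrable_sum int_t) auto
    show "norm (vector_derivative (vline 2 T) (at u)) \<le> 2 * \<bar>T\<bar>" for u
      by simp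
  qed auto
  moreover have "contour_integral (vline 2 T) (\<lambda>s. \<Sum>n<k. t n s) = (\<Sum>n<k. I n)" for k
    unfolding I_def by (intro contour_integral_sum int_t) auto
  moreover have "contour_integral (vline 2 T) (\<lambda>s. \<Sum>n. t n s) =
      contour_integral (vline 2 T) (\<lambda>s. dseries (log_deriv_coeff \<psi>) s * cesaro Y s)"
  proof (rule contour_integral_eq)
    fix s assume "s \<in> path_image (vline 2 T)"
    then have "Re s > 1"
      by (simp add: seg)
    from dseries_summable(2)[OF subpolynomial_log_deriv_coeff[OF ch] this]
    have "(\<lambda>n. t n s) sums (dseries (log_deriv_coeff \<psi>) s * cesaro Y s)"
      unfolding t_def by (rule sums_mult2)
    then show "(\<Sum>n. t n s) = dseries (log_deriv_coeff \<psi>) s * cesaro Y s"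
      by (rule sums_unique[symmetric])
  qed
  ultimately have I_sums: "I sums contour_integral (vline 2 T) (\<lambda>s. dseries (log_deriv_coeff \<psi>) s * cesaro Y s)"
    by (simp add: sums_def)
  define W where "W n = 2 * of_real pi * \<i> * (log_deriv_coeff \<psi> n * of_real (max 0 (Y - real n)))" for n
  have "W sums (\<Sum>n<M. W n)"
    using M by (intro sums_finite) (auto simp: W_def)
  also have "(\<Sum>n<M. W n) = 2 * of_real pi * \<i> * (\<Sum>n<M. log_deriv_coeff \<psi> n * of_real (max 0 (Y - real n)))"
    by (simp add: W_def sum_distrib_left)
  finally have diff: "(\<lambda>n. I n - W n) sums (contour_integral (vline 2 T) (\<lambda>s. dseries (log_deriv_coeff \<psi>) s * cesaro Y s)
      - 2 * of_real pi * \<i> * (\<Sum>n<M. log_deriv_coeff \<psi> n * of_real (max 0 (Y - real n))))"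
    by (intro sums_diff I_sums)
  have le: "norm (I n - W n) \<le> mangoldt n * real n powr (- 2) * (8 * Y powr 3 / T)" for n
  proof (cases "n = 0")
    case True
    have "t 0 = (\<lambda>_. 0)"
      by (simp add: t_def fun_eq_iff)
    then show ?thesis
      using True by (simp add: I_def W_def log_deriv_coeff_def)
  next
    case False
    have n: "real n > 0" "Y / real n > 0"
      using False Y by auto
    have tn: "t n = (\<lambda>s. (log_deriv_coeff \<psi> n * of_nat n) * cesaro (Y / real n) s)"
      using powr_mult_cesaro[of n Y] False Y by (simp add: t_def mult.assoc fun_eq_iff)
    have "I n = (log_deriv_coeff \<psi> n * of_nat n) * contour_integral (vline 2 T) (cesaro (Y / real n))"
      unfolding I_def tn using cont_ces[OF n(2)]
      by (simp add: contour_integral_lmul contour_integrable_continuous_linepath)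
    moreover have "W n = (log_deriv_coeff \<psi> n * of_nat n) * (2 * of_real pi * \<i> * of_real (max 0 (Y / real n - 1)))"
    proof -
      have "max 0 (Y - real n) = real n * max 0 (Y / real n - 1)"
        using n by (simp add: max_def field_simps)
      then show ?thesis
        by (simp add: W_def mult_ac)
    qed
    ultimately have "norm (I n - W n) = norm (log_deriv_coeff \<psi> n) * real n *
        norm (contour_integral (vline 2 T) (cesaro (Y / real n)) - 2 * of_real pi * \<i> * of_real (max 0 (Y / real n - 1)))"
      by (simp add: norm_mult flip: right_diff_distrib)
    also have "\<dots> \<le> mangoldt n * real n * (8 * (Y / real n) powr 3 / T)"
      using norm_log_deriv_coeff_le[OF ch, of n] contour_integral_cesaro[OF n(2) T] mangoldt_nonneg[of n]
      by (intro mult_mono) auto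
    also have "\<dots> = mangoldt n * real n powr (- 2) * (8 * Y powr 3 / T)"
      using n Y by (simp add: powr_divide powr_minus field_simps power2_eq_square power3_eq_cube)
    finally show ?thesis .
  qed
  have sm: "summable (\<lambda>n. mangoldt n * real n powr (- 2) * (8 * Y powr 3 / T))"
    by (intro summable_mult2 summable_mangoldt)
  have "norm (\<Sum>n. I n - W n) \<le> (\<Sum>n. mangoldt n * real n powr (- 2) * (8 * Y powr 3 / T))"
    by (rule norm_suminf_le[OF le sm])
  also have "\<dots> = 8 * (\<Sum>n. mangoldt n * real n powr (- 2)) * Y powr 3 / T"
    using suminf_mult2[OF summable_mangoldt, of "8 * Y powr 3 / T"] by (simp add: mult_ac)
  finally show ?thesis
    using sums_unique[OF diff] by simp
qed

lemma contour_integral_dseries_tent_kernel: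
  assumes ch: "dirichlet_character N \<psi>" and X: "X > 0" and h: "h > 0" and M: "real M \<ge> X + 2 * h"
  obtains D where "\<And>T. T \<ge> 3 \<Longrightarrow> norm (contour_integral (vline 2 T) (\<lambda>s. dseries (log_deriv_coeff \<psi>) s * tent_kernel X h s)
      - 2 * of_real pi * \<i> * (\<Sum>n<M. log_deriv_coeff \<psi> n * of_real (tent X h (real n)))) \<le> D / T"
proof -
  define m where "m = (\<Sum>n. mangoldt n * real n powr (- 2) :: real)"
  define P where "P = dseries (log_deriv_coeff \<psi>)"
  define S where "S Y = 2 * of_real pi * \<i> * (\<Sum>n<M. log_deriv_coeff \<psi> n * of_real (max 0 (Y - real n)))" for Y
  show thesis
  proof (rule that[of "8 * m * (X + 2 * h) powr 3 + 2 * (8 * m * (X + h) powr 3) + 8 * m * X powr 3"])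
    fix T :: real assume T: "T \<ge> 3"
    define J where "J Y = contour_integral (vline 2 T) (\<lambda>s. P s * cesaro Y s)" for Y
    have seg: "closed_segment (Complex 2 (- T)) (Complex 2 T) = {z. Re z = 2 \<and> \<bar>Im z\<bar> \<le> T}"
      using T by (intro closed_segment_vline) auto
    have "P holomorphic_on {s. Re s > 1}"
      unfolding P_def using has_field_derivative_dseries[OF subpolynomial_log_deriv_coeff[OF ch]] open_halfspace_Re_gt[of 1]
      by (auto simp: holomorphic_on_open)
    then have "continuous_on (closed_segment (Complex 2 (- T)) (Complex 2 T)) P"
      by (rule continuous_on_subset[OF holomorphic_on_imp_continuous_on]) (auto simp: seg)
    then have int: "(\<lambda>s. P s * cesaro Y s) contour_integrable_on vline 2 T" if "Y > 0" for Y
      using that by (intro contour_integrable_continuous_linepath continuous_on_mult continuous_on_cesaro) (auto simp: seg)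
    have J: "norm (J Y - S Y) \<le> 8 * m * Y powr 3 / T" if "0 < Y" "Y \<le> X + 2 * h" for Y
      unfolding J_def S_def P_def m_def using that M by (intro contour_integral_dseries_cesaro[OF ch _ T]) auto
    have "((\<lambda>s. P s * cesaro (X + 2 * h) s - 2 * (P s * cesaro (X + h) s) + P s * cesaro X s) has_contour_integral
        (J (X + 2 * h) - 2 * J (X + h) + J X)) (vline 2 T)"
      unfolding J_def using X h
      by (intro has_contour_integral_add has_contour_integral_diff has_contour_integral_lmul has_contour_integral_integral int) auto
    then have e1: "contour_integral (vline 2 T) (\<lambda>s. P s * tent_kernel X h s) = J (X + 2 * h) - 2 * J (X + h) + J X"
      by (intro contour_integral_unique) (simp add: tent_kernel_def algebra_simps)
    have e2: "2 * of_real pi * \<i> * (\<Sum>n<M. log_deriv_coeff \<psi> n * of_real (tent X h (real n))) = S (X + 2 * h) - 2 * S (X + h) + S X"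
      by (simp add: S_def tent_def sum_distrib_left algebra_simps sum.distrib sum_subtractf)
    have "norm (contour_integral (vline 2 T) (\<lambda>s. P s * tent_kernel X h s)
        - 2 * of_real pi * \<i> * (\<Sum>n<M. log_deriv_coeff \<psi> n * of_real (tent X h (real n)))) =
        norm ((J (X + 2 * h) - S (X + 2 * h)) - 2 * (J (X + h) - S (X + h)) + (J X - S X))"
      unfolding e1 e2 by (simp add: algebra_simps)
    also have "\<dots> \<le> norm (J (X + 2 * h) - S (X + 2 * h)) + 2 * norm (J (X + h) - S (X + h)) + norm (J X - S X)"
      using norm_triangle_ineq[of "(J (X + 2 * h) - S (X + 2 * h)) - 2 * (J (X + h) - S (X + h))" "J X - S X"]
        norm_triangle_ineq4[of "J (X + 2 * h) - S (X + 2 * h)" "2 * (J (X + h) - S (X + h))"]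
      by (simp only: norm_mult norm_numeral)
    also have "\<dots> \<le> 8 * m * (X + 2 * h) powr 3 / T + 2 * (8 * m * (X + h) powr 3 / T) + 8 * m * X powr 3 / T"
      using X h by (intro add_mono mult_left_mono J) auto
    also have "\<dots> = (8 * m * (X + 2 * h) powr 3 + 2 * (8 * m * (X + h) powr 3) + 8 * m * X powr 3) / T"
      by (simp add: add_divide_distrib)
    finally show "norm (contour_integral (vline 2 T) (\<lambda>s. dseries (log_deriv_coeff \<psi>) s * tent_kernel X h s)
      - 2 * of_real pi * \<i> * (\<Sum>n<M. log_deriv_coeff \<psi> n * of_real (tent X h (real n))))
      \<le> (8 * m * (X + 2 * h) powr 3 + 2 * (8 * m * (X + h) powr 3) + 8 * m * X powr 3) / T"
      by (simp only: P_def)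
  qed
qed

text \<open>Under GRH, the only possible pole of \<open>L'/L\<close> to the right of the critical line is at 1.\<close>

lemma GRH_contour_integral_rectpath:
  assumes GRH and ch: "dirichlet_character N \<psi>" and K: "K holomorphic_on {s. Re s > 1 / 2}"
    and a: "1 / 2 < a" "a < 1" and T: "T > 0"
  shows "((\<lambda>s. - (deriv (dirichlet_L \<psi>) s / dirichlet_L \<psi> s) * K s) has_contour_integral
           (2 * of_real pi * \<i> * (of_bool (principal_character \<psi>) * K 1)))
         (rectpath (Complex a (- T)) (Complex 2 T))"
    and "continuous_on (path_image (rectpath (Complex a (- T)) (Complex 2 T)))
           (\<lambda>s. - (deriv (dirichlet_L \<psi>) s / dirichlet_L \<psi> s) * K s)"
proof -
  let ?S = "{s. Re s > 1 / 2}" and ?R = "rectpath (Complex a (- T)) (Complex 2 T)"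
  let ?g = "\<lambda>s. - (deriv (dirichlet_L \<psi>) s / dirichlet_L \<psi> s) * K s"
  have S: "convex ?S" "open ?S" "cbox (Complex a (- T)) (Complex 2 T) \<subseteq> ?S"
    using a by (simp only: convex_halfspace_Re_gt, simp only: open_halfspace_Re_gt, auto simp: in_cbox_complex_iff)
  have img: "path_image ?R \<subseteq> ?S - {1}"
    using a T by (auto simp: path_image_rectpath)
  have hol1: "dirichlet_L \<psi> holomorphic_on - {1}"
    by (rule holomorphic_on_subset[OF dirichlet_L_continuation(1)[OF ch]]) auto
  have "deriv (dirichlet_L \<psi>) holomorphic_on ?S - {1}"
    by (rule holomorphic_on_subset[OF holomorphic_deriv[OF hol1]]) auto
  moreover have "dirichlet_L \<psi> holomorphic_on ?S - {1}"
    by (rule holomorphic_on_subset[OF hol1]) auto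
  moreover have "K holomorphic_on ?S - {1}"
    by (rule holomorphic_on_subset[OF K]) auto
  moreover have "dirichlet_L \<psi> s \<noteq> 0" if "s \<in> ?S - {1}" for s
    using that by (intro GRH_nonzero[OF assms(1) ch]) auto
  ultimately have "?g holomorphic_on ?S - {1}"
    by (intro holomorphic_on_mult holomorphic_on_minus holomorphic_on_divide)
  then show "continuous_on (path_image ?R) ?g"
    using img by (blast intro: holomorphic_on_imp_continuous_on continuous_on_subset)
  show "(?g has_contour_integral (2 * of_real pi * \<i> * (of_bool (principal_character \<psi>) * K 1))) ?R"
  proof (cases "principal_character \<psi>")
    case False
    have hol: "dirichlet_L \<psi> holomorphic_on UNIV"
      using dirichlet_L_continuation(1)[OF ch] False by simp
    have "deriv (dirichlet_L \<psi>) holomorphic_on ?S"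
      by (rule holomorphic_on_subset[OF holomorphic_deriv[OF hol]]) auto
    moreover have "dirichlet_L \<psi> holomorphic_on ?S"
      by (rule holomorphic_on_subset[OF hol]) auto
    moreover have "dirichlet_L \<psi> s \<noteq> 0" if "s \<in> ?S" for s
      using that False by (intro GRH_nonzero[OF assms(1) ch]) auto
    ultimately have "?g holomorphic_on ?S"
      using K by (intro holomorphic_on_mult holomorphic_on_minus holomorphic_on_divide)
    then have "(?g has_contour_integral 0) ?R"
      using S a T by (intro has_contour_integral_rectpath_0) auto
    then show ?thesis
      using False by simp
  next
    case True
    obtain E C where E: "E holomorphic_on UNIV" "\<And>s. s \<noteq> 1 \<Longrightarrow> E s = (s - 1) * dirichlet_L \<psi> s"
      "E 1 = 0 \<longleftrightarrow> \<not> principal_character \<psi>"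
      by (rule entire_multiple_of_L[OF ch]) (rule that)
    have E_nz: "E s \<noteq> 0" if "s \<in> ?S" for s
    proof (cases "s = 1")
      case False
      then have "dirichlet_L \<psi> s \<noteq> 0"
        using that by (intro GRH_nonzero[OF assms(1) ch]) auto
      then show ?thesis
        using E(2)[OF False] False by simp
    qed (use E(3) True in simp)
    define f where "f s = K s - (s - 1) * (deriv E s / E s) * K s" for s
    have "deriv E holomorphic_on ?S" "E holomorphic_on ?S"
      by (rule holomorphic_on_subset[OF holomorphic_deriv[OF E(1)]] holomorphic_on_subset[OF E(1)]; simp)+
    then have "f holomorphic_on ?S"
      unfolding f_def using K E_nz
      by (intro holomorphic_on_diff holomorphic_on_mult holomorphic_on_divide holomorphic_on_ident holomorphic_on_const)
    then have "((\<lambda>s. f s / (s - 1)) has_contour_integral (2 * of_real pi * \<i> * f 1)) ?R"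
      using S a T by (intro has_contour_integral_rectpath_residue[of ?S]) auto
    then have "(?g has_contour_integral (2 * of_real pi * \<i> * f 1)) ?R"
    proof (rule has_contour_integral_eq)
      fix s assume "s \<in> path_image ?R"
      then have s: "s \<in> ?S" "s \<noteq> 1"
        using img by blast+
      have "dirichlet_L \<psi> s \<noteq> 0"
        using s by (intro GRH_nonzero[OF assms(1) ch]) auto
      have "(k - u * q * k) / u = - (q - 1 / u) * k" if "u \<noteq> 0" for u q k :: complex
        using that by (simp add: field_simps)
      then have "f s / (s - 1) = - (deriv E s / E s - 1 / (s - 1)) * K s"
        unfolding f_def using s(2) by (metis eq_iff_diff_eq_0)
      moreover have "deriv (dirichlet_L \<psi>) s / dirichlet_L \<psi> s = deriv E s / E s - 1 / (s - 1)"
        by (rule log_deriv_L_eq[OF ch E(2) s(2) \<open>dirichlet_L \<psi> s \<noteq> 0\<close>])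
      ultimately show "f s / (s - 1) = ?g s"
        by (simp only:)
    qed
    then show ?thesis
      using True by (simp add: f_def)
  qed
qed

lemma contour_integral_vline_bound:
  assumes T: "T > 0" and T0: "T0 \<ge> 1" and A: "A \<ge> 0"
    and cont: "continuous_on (closed_segment (Complex a (- T)) (Complex a T)) g"
    and bound: "\<And>t. norm (g (Complex a t)) \<le> A * (ln (\<bar>t\<bar> + T0) / (\<bar>t\<bar> + T0)\<^sup>2)"
  shows "norm (contour_integral (vline a T) g) \<le> 2 * A * (ln T0 + 1) / T0"
proof -
  let ?f = "\<lambda>t. ln (t + T0) / (t + T0)\<^sup>2"
  \<comment> \<open>\<open>- (ln v + 1) / v\<close> is a primitive of \<open>ln v / v\<^sup>2\<close>.\<close>
  define G where "G t = - (ln (t + T0) + 1) / (t + T0)" for t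
  have "(?f has_integral (G T - G 0)) {0..T}"
  proof (rule fundamental_theorem_of_calculus)
    fix t :: real assume "t \<in> {0..T}"
    then have t: "t + T0 > 0"
      using T0 by auto
    have "(G has_real_derivative ?f t) (at t within {0..T})"
      unfolding G_def using t
      by (auto intro!: derivative_eq_intros simp: field_simps power2_eq_square)
    then show "(G has_vector_derivative ?f t) (at t within {0..T})"
      by (simp add: has_real_derivative_iff_has_vector_derivative)
  qed (use T in auto)
  then have 1: "((\<lambda>t. ?f \<bar>t\<bar>) has_integral (G T - G 0)) {0..T}"
    by (rule has_integral_eq[rotated]) auto
  then have "((\<lambda>t. ?f \<bar>- t\<bar>) has_integral (G T - G 0)) {- T..- 0}"
    by (subst has_integral_reflect_real)
  then have 2: "((\<lambda>t. ?f \<bar>t\<bar>) has_integral (G T - G 0)) {- T..0}"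
    by simp
  have 3: "((\<lambda>t. ?f \<bar>t\<bar>) has_integral ((G T - G 0) + (G T - G 0))) {- T..T}"
    by (rule has_integral_combine[OF _ _ 2 1]) (use T in auto)
  have 4: "((\<lambda>t. A * ?f \<bar>t\<bar>) has_integral A * ((G T - G 0) + (G T - G 0))) {- T..T}"
    by (rule has_integral_mult_right[OF 3])
  have "contour_integral (vline a T) g = \<i> * integral {- T..T} (\<lambda>t. g (Complex a t))"
    using T by (intro contour_integral_linepath_same_Re) auto
  then have "norm (contour_integral (vline a T) g) = norm (integral {- T..T} (\<lambda>t. g (Complex a t)))"
    by (simp add: norm_mult)
  also have "\<dots> \<le> integral {- T..T} (\<lambda>t. A * ?f \<bar>t\<bar>)"
  proof (rule integral_norm_bound_integral)
    have "continuous_on {- T..T} (\<lambda>t. g (Complex a t))"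
    proof (rule continuous_on_compose2[OF cont])
      show "continuous_on {- T..T} (Complex a)"
        unfolding Complex_eq by (intro continuous_intros)
      show "Complex a ` {- T..T} \<subseteq> closed_segment (Complex a (- T)) (Complex a T)"
        using T by (subst closed_segment_vline) auto
    qed
    then show "(\<lambda>t. g (Complex a t)) integrable_on {- T..T}"
      by (rule integrable_continuous_real)
    show "(\<lambda>t. A * ?f \<bar>t\<bar>) integrable_on {- T..T}"
      using 4 by blast
  qed (rule bound)
  also have "\<dots> = A * ((G T - G 0) + (G T - G 0))"
    using 4 by (rule integral_unique)
  also have "\<dots> \<le> A * (2 * ((ln T0 + 1) / T0))"
  proof (intro mult_left_mono A)
    have "ln (T + T0) \<ge> 0"
      using T T0 by simp
    then have "- (ln (T + T0) + 1) \<le> 0"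
      by linarith
    then have "G T \<le> 0"
      unfolding G_def using T T0 by (intro divide_nonpos_pos) auto
    moreover have "G 0 = - ((ln T0 + 1) / T0)"
      by (simp only: G_def add_0 minus_divide_left)
    ultimately show "(G T - G 0) + (G T - G 0) \<le> 2 * ((ln T0 + 1) / T0)"
      by linarith
  qed
  also have "A * (2 * (y / T0)) = 2 * A * y / T0" for y
    by simp
  finally show ?thesis .
qed

text \<open>
  The line of integration is moved from \<open>Re s = 2\<close> to \<open>Re s = 1 / 2 + 1 / ln X\<close>. There the kernel is
  concentrated on \<open>\<bar>Im s\<bar> \<le> X / h\<close> and of size \<open>h\<^sup>2 / sqrt X\<close>, and \<open>L'/L\<close> is \<open>O(ln\<^sup>2 X)\<close>.
\<close>

theorem GRH_tent_sum:
  assumes GRH and ch: "dirichlet_character N \<psi>"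
  obtains B where "B > 0"
    "\<And>X h M. exp 4 \<le> X \<Longrightarrow> 1 \<le> h \<Longrightarrow> 3 * h \<le> X \<Longrightarrow> X + 2 * h \<le> real M \<Longrightarrow>
       norm ((\<Sum>n<M. log_deriv_coeff \<psi> n * of_real (tent X h (real n)))
         - of_bool (principal_character \<psi>) * of_real (h\<^sup>2)) \<le> B * h * sqrt X * (ln X)\<^sup>2"
proof -
  obtain B where B: "B > 0"
    "\<And>\<delta> s. 0 < \<delta> \<Longrightarrow> \<delta> \<le> 1 \<Longrightarrow> 1 / 2 + \<delta> \<le> Re s \<Longrightarrow> Re s \<le> 3 \<Longrightarrow> \<delta> \<le> norm (s - 1) \<Longrightarrow>
       norm (deriv (dirichlet_L \<psi>) s / dirichlet_L \<psi> s) \<le> B / \<delta> * ln (\<bar>Im s\<bar> + 3)"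
    by (rule GRH_log_deriv_bound[OF assms]) (rule that, assumption, blast)
  show thesis
  proof (rule that[of "1728 * B"])
    show "1728 * B > 0"
      using B by simp
    fix X h :: real and M :: nat
    assume X: "exp 4 \<le> X" and h: "1 \<le> h" "3 * h \<le> X" and M: "X + 2 * h \<le> real M"
    define W where "W = (\<Sum>n<M. log_deriv_coeff \<psi> n * of_real (tent X h (real n)))"
    define e :: complex where "e = of_bool (principal_character \<psi>)"
    \<comment> \<open>With this choice, \<open>X powr (1 / 2 + \<delta>)\<close> is \<open>sqrt X\<close> up to the factor \<open>exp 1\<close>.\<close>
    define \<delta> where "\<delta> = 1 / ln X"
    define a where "a = 1 / 2 + \<delta>"
    define T0 where "T0 = X / h"
    define g where "g s = - (deriv (dirichlet_L \<psi>) s / dirichlet_L \<psi> s) * tent_kernel X h s" for s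
    have X0: "X > 0" "X \<ge> 1"
      using X h by auto
    have lnX: "ln X \<ge> 4"
      using X X0 by (simp add: ln_ge_iff)
    have \<delta>: "0 < \<delta>" "\<delta> \<le> 1 / 4"
      using lnX by (auto simp: \<delta>_def field_simps)
    have a: "1 / 2 < a" "a \<le> 3 / 4"
      using \<delta> by (auto simp: a_def)
    have T0: "3 \<le> T0" "T0 \<le> X"
      using h X0 by (auto simp: T0_def field_simps)
    have log_deriv: "norm (deriv (dirichlet_L \<psi>) s / dirichlet_L \<psi> s) \<le> B / \<delta> * ln (\<bar>Im s\<bar> + 3)"
      if "a \<le> Re s" "Re s \<le> 2" "\<bar>Im s\<bar> \<ge> 3 \<or> Re s = a" for s
    proof (rule B(2))
      have "\<delta> \<le> \<bar>Im (s - 1)\<bar> \<or> \<delta> \<le> \<bar>Re (s - 1)\<bar>"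
        using that a \<delta> by auto
      then show "\<delta> \<le> norm (s - 1)"
        using abs_Re_le_cmod[of "s - 1"] abs_Im_le_cmod[of "s - 1"] by linarith
    qed (use that \<delta> in \<open>auto simp: a_def\<close>)
    have "tent_kernel X h holomorphic_on {s. Re s > 1 / 2}"
      using X0 h by (intro holomorphic_tent_kernel) auto
    note K = GRH_contour_integral_rectpath[OF assms this a(1)]
    obtain D where "\<And>T. T \<ge> 3 \<Longrightarrow> norm (contour_integral (vline 2 T) (\<lambda>s. dseries (log_deriv_coeff \<psi>) s * tent_kernel X h s)
      - 2 * of_real pi * \<i> * (\<Sum>n<M. log_deriv_coeff \<psi> n * of_real (tent X h (real n)))) \<le> D / T"
      by (rule contour_integral_dseries_tent_kernel[OF ch X0(1) _ M]) (use h in simp, rule that)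
    note D = this[folded W_def]
    have right: "norm (contour_integral (vline 2 T) g - 2 * of_real pi * \<i> * W) \<le> D / T" if T: "T \<ge> 3" for T
    proof -
      have "contour_integral (vline 2 T) g = contour_integral (vline 2 T) (\<lambda>s. dseries (log_deriv_coeff \<psi>) s * tent_kernel X h s)"
      proof (rule contour_integral_eq)
        fix s assume "s \<in> path_image (vline 2 T)"
        then have s: "Re s > 1"
          using T closed_segment_vline[of T 2] by simp
        have "deriv (dirichlet_L \<psi>) s = - (dirichlet_L \<psi> s * dseries (log_deriv_coeff \<psi>) s)"
          by (rule DERIV_imp_deriv[OF dirichlet_L_log_deriv[OF ch s]])
        then show "g s = dseries (log_deriv_coeff \<psi>) s * tent_kernel X h s"
          using dirichlet_L_nonzero[OF ch s] by (simp add: g_def)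
      qed
      then show ?thesis
        using D[OF T] by simp
    qed
    define A where "A = B / \<delta> * (144 * X powr (a + 1))"
    have A: "A \<ge> 0"
      using B \<delta> by (simp add: A_def)
    have left: "norm (contour_integral (vline a T) g) \<le> 2 * A * (ln T0 + 1) / T0" if T: "T \<ge> 3" for T
    proof (rule contour_integral_vline_bound)
      show "continuous_on (closed_segment (Complex a (- T)) (Complex a T)) g"
        unfolding g_def
      proof (rule continuous_on_subset[OF K(2)])
        show "closed_segment (Complex a (- T)) (Complex a T) \<subseteq> path_image (rectpath (Complex a (- T)) (Complex 2 T))"
          using T a by (subst closed_segment_vline) (auto simp: path_image_rectpath)
      qed (use T a in auto)
      fix t :: real
      define s where "s = Complex a t"
      have s: "Re s = a" "Im s = t"
        by (simp_all add: s_def)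
      have "norm (g s) \<le> (B / \<delta> * ln (\<bar>t\<bar> + 3)) * (144 * X powr (a + 1) / (T0 + \<bar>t\<bar>)\<^sup>2)"
        unfolding g_def norm_mult norm_minus_cancel
        using log_deriv[of s] norm_tent_kernel_le[of X h s] s a X0 h B(1) \<delta>
        by (intro mult_mono) (auto simp: T0_def)
      also have "\<dots> \<le> (B / \<delta> * ln (\<bar>t\<bar> + T0)) * (144 * X powr (a + 1) / (T0 + \<bar>t\<bar>)\<^sup>2)"
        using T0 B(1) \<delta> by (intro mult_right_mono mult_left_mono ln_mono) auto
      also have "\<dots> = A * (ln (\<bar>t\<bar> + T0) / (\<bar>t\<bar> + T0)\<^sup>2)"
        by (simp add: A_def add.commute)
      finally show "norm (g (Complex a t)) \<le> A * (ln (\<bar>t\<bar> + T0) / (\<bar>t\<bar> + T0)\<^sup>2)"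
        by (simp only: s_def)
    qed (use T T0 A in auto)
    define H where "H T = B / \<delta> * ln (T + 3) * (4 * (3 * X) powr 3 / T\<^sup>2)" for T
    have shift: "norm (contour_integral (vline 2 T) g - contour_integral (vline a T) g - 2 * of_real pi * \<i> * (e * of_real (h\<^sup>2))) \<le> 2 * (2 - a) * H T"
      if T: "T \<ge> 3" for T
    proof (rule rectangle_difference)
      show "continuous_on (path_image (rectpath (Complex a (- T)) (Complex 2 T))) g"
        unfolding g_def using K(2)[of T] a T by simp
      show "(g has_contour_integral 2 * of_real pi * \<i> * (e * of_real (h\<^sup>2))) (rectpath (Complex a (- T)) (Complex 2 T))"
        using K(1)[of T] a T tent_kernel_1[of X h] X0 h unfolding g_def e_def by simp
      show "H T \<ge> 0"
        unfolding H_def using B(1) \<delta> T by (intro mult_nonneg_nonneg) auto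
      fix s :: complex assume s: "a \<le> Re s" "Re s \<le> 2" "\<bar>Im s\<bar> = T"
      have "norm (tent_kernel X h s) \<le> 4 * (3 * X) powr (Re s + 1) / (Im s)\<^sup>2"
        using s a T X0 h by (intro norm_tent_kernel_le_large) auto
      also have "\<dots> \<le> 4 * (3 * X) powr 3 / (Im s)\<^sup>2"
        using s X0 by (intro divide_right_mono mult_left_mono powr_mono) auto
      also have "(Im s)\<^sup>2 = T\<^sup>2"
        using s(3) by (metis power2_abs)
      finally show "norm (g s) \<le> H T"
        unfolding g_def H_def norm_mult norm_minus_cancel
        using log_deriv[of s] s T B(1) \<delta> by (intro mult_mono) auto
    qed (use a T in auto)
    have bound_T: "norm (2 * of_real pi * \<i> * W - 2 * of_real pi * \<i> * (e * of_real (h\<^sup>2)))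
        \<le> D / T + 2 * (2 - a) * H T + 2 * A * (ln T0 + 1) / T0" if T: "T \<ge> 3" for T
    proof -
      have "norm (w - v) \<le> norm (r - w) + norm (r - l - v) + norm l" for w v r l :: complex
        using norm_triangle_ineq4[of "r - l - v" "r - w"] norm_triangle_ineq[of "r - l - v - (r - w)" l]
        by (simp add: algebra_simps)
      from this[of "2 * of_real pi * \<i> * W" "2 * of_real pi * \<i> * (e * of_real (h\<^sup>2))" "contour_integral (vline 2 T) g" "contour_integral (vline a T) g"]
      show ?thesis
        using right[OF T] shift[OF T] left[OF T] by linarith
    qed
    have "((\<lambda>T. D / T + 2 * (2 - a) * (B / \<delta> * ln (T + 3) * (4 * (3 * X) powr 3 / T\<^sup>2)) + 2 * A * (ln T0 + 1) / T0)
        \<longlongrightarrow> 0 + 0 + 2 * A * (ln T0 + 1) / T0) at_top"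
    proof (intro tendsto_add tendsto_const)
      show "((\<lambda>T. D / T) \<longlongrightarrow> 0) at_top"
        by real_asymp
      have "((\<lambda>T::real. ln (T + 3) / T\<^sup>2) \<longlongrightarrow> 0) at_top"
        by real_asymp
      then have "((\<lambda>T. 2 * (2 - a) * (B / \<delta> * (4 * (3 * X) powr 3)) * (ln (T + 3) / T\<^sup>2)) \<longlongrightarrow> 2 * (2 - a) * (B / \<delta> * (4 * (3 * X) powr 3)) * 0) at_top"
        by (intro tendsto_mult tendsto_const)
      then show "((\<lambda>T. 2 * (2 - a) * (B / \<delta> * ln (T + 3) * (4 * (3 * X) powr 3 / T\<^sup>2))) \<longlongrightarrow> 0) at_top"
        by (simp add: mult_ac)
    qed
    then have lim: "norm (2 * of_real pi * \<i> * W - 2 * of_real pi * \<i> * (e * of_real (h\<^sup>2))) \<le> 0 + 0 + 2 * A * (ln T0 + 1) / T0"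
    proof (rule tendsto_lowerbound)
      show "\<forall>\<^sub>F T in at_top. norm (2 * of_real pi * \<i> * W - 2 * of_real pi * \<i> * (e * of_real (h\<^sup>2)))
          \<le> D / T + 2 * (2 - a) * (B / \<delta> * ln (T + 3) * (4 * (3 * X) powr 3 / T\<^sup>2)) + 2 * A * (ln T0 + 1) / T0"
        using bound_T unfolding H_def by (intro eventually_at_top_linorderI[of 3]) auto
    qed auto
    have "norm (2 * of_real pi * \<i> * W - 2 * of_real pi * \<i> * (e * of_real (h\<^sup>2))) = 2 * pi * norm (W - e * of_real (h\<^sup>2))"
    proof -
      have "2 * of_real pi * \<i> * W - 2 * of_real pi * \<i> * (e * of_real (h\<^sup>2)) = (2 * of_real pi * \<i>) * (W - e * of_real (h\<^sup>2))"
        by (simp add: right_diff_distrib mult.assoc)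
      then show ?thesis
        by (simp only: norm_mult) simp
    qed
    moreover have "1 * norm (W - e * of_real (h\<^sup>2)) \<le> 2 * pi * norm (W - e * of_real (h\<^sup>2))"
      using pi_gt3 by (intro mult_right_mono) auto
    ultimately have "norm (W - e * of_real (h\<^sup>2)) \<le> 2 * A * (ln T0 + 1) / T0"
      using lim by linarith
    also have "\<dots> \<le> 2 * A * (2 * ln X) / T0"
    proof -
      have "ln T0 \<le> ln X"
        using T0 by (intro ln_mono) auto
      then have "ln T0 + 1 \<le> 2 * ln X"
        using lnX by linarith
      then show ?thesis
        using A T0 by (intro divide_right_mono mult_left_mono) auto
    qed
    also have "\<dots> = 576 * B * (ln X)\<^sup>2 * h * (X powr (a + 1) / X)"
      using X0 h by (simp add: A_def \<delta>_def T0_def power2_eq_square)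
    also have "X powr (a + 1) / X = sqrt X * exp 1"
    proof -
      have "X powr (a + 1) / X = X powr a"
        using X0 by (simp add: powr_add)
      moreover have "X powr a = X powr (1 / 2) * X powr \<delta>"
        by (simp add: a_def powr_add)
      moreover have "X powr \<delta> = exp 1"
      proof -
        have "X \<noteq> 1"
          using lnX by auto
        then show ?thesis
          using X0 by (simp add: powr_def \<delta>_def)
      qed
      ultimately show ?thesis
        using X0 by (simp add: powr_half_sqrt)
    qed
    also have "576 * B * (ln X)\<^sup>2 * h * (sqrt X * exp 1) \<le> 576 * B * (ln X)\<^sup>2 * h * (sqrt X * 3)"
      using exp_le B(1) h X0 by (intro mult_left_mono) auto
    also have "\<dots> = 1728 * B * h * sqrt X * (ln X)\<^sup>2"
      by simp
    finally show "norm ((\<Sum>n<M. log_deriv_coeff \<psi> n * of_real (tent X h (real n)))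
         - of_bool (principal_character \<psi>) * of_real (h\<^sup>2)) \<le> 1728 * B * h * sqrt X * (ln X)\<^sup>2"
      by (simp only: W_def e_def)
  qed
qed

section \<open>Primes in short intervals of an arithmetic progression\<close>

text \<open>
  A crude bound suffices for the proper prime powers \<open>p ^ j\<close> with \<open>j \<ge> 2\<close>: there are at most
  \<open>sqrt M\<close> choices for \<open>p\<close> and \<open>2 ln M\<close> choices for \<open>j\<close>.
\<close>

lemma sum_mangoldt_nonprime_le:
  assumes M: "M \<ge> 1"
  shows "(\<Sum>n | n < M \<and> \<not> prime n. mangoldt n :: real) \<le> 2 * sqrt (real M) * (ln (real M))\<^sup>2"
proof -
  define A where "A = {1..nat \<lfloor>sqrt (real M)\<rfloor>}"
  define J where "J = {1..nat \<lfloor>2 * ln (real M)\<rfloor>}"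
  define Q where "Q = {n. n < M \<and> \<not> prime n \<and> primepow n}"
  have lnM: "ln (real M) \<ge> 0"
    using M by simp
  have Q_sub: "Q \<subseteq> (\<lambda>(p, j). p ^ j) ` (A \<times> J)"
  proof
    fix n assume "n \<in> Q"
    then have n: "n < M" "\<not> prime n" "primepow n"
      by (auto simp: Q_def)
    then obtain p j where pj: "prime p" "j > 0" "n = p ^ j"
      by (auto simp: primepow_def)
    have p2: "p \<ge> 2"
      using pj(1) by (rule prime_ge_2_nat)
    have "j \<noteq> 1"
      using pj n(2) by auto
    then have j2: "j \<ge> 2"
      using pj(2) by simp
    have "p ^ 2 \<le> p ^ j"
      using p2 j2 by (intro power_increasing) auto
    then have "(real p)\<^sup>2 \<le> real M"
      using n(1) pj(3) by (metis less_imp_le of_nat_le_iff of_nat_power order_trans)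
    then have "real p \<le> sqrt (real M)"
      by (rule real_le_rsqrt)
    then have "p \<in> A"
      using p2 by (auto simp: A_def le_nat_floor)
    have "2 ^ j \<le> p ^ j"
      using p2 by (intro power_mono) auto
    then have "(2::real) ^ j \<le> real M"
      using n(1) pj(3) by (metis less_imp_le of_nat_le_iff of_nat_numeral of_nat_power order_trans)
    then have "ln ((2::real) ^ j) \<le> ln (real M)"
      by (intro ln_mono) auto
    then have "real j * ln 2 \<le> ln (real M)"
      by (simp add: ln_realpow)
    moreover have "real j * (1 / 2) \<le> real j * ln 2"
      using ln2_ge_two_thirds by (intro mult_left_mono) auto
    ultimately have "real j \<le> 2 * ln (real M)"
      by linarith
    then have "j \<in> J"
      using pj(2) by (auto simp: J_def le_nat_floor)
    then show "n \<in> (\<lambda>(p, j). p ^ j) ` (A \<times> J)"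
      using \<open>p \<in> A\<close> pj(3) by auto
  qed
  have "card Q \<le> card (A \<times> J)"
    using surj_card_le[OF _ Q_sub] by (simp add: A_def J_def)
  then have "real (card Q) \<le> real (card A) * real (card J)"
    by (metis card_cartesian_product of_nat_le_iff of_nat_mult)
  also have "\<dots> \<le> sqrt (real M) * (2 * ln (real M))"
    using lnM by (intro mult_mono) (auto simp: A_def J_def)
  finally have card_Q: "real (card Q) \<le> sqrt (real M) * (2 * ln (real M))" .
  have "finite {n. n < M \<and> \<not> prime n}"
    by (rule finite_subset[of _ "{..<M}"]) auto
  then have "(\<Sum>n | n < M \<and> \<not> prime n. mangoldt n :: real) = (\<Sum>n\<in>Q. mangoldt n)"
    by (intro sum.mono_neutral_right) (auto simp: Q_def mangoldt_def)
  also have "\<dots> \<le> (\<Sum>n\<in>Q. ln (real M))"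
  proof (rule sum_mono)
    fix n assume n: "n \<in> Q"
    then have "n > 0"
      using primepow_gt_0_nat by (auto simp: Q_def)
    then have "ln (real n) \<le> ln (real M)"
      using n by (intro ln_mono) (auto simp: Q_def)
    then show "mangoldt n \<le> ln (real M)"
      using mangoldt_le_ln[of n] by linarith
  qed
  also have "\<dots> \<le> (sqrt (real M) * (2 * ln (real M))) * ln (real M)"
    using card_Q lnM by (simp add: mult_right_mono)
  finally show ?thesis
    by (simp add: power2_eq_square mult_ac)
qed

text \<open>
  With \<open>h = C sqrt X ln\<^sup>2 X\<close> for large \<open>C\<close>, the main term \<open>h\<^sup>2\<close> exceeds both the error term of each
  character and the contribution of the proper prime powers, which are multiples of
  \<open>h sqrt X ln\<^sup>2 X\<close>.
\<close>

theorem GRH_primes_in_short_progression: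
  assumes GRH and N: "N > 0"
  obtains C where "C > 0"
    "\<forall>\<^sub>F X in sequentially. coprime X N \<longrightarrow>
       (\<exists>p. prime p \<and> [p = X] (mod N) \<and> X < p \<and> real p < real X + C * (sqrt (real X) * (ln (real X))\<^sup>2))"
proof -
  define Ch where "Ch = {\<psi>. dirichlet_character N \<psi>}"
  have fin: "finite Ch"
    unfolding Ch_def by (rule finite_dirichlet_characters)
  have "\<forall>\<psi>\<in>Ch. \<exists>B>0. \<forall>X h M. exp 4 \<le> X \<longrightarrow> 1 \<le> h \<longrightarrow> 3 * h \<le> X \<longrightarrow> X + 2 * h \<le> real M \<longrightarrow>
       norm ((\<Sum>n<M. log_deriv_coeff \<psi> n * of_real (tent X h (real n)))
         - of_bool (principal_character \<psi>) * of_real (h\<^sup>2)) \<le> B * h * sqrt X * (ln X)\<^sup>2"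
  proof
    fix \<psi> assume "\<psi> \<in> Ch"
    then have ch: "dirichlet_character N \<psi>"
      by (simp add: Ch_def)
    show "\<exists>B>0. \<forall>X h M. exp 4 \<le> X \<longrightarrow> 1 \<le> h \<longrightarrow> 3 * h \<le> X \<longrightarrow> X + 2 * h \<le> real M \<longrightarrow>
       norm ((\<Sum>n<M. log_deriv_coeff \<psi> n * of_real (tent X h (real n)))
         - of_bool (principal_character \<psi>) * of_real (h\<^sup>2)) \<le> B * h * sqrt X * (ln X)\<^sup>2"
      by (rule GRH_tent_sum[OF assms(1) ch]) blast
  qed
  from bchoice[OF this] obtain B where B: "\<And>\<psi>. \<psi> \<in> Ch \<Longrightarrow> B \<psi> > (0::real)"
    "\<And>\<psi> X h M. \<psi> \<in> Ch \<Longrightarrow> exp 4 \<le> X \<Longrightarrow> 1 \<le> h \<Longrightarrow> 3 * h \<le> X \<Longrightarrow> X + 2 * h \<le> real M \<Longrightarrow>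
       norm ((\<Sum>n<M. log_deriv_coeff \<psi> n * of_real (tent X h (real n)))
         - of_bool (principal_character \<psi>) * of_real (h\<^sup>2)) \<le> B \<psi> * h * sqrt X * (ln X)\<^sup>2"
    by blast
  define c where "c = real (card Ch)"
  \<comment> \<open>\<open>B\<close> accounts for the error terms and \<open>16 c\<close> for the proper prime powers.\<close>
  define C where "C = (\<Sum>\<psi>\<in>Ch. B \<psi>) + 16 * c + 1"
  have BS: "(\<Sum>\<psi>\<in>Ch. B \<psi>) \<ge> 0"
    using B(1) by (intro sum_nonneg) (auto intro: less_imp_le)
  have C1: "C \<ge> 1"
    using BS by (simp add: C_def c_def)
  show thesis
  proof (rule that[of "2 * C"])
    show "2 * C > 0"
      using C1 by simp
    have "((\<lambda>X::real. sqrt X * (ln X)\<^sup>2 / X) \<longlongrightarrow> 0) at_top"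
      by real_asymp
    then have "\<forall>\<^sub>F X in at_top. sqrt X * (ln X)\<^sup>2 / X < 1 / (3 * C)"
      using C1 by (intro order_tendstoD(2)) auto
    then have ev: "\<forall>\<^sub>F n in sequentially. sqrt (real n) * (ln (real n))\<^sup>2 / real n < 1 / (3 * C)"
      using filterlim_real_sequentially unfolding filterlim_iff by blast
    show "\<forall>\<^sub>F X in sequentially. coprime X N \<longrightarrow>
       (\<exists>p. prime p \<and> [p = X] (mod N) \<and> X < p \<and> real p < real X + 2 * C * (sqrt (real X) * (ln (real X))\<^sup>2))"
      using ev eventually_ge_at_top[of "nat \<lceil>exp 4 :: real\<rceil>"]
    proof eventually_elim
      case (elim a)
      define X where "X = real a"
      define Y where "Y = sqrt X * (ln X)\<^sup>2"
      define h where "h = C * Y"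
      have X: "exp 4 \<le> X"
        using elim(2) unfolding X_def by linarith
      have X0: "X \<ge> 5"
        using X exp_ge_add_one_self[of "4::real"] by linarith
      have lnX: "ln X \<ge> 4"
        using X X0 by (simp add: ln_ge_iff)
      have Y1: "Y \<ge> 1"
      proof -
        have "1 * 1 \<le> sqrt X * (ln X)\<^sup>2"
          using X0 lnX by (intro mult_mono one_le_power) auto
        then show ?thesis
          by (simp add: Y_def)
      qed
      have h1: "1 \<le> h"
        using mult_mono[OF C1 Y1] C1 by (simp add: h_def)
      have hX: "3 * h \<le> X"
      proof -
        have "Y / X < 1 / (3 * C)"
          using elim(1) by (simp add: X_def Y_def)
        then show ?thesis
          using C1 X0 by (simp add: h_def field_simps)
      qed
      show ?case
      proof (intro impI, rule ccontr)
        assume cop: "coprime a N"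
        assume "\<not> (\<exists>p. prime p \<and> [p = a] (mod N) \<and> a < p \<and> real p < real a + 2 * C * (sqrt (real a) * (ln (real a))\<^sup>2))"
        then have no_prime: "\<not> (X < real p \<and> real p < X + 2 * h)" if "prime p" "[p = a] (mod N)" for p
          using that by (auto simp: X_def h_def Y_def mult_ac)
        define M where "M = nat \<lceil>X + 2 * h\<rceil>"
        have M: "X + 2 * h \<le> real M" "real M \<le> X + 2 * h + 1"
          using h1 X0 unfolding M_def by linarith+
        have M_le: "real M \<le> 4 * X"
          using M(2) hX X0 h1 by linarith
        have M1: "M \<ge> 1"
          using M(1) X0 h1 by linarith
        define w where "w n = tent X h (real n)" for n
        define S where "S \<psi> = (\<Sum>n<M. log_deriv_coeff \<psi> n * of_real (w n))" for \<psi>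
        define W where "W = (\<Sum>n | n < M \<and> [n = a] (mod N). mangoldt n * w n :: real)"
        have w: "0 \<le> w n" "w n \<le> h" "w n \<noteq> 0 \<Longrightarrow> X < real n \<and> real n < X + 2 * h" for n
          using tent_bounds[of h X "real n"] h1 by (auto simp: w_def)
        have "W \<le> (\<Sum>n | n < M \<and> \<not> prime n. mangoldt n * h)"
        proof -
          have "W = (\<Sum>n | n < M \<and> [n = a] (mod N) \<and> \<not> prime n. mangoldt n * w n)"
            unfolding W_def
            by (rule sum.mono_neutral_right) (use no_prime w(3) in \<open>auto intro: finite_subset[of _ "{..<M}"]\<close>)
          also have "\<dots> \<le> (\<Sum>n | n < M \<and> [n = a] (mod N) \<and> \<not> prime n. mangoldt n * h)"
            using w mangoldt_nonneg by (intro sum_mono mult_left_mono) auto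
          also have "\<dots> \<le> (\<Sum>n | n < M \<and> \<not> prime n. mangoldt n * h)"
            using mangoldt_nonneg h1 by (intro sum_mono2) (auto intro: finite_subset[of _ "{..<M}"])
          finally show ?thesis .
        qed
        also have "\<dots> = (\<Sum>n | n < M \<and> \<not> prime n. mangoldt n) * h"
          by (simp add: sum_distrib_right)
        also have "\<dots> \<le> (2 * sqrt (real M) * (ln (real M))\<^sup>2) * h"
          using h1 by (intro mult_right_mono sum_mangoldt_nonprime_le M1) auto
        also have "\<dots> \<le> (2 * (2 * sqrt X) * (2 * ln X)\<^sup>2) * h"
        proof -
          have "sqrt (real M) \<le> sqrt (4 * X)"
            using M_le by simp
          also have "\<dots> = 2 * sqrt X"
            by (simp add: real_sqrt_mult)
          finally have 1: "sqrt (real M) \<le> 2 * sqrt X" .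
          have "4 * X \<le> X * X"
            using X0 by (intro mult_right_mono) auto
          then have "real M \<le> X\<^sup>2"
            using M_le unfolding power2_eq_square by linarith
          then have "ln (real M) \<le> ln (X\<^sup>2)"
            using M1 by (intro ln_mono) auto
          then have 2: "ln (real M) \<le> 2 * ln X"
            using X0 by (simp add: ln_realpow)
          show ?thesis
            using 1 2 M1 h1 X0 by (intro mult_mono power_mono mult_nonneg_nonneg) auto
        qed
        also have "\<dots> = 16 * h * Y"
          by (simp add: Y_def power2_eq_square)
        finally have W_le: "W \<le> 16 * h * Y" .
        have "(\<Sum>\<psi>\<in>Ch. cnj (\<psi> a) * S \<psi>) = (\<Sum>n<M. of_real (mangoldt n * w n) * (\<Sum>\<psi>\<in>Ch. cnj (\<psi> a) * \<psi> n))"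
          unfolding S_def sum_distrib_left log_deriv_coeff_def
          by (subst sum.swap) (simp add: mult_ac)
        also have "\<dots> = (\<Sum>n<M. if [n = a] (mod N) then of_real c * of_real (mangoldt n * w n) else 0)"
          unfolding Ch_def dirichlet_character_orthogonality[OF N cop]
          by (intro sum.cong refl) (simp add: c_def Ch_def)
        also have "\<dots> = of_real (c * W)"
        proof -
          have "{..<M} \<inter> {n. [n = a] (mod N)} = {n. n < M \<and> [n = a] (mod N)}"
            by auto
          then show ?thesis
            by (simp add: W_def sum.If_cases sum_distrib_left)
        qed
        finally have orth: "(\<Sum>\<psi>\<in>Ch. cnj (\<psi> a) * S \<psi>) = of_real (c * W)" .
        have main: "(\<Sum>\<psi>\<in>Ch. cnj (\<psi> a) * (of_bool (principal_character \<psi>) * of_real (h\<^sup>2))) = of_real (h\<^sup>2)"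
        proof -
          have "(\<Sum>\<psi>\<in>Ch. cnj (\<psi> a) * (of_bool (principal_character \<psi>) * of_real (h\<^sup>2))) =
              (\<Sum>\<psi>\<in>{principal_char N}. cnj (\<psi> a) * (of_bool (principal_character \<psi>) * of_real (h\<^sup>2)))"
            by (rule sum.mono_neutral_right[OF fin])
               (use principal_char(1)[OF N] principal_character_eq in \<open>auto simp: Ch_def\<close>)
          also have "\<dots> = of_real (h\<^sup>2)"
            using cop principal_char(2)[OF N] by (simp add: principal_char_def[of N a])
          finally show ?thesis .
        qed
        have "\<bar>c * W - h\<^sup>2\<bar> = norm (complex_of_real (c * W) - of_real (h\<^sup>2))"
          by (simp only: of_real_diff[symmetric] norm_of_real)
        also have "complex_of_real (c * W) - of_real (h\<^sup>2) =
            (\<Sum>\<psi>\<in>Ch. cnj (\<psi> a) * (S \<psi> - of_bool (principal_character \<psi>) * of_real (h\<^sup>2)))"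
          by (simp only: right_diff_distrib sum_subtractf orth main)
        also have "norm \<dots> \<le> (\<Sum>\<psi>\<in>Ch. B \<psi> * h * Y)"
        proof (rule sum_norm_le)
          fix \<psi> assume \<psi>: "\<psi> \<in> Ch"
          then have ch: "dirichlet_character N \<psi>"
            by (simp add: Ch_def)
          have "norm (S \<psi> - of_bool (principal_character \<psi>) * of_real (h\<^sup>2)) \<le> B \<psi> * h * sqrt X * (ln X)\<^sup>2"
            unfolding S_def w_def by (rule B(2)[OF \<psi> X h1 hX M(1)])
          then have "norm (cnj (\<psi> a)) * norm (S \<psi> - of_bool (principal_character \<psi>) * of_real (h\<^sup>2)) \<le> 1 * (B \<psi> * h * Y)"
            using dirichlet_character_norm_le[OF ch, of a] by (intro mult_mono) (auto simp: Y_def mult_ac)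
          then show "norm (cnj (\<psi> a) * (S \<psi> - of_bool (principal_character \<psi>) * of_real (h\<^sup>2))) \<le> B \<psi> * h * Y"
            by (simp add: norm_mult)
        qed
        also have "\<dots> = (\<Sum>\<psi>\<in>Ch. B \<psi>) * h * Y"
          by (simp add: sum_distrib_right)
        finally have "h\<^sup>2 \<le> c * W + (\<Sum>\<psi>\<in>Ch. B \<psi>) * h * Y"
          by linarith
        also have "c * W \<le> c * (16 * h * Y)"
          using W_le by (intro mult_left_mono) (auto simp: c_def)
        finally have "h\<^sup>2 \<le> (C - 1) * h * Y"
          by (simp add: C_def algebra_simps)
        then have "h * (C * Y) \<le> h * ((C - 1) * Y)"
          by (simp add: h_def power2_eq_square mult_ac)
        then have "C * Y \<le> (C - 1) * Y"
          using h1 by simp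
        then show False
          using Y1 by (simp add: algebra_simps)
      qed
    qed
  qed
qed

section \<open>The least shift that yields a prime\<close>

text \<open>
  The tie-break makes the minimiser unique, so that the definite description in \<open>q_min\<close> denotes it.
\<close>

lemma abs_q_min_le:
  assumes "prime (q_val k m \<epsilon> q)"
  shows "\<bar>q_min k m \<epsilon>\<bar> \<le> \<bar>q\<bar>"
proof -
  let ?P = "\<lambda>q. prime (q_val k m \<epsilon> q)"
  let ?Q = "\<lambda>q. ?P q \<and> (\<forall>q'. ?P q' \<longrightarrow> \<bar>q\<bar> \<le> \<bar>q'\<bar>) \<and> (?P (- q) \<longrightarrow> q \<ge> 0)"
  obtain r where r: "?P r" "\<And>q'. ?P q' \<Longrightarrow> nat \<bar>r\<bar> \<le> nat \<bar>q'\<bar>"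
    using ex_has_least_nat[of ?P q "\<lambda>q. nat \<bar>q\<bar>"] assms by blast
  have r': "\<bar>r\<bar> \<le> \<bar>q'\<bar>" if "?P q'" for q'
    using r(2)[OF that] by simp
  define s where "s = (if ?P (- r) then \<bar>r\<bar> else r)"
  have s: "?Q s"
  proof (cases "?P (- r)")
    case True
    then have "?P \<bar>r\<bar>"
      using r(1) by (simp add: abs_if)
    then show ?thesis
      using True r' by (simp add: s_def)
  next
    case False
    then show ?thesis
      using r(1) r' by (simp add: s_def)
  qed
  have "t = s" if t: "?Q t" for t
  proof -
    have "\<bar>t\<bar> = \<bar>s\<bar>"
      using s t by (meson order_antisym)
    then show ?thesis
      using s t by (smt (verit) add.inverse_inverse)
  qed
  then have "q_min k m \<epsilon> = s"
    unfolding q_min_def using s by (intro the_equality) blast+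
  then show ?thesis
    using s assms by blast
qed

theorem theorem1p4:
  fixes k :: nat and \<epsilon> :: int
  assumes "GRH"
    and "k \<ge> 1"
    and "\<epsilon> \<in> {1, -1}"
  shows "(\<lambda>m::nat. real_of_int \<bar>q_min k m \<epsilon>\<bar>) \<in> O(\<lambda>m. real m * (ln (real m))\<^sup>2)"
proof -
  have N: "2 * k > 0"
    using assms(2) by simp
  obtain C where C: "C > 0"
    "\<forall>\<^sub>F X in sequentially. coprime X (2 * k) \<longrightarrow>
       (\<exists>p. prime p \<and> [p = X] (mod 2 * k) \<and> X < p \<and> real p < real X + C * (sqrt (real X) * (ln (real X))\<^sup>2))"
    by (rule GRH_primes_in_short_progression[OF assms(1) N]) (rule that)
  define X where "X m = nat (int k * int m * (int m + 1) + \<epsilon>)" for m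
  have X_int: "int (X m) = int k * int m * (int m + 1) + \<epsilon>" if "m \<ge> 1" for m
  proof -
    have "1 * 1 * 2 \<le> int k * int m * (int m + 1)"
      using that assms(2) by (intro mult_mono) auto
    then show ?thesis
      using assms(3) by (auto simp: X_def)
  qed
  have X_ge: "X m \<ge> m" if "m \<ge> 1" for m
  proof -
    have "1 * int m * 2 \<le> int k * int m * (int m + 1)"
      using that assms(2) by (intro mult_mono) auto
    moreover have "\<epsilon> \<ge> -1"
      using assms(3) by auto
    ultimately have "int m \<le> int (X m)"
      using X_int[OF that] that by linarith
    then show ?thesis
      by simp
  qed
  have "filterlim X at_top sequentially"
    by (rule filterlim_at_top_mono[OF filterlim_ident])
       (use X_ge in \<open>auto intro: eventually_sequentiallyI[of 1]\<close>)
  then have ev: "\<forall>\<^sub>F m in sequentially. coprime (X m) (2 * k) \<longrightarrow>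
       (\<exists>p. prime p \<and> [p = X m] (mod 2 * k) \<and> X m < p \<and> real p < real (X m) + C * (sqrt (real (X m)) * (ln (real (X m)))\<^sup>2))"
    using C(2) unfolding filterlim_iff by blast
  have "\<forall>\<^sub>F m in sequentially. norm (real_of_int \<bar>q_min k m \<epsilon>\<bar>) \<le> (48 * C * real k) * norm (real m * (ln (real m))\<^sup>2)"
    using ev eventually_ge_at_top[of "3 * k"]
  proof eventually_elim
    case (elim m)
    have m: "m \<ge> 3"
      using elim(2) assms(2) by simp
    have "coprime (X m) (2 * k)"
    proof -
      have "even (int m * (int m + 1))"
        by simp
      then obtain z where z: "int m * (int m + 1) = 2 * z"
        by blast
      have "int (X m) = int (2 * k) * z + \<epsilon>"
        using X_int[of m] m z by (simp add: mult.assoc)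
      moreover have "coprime (int (2 * k) * z + \<epsilon>) (int (2 * k))"
      proof (rule coprimeI)
        fix d assume d: "d dvd int (2 * k) * z + \<epsilon>" "d dvd int (2 * k)"
        have "d dvd int (2 * k) * z"
          by (rule dvd_mult2[OF d(2)])
        then have "d dvd \<epsilon>"
          using d(1) dvd_add_right_iff by blast
        then show "is_unit d"
          using assms(3) by auto
      qed
      ultimately have "coprime (int (X m)) (int (2 * k))"
        by simp
      then show ?thesis
        by (simp only: coprime_int_iff)
    qed
    then obtain p where p: "prime p" "[p = X m] (mod 2 * k)" "X m < p"
      "real p < real (X m) + C * (sqrt (real (X m)) * (ln (real (X m)))\<^sup>2)"
      using elim(1) by blast
    have "int (2 * k) dvd int p - int (X m)"
      using p(2) by (metis cong_int_iff cong_iff_dvd_diff)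
    then obtain q where q: "int p - int (X m) = int (2 * k) * q"
      by blast
    have "q_val k m \<epsilon> q = int p"
      using q X_int[of m] m by (simp add: q_val_def)
    then have "prime (q_val k m \<epsilon> q)"
      using p(1) by simp
    then have "\<bar>q_min k m \<epsilon>\<bar> \<le> \<bar>q\<bar>"
      by (rule abs_q_min_le)
    also have "\<bar>q\<bar> \<le> int p - int (X m)"
    proof -
      have "q > 0"
        using q p(3) assms(2) by (metis diff_gt_0_iff_gt of_nat_less_iff zero_less_mult_pos2 zero_less_mult_pos N of_nat_0_less_iff)
      moreover have "1 * q \<le> int (2 * k) * q"
        using \<open>q > 0\<close> assms(2) by (intro mult_right_mono) auto
      ultimately show ?thesis
        using q by simp
    qed
    finally have "real_of_int \<bar>q_min k m \<epsilon>\<bar> \<le> real p - real (X m)"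
      by linarith
    also have "\<dots> \<le> C * (sqrt (real (X m)) * (ln (real (X m)))\<^sup>2)"
      using p(4) by simp
    also have "\<dots> \<le> C * ((3 * real k * real m) * (4 * ln (real m))\<^sup>2)"
    proof -
      have k1: "real k \<ge> 1" and m1: "real m \<ge> 3"
        using assms(2) m by auto
      have "real (X m) = real k * real m * (real m + 1) + real_of_int \<epsilon>"
        using arg_cong[OF X_int[of m], of real_of_int] m by simp
      also have "\<dots> \<le> real k * real m * (real m + 1) + real k * real m * 1"
        using assms(3) mult_mono[of 1 "real k" 1 "real m"] k1 m1 by auto
      also have "\<dots> = real k * real m * (real m + 2)"
        by (simp add: algebra_simps)
      also have "\<dots> \<le> real k * real m * (3 * real m)"
        using m1 by (intro mult_left_mono) auto
      also have "\<dots> \<le> (3 * real k) * (real k * real m * (3 * real m))"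
        using k1 m1 mult_right_mono[of 1 "3 * real k" "real k * real m * (3 * real m)"] by simp
      also have "\<dots> = (3 * real k * real m)\<^sup>2"
        by (simp add: power2_eq_square)
      finally have sq: "real (X m) \<le> (3 * real k * real m)\<^sup>2" .
      have X1: "real (X m) \<ge> 1"
        using X_ge[of m] m by linarith
      have 1: "sqrt (real (X m)) \<le> 3 * real k * real m"
        by (rule real_le_lsqrt) (use sq k1 m1 in auto)
      have "3 * real k * real m \<le> real m * real m"
        using elim(2) by (intro mult_right_mono) auto
      then have "(3 * real k * real m)\<^sup>2 \<le> (real m * real m)\<^sup>2"
        using k1 m1 by (intro power_mono) auto
      then have "real (X m) \<le> real m ^ 4"
        using sq by (simp add: power2_eq_square power4_eq_xxxx mult_ac)
      then have "ln (real (X m)) \<le> ln (real m ^ 4)"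
        using X1 by (intro ln_mono) auto
      then have 2: "ln (real (X m)) \<le> 4 * ln (real m)"
        using m1 by (simp add: ln_realpow)
      show ?thesis
        using 1 2 X1 C(1) k1 m1 by (intro mult_left_mono mult_mono power_mono) auto
    qed
    also have "\<dots> = (48 * C * real k) * (real m * (ln (real m))\<^sup>2)"
      by (simp add: power2_eq_square)
    finally show ?case
      by simp
  qed
  then show ?thesis
    by (rule bigoI)
qed

end
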